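(* Let $\Omega\subset\mathbb{R}^3$ be a domain, let $T>0$, and let $\overline{\varrho}\ge 0$. Suppose that the pressure $p$ satisfies $$p\in C[0,\infty)\cap C^2(0,\infty),\quad p(0)=0,\quad p'(\varrho)>0 \text{ for all }\varrho>0,\quad \lim_{\varrho\to\infty}\frac{p'(\varrho)}{\varrho^{\gamma-1}}=a>0\ \text{ for a certain }\gamma>3/2,$$ and, if $\overline\varrho=0$, suppose moreover that $p$ is asymptotically small for $\varrho\to 0$ so that $H(\varrho)=\varrho\int_{\overline\varrho}^{\varrho}\frac{p(z)}{z^2}\,dz$ is finite for any $\varrho>0$. Let $$\mathbf f\in L^\infty(0,T;L^1\cap L^\infty(\Omega;\mathbb{R}^3)).$$ Let $\varrho,\mathbf u$ be a finite energy weak solution (in the sense defined in the context) on $(0,T)\times\Omega$ to the compressible Navier-Stokes system with no-slip boundary condition and far-field density $\overline\varrho$, emanating from initial data $\varrho_0,\mathbf u_0$. Then for any $\mathbf U\in C^\infty_c([0,T]\times\Omega;\mathbb{R}^3)$ and any $r>0$ with $r-\overline\varrho\in C^\infty_c([0,T]\times\overline\Omega)$, the relative energy inequality $$\mathcal E\big([\varrho,\mathbf u]\,\big|\,[r,\mathbf U]\big)(\tau)+\int_0^\tau\!\int_\Omega\big(\mathbb S(\nabla_x\mathbf u)-\mathbb S(\nabla_x\mathbf U)\big):\big(\nabla_x\mathbf u-\nabla_x\mathbf U\big)\,dx\,dt\ \le\ \mathcal E\big([\varrho_0,\mathbf u_0]\,\big|\,[r(0,\cdot),\mathbf U(0,\cdot)]\big)+\int_0^\tau\mathcal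 R(\varrho,\mathbf u,r,\mathbf U)\,dt$$ holds for a.a. $\tau\in(0,T)$, where $$\mathcal E\big([\varrho,\mathbf u]\,\big|\,[r,\mathbf U]\big)=\int_\Omega\Big(\tfrac12\varrho|\mathbf u-\mathbf U|^2+H(\varrho)-H'(r)(\varrho-r)-H(r)\Big)\,dx$$ and $$\mathcal R(\varrho,\mathbf u,r,\mathbf U)=\int_\Omega\varrho\big(\partial_t\mathbf U+\mathbf u\cdot\nabla_x\mathbf U\big)\cdot(\mathbf U-\mathbf u)\,dx+\int_\Omega\mathbb S(\nabla_x\mathbf U):\nabla_x(\mathbf U-\mathbf u)\,dx+\int_\Omega\varrho\,\mathbf f\cdot(\mathbf u-\mathbf U)\,dx$$ $$+\int_\Omega\Big((r-\varrho)\,\partial_tH'(r)+\nabla_xH'(r)\cdot(r\mathbf U-\varrho\mathbf u)\Big)\,dx-\int_\Omega\mathrm{div}_x\mathbf U\,\big(p(\varrho)-p(r)\big)\,dx.$$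
   Context: The compressible Navier-Stokes system for the density $\varrho=\varrho(t,x)\ge 0$ and velocity $\mathbf u=\mathbf u(t,x)\in\mathbb{R}^3$ is $$\partial_t\varrho+\mathrm{div}_x(\varrho\mathbf u)=0,\qquad \partial_t(\varrho\mathbf u)+\mathrm{div}_x(\varrho\mathbf u\otimes\mathbf u)+\nabla_xp(\varrho)=\mathrm{div}_x\mathbb S(\nabla_x\mathbf u)+\varrho\mathbf f,$$ $$\mathbb S(\nabla_x\mathbf u)=\mu\Big(\nabla_x\mathbf u+\nabla_x^t\mathbf u-\tfrac23\mathrm{div}_x\mathbf u\,\mathbb I\Big)+\eta\,\mathrm{div}_x\mathbf u\,\mathbb I,$$ with constants $\mu>0$, $\eta\ge0$, boundary condition $\mathbf u|_{\partial\Omega}=0$ and, if $\Omega$ is unbounded, far-field behavior $\varrho\to\overline\varrho$, $\mathbf u\to0$ as $|x|\to\infty$, where $\overline\varrho\ge0$ is a given constant. Notation. $H(\varrho)=\varrho\int_{\overline\varrho}^\varrho\frac{p(z)}{z^2}\,dz$; $H$ and (when $\overline\varrho=0$) $H'$ are understood at $\varrho=0$ as limits. $D^{1,2}_0(\Omega)$ is the completion of $C^\infty_c(\Omega)$ in the $L^2$-norm of the gradient. $L^2+L^q(\Omega)$ denotes the sum space. $C_{\rm weak}([0,T];X)$ is the space of weakly continuous functions with values in $X$. $C^\infty_c([0,T]\times\Omega)$ (resp. $C^\infty_c([0,T]\times\overline\Omega)$) denotes smooth functions with compact support in $[0,T]\times\Omega$ (resp. in $[0,T]\times\overline\Omega$);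 they need not vanish at $t=0$ or $t=T$ (nor, in the second case, on $\partial\Omega$). Definition (finite energy weak solution). $\varrho,\mathbf u$ is a finite energy weak solution emanating from the initial data $\varrho_0,\mathbf u_0$ if: (i) $\varrho-\overline\varrho\in L^\infty(0,T;L^2+L^\gamma(\Omega))$, $\varrho\ge0$ a.a. in $(0,T)\times\Omega$; $\mathbf u\in L^2(0,T;D^{1,2}_0(\Omega;\mathbb{R}^3))$; $\varrho\mathbf u\in L^\infty(0,T;L^2+L^{2\gamma/(\gamma+1)}(\Omega;\mathbb{R}^3))$; $p(\varrho)\in L^1_{\rm loc}([0,T]\times\Omega)$; (ii) $\varrho-\overline\varrho\in C_{\rm weak}([0,T];L^2+L^\gamma(\Omega))$ and, for every $\tau\in[0,T]$ and every $\varphi\in C^\infty_c([0,T]\times\overline\Omega)$, $$\int_\Omega\varrho(\tau,\cdot)\varphi(\tau,\cdot)\,dx-\int_\Omega\varrho_0\varphi(0,\cdot)\,dx=\int_0^\tau\!\int_\Omega\big(\varrho\,\partial_t\varphi+\varrho\mathbf u\cdot\nabla_x\varphi\big)\,dx\,dt;$$ (iii) $\varrho\mathbf u\in C_{\rm weak}([0,T];L^2+L^{2\gamma/(\gamma+1)}(\Omega;\mathbb{R}^3))$ and, for every $\tau\in[0,T]$ and every $\varphi\in C^\infty_c([0,T]\times\Omega;\mathbb{R}^3)$, $$\int_\Omega\varrho\mathbf u(\tau,\cdot)\cdot\varphi(\tau,\cdot)\,dx-\int_\Omega\varrho_0\mathbf u_0\cdot\varphi(0,\cdot)\,dx=\int_0^\tau\!\int_\Omega\big(\varrho\mathbf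 u\cdot\partial_t\varphi+(\varrho\mathbf u\otimes\mathbf u):\nabla_x\varphi+p(\varrho)\,\mathrm{div}_x\varphi-\mathbb S(\nabla_x\mathbf u):\nabla_x\varphi+\varrho\mathbf f\cdot\varphi\big)\,dx\,dt;$$ (iv) for a.a. $\tau\in[0,T]$ the energy inequality holds: $$\int_\Omega\Big(\tfrac12\varrho|\mathbf u|^2+H(\varrho)-H'(\overline\varrho)(\varrho-\overline\varrho)-H(\overline\varrho)\Big)(\tau,\cdot)\,dx+\int_0^\tau\!\int_\Omega\mathbb S(\nabla_x\mathbf u):\nabla_x\mathbf u\,dx\,dt$$ $$\le\int_\Omega\Big(\tfrac12\varrho_0|\mathbf u_0|^2+H(\varrho_0)-H'(\overline\varrho)(\varrho_0-\overline\varrho)-H(\overline\varrho)\Big)\,dx+\int_0^\tau\!\int_\Omega\varrho\mathbf f\cdot\mathbf u\,dx\,dt,$$ where the initial data are assumed to be such that the first integral on the right-hand side is finite. *)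

theory Defs
  imports "HOL-Analysis.Analysis"
begin

section \<open>Smooth functions and test functions\<close>

primrec Ck :: "nat \<Rightarrow> ('a::euclidean_space \<Rightarrow> 'b::real_normed_vector) \<Rightarrow> bool" where
  "Ck 0 f \<longleftrightarrow> continuous_on UNIV f"
| "Ck (Suc k) f \<longleftrightarrow>
     (\<forall>x. f differentiable (at x)) \<and> (\<forall>v. Ck k (\<lambda>x. frechet_derivative f (at x) v))"

definition smooth :: "('a::euclidean_space \<Rightarrow> 'b::real_normed_vector) \<Rightarrow> bool" where
  "smooth f \<longleftrightarrow> (\<forall>k. Ck k f)"

definition supp :: "('a::topological_space \<Rightarrow> 'b::zero) \<Rightarrow> 'a set" where
  "supp f = closure {x. f x \<noteq> 0}"

definition Cc_space :: "(real^3) set \<Rightarrow> (real^3 \<Rightarrow> real^3) \<Rightarrow> bool" where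
  "Cc_space \<Omega> \<phi> \<longleftrightarrow> smooth \<phi> \<and> compact (supp \<phi>) \<and> supp \<phi> \<subseteq> \<Omega>"

text \<open>\<open>C\<^sub>c\<^sup>\<infinity>([0,T] \<times> \<Omega>)\<close> and \<open>C\<^sub>c\<^sup>\<infinity>([0,T] \<times> closure \<Omega>)\<close>: smoothness up to \<open>t = 0\<close>, \<open>t = T\<close> and
  (in the second case) up to the boundary of \<open>\<Omega>\<close> means being the restriction of a smooth function on
  the whole space-time. No vanishing at \<open>t = 0\<close>, \<open>t = T\<close> is imposed.\<close>

definition Cc_open ::
  "real \<Rightarrow> (real^3) set \<Rightarrow> (real \<Rightarrow> real^3 \<Rightarrow> 'b::real_normed_vector) \<Rightarrow> bool" where
  "Cc_open T \<Omega> \<phi> \<longleftrightarrow>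
     (\<exists>\<psi> :: real \<times> (real^3) \<Rightarrow> 'b. smooth \<psi> \<and> compact (supp \<psi>) \<and> supp \<psi> \<subseteq> UNIV \<times> \<Omega> \<and>
        (\<forall>t\<in>{0..T}. \<forall>x\<in>\<Omega>. \<phi> t x = \<psi> (t, x)))"

definition Cc_closure ::
  "real \<Rightarrow> (real^3) set \<Rightarrow> (real \<Rightarrow> real^3 \<Rightarrow> 'b::real_normed_vector) \<Rightarrow> bool" where
  "Cc_closure T \<Omega> \<phi> \<longleftrightarrow>
     (\<exists>\<psi> :: real \<times> (real^3) \<Rightarrow> 'b. smooth \<psi> \<and> compact (supp \<psi>) \<and>
        (\<forall>t\<in>{0..T}. \<forall>x\<in>closure \<Omega>. \<phi> t x = \<psi> (t, x)))"


section \<open>Differential operators\<close>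

text \<open>The spatial gradient of a vector field is its Jacobian matrix, entry \<open>(i, j)\<close> being
  \<open>\<partial>\<^sub>j v\<^sub>i\<close>. The matrix contraction \<open>A : B\<close> is the inner product on \<^typ>\<open>real^3^3\<close>, and
  \<open>u \<cdot> \<nabla>U\<close> is the matrix-vector product \<open>\<nabla>U *v u\<close>.\<close>

definition dt :: "(real \<Rightarrow> real^3 \<Rightarrow> 'b::real_normed_vector) \<Rightarrow> real \<Rightarrow> real^3 \<Rightarrow> 'b" where
  "dt \<phi> t x = vector_derivative (\<lambda>s. \<phi> s x) (at t)"

definition grad :: "(real^3 \<Rightarrow> real) \<Rightarrow> real^3 \<Rightarrow> real^3" where
  "grad g x = (\<chi> i. frechet_derivative g (at x) (axis i 1))"

definition vgrad :: "(real^3 \<Rightarrow> real^3) \<Rightarrow> real^3 \<Rightarrow> real^3^3" where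
  "vgrad v x = jacobian v (at x)"

definition tensor :: "real^3 \<Rightarrow> real^3 \<Rightarrow> real^3^3" where
  "tensor a b = (\<chi> i j. a $ i * b $ j)"

definition stress :: "real \<Rightarrow> real \<Rightarrow> real^3^3 \<Rightarrow> real^3^3" where
  "stress \<mu> \<eta> A =
     \<mu> *\<^sub>R (A + transpose A - (2/3 * trace A) *\<^sub>R mat 1) + (\<eta> * trace A) *\<^sub>R mat 1"


section \<open>Function spaces\<close>

definition in_Lp :: "real \<Rightarrow> (real^3) set \<Rightarrow> (real^3 \<Rightarrow> 'b::euclidean_space) \<Rightarrow> bool" where
  "in_Lp q \<Omega> v \<longleftrightarrow> v \<in> borel_measurable (lebesgue_on \<Omega>) \<and>
     integrable (lebesgue_on \<Omega>) (\<lambda>x. norm (v x) powr q)"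

definition Lp_norm :: "real \<Rightarrow> (real^3) set \<Rightarrow> (real^3 \<Rightarrow> 'b::euclidean_space) \<Rightarrow> real" where
  "Lp_norm q \<Omega> v = (LINT x|lebesgue_on \<Omega>. norm (v x) powr q) powr (1/q)"

definition sum_decomp ::
  "real \<Rightarrow> (real^3) set \<Rightarrow> (real^3 \<Rightarrow> 'b::euclidean_space) \<Rightarrow>
   (real^3 \<Rightarrow> 'b) \<Rightarrow> (real^3 \<Rightarrow> 'b) \<Rightarrow> bool" where
  "sum_decomp q \<Omega> v g h \<longleftrightarrow>
     in_Lp 2 \<Omega> g \<and> in_Lp q \<Omega> h \<and> (AE x in lebesgue_on \<Omega>. v x = g x + h x)"

text \<open>The sum space \<open>L\<^sup>2 + L\<^sup>q(\<Omega>)\<close> with its norm.\<close>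

definition L2_plus_Lq :: "real \<Rightarrow> (real^3) set \<Rightarrow> (real^3 \<Rightarrow> 'b::euclidean_space) set" where
  "L2_plus_Lq q \<Omega> = {v \<in> borel_measurable (lebesgue_on \<Omega>). \<exists>g h. sum_decomp q \<Omega> v g h}"

definition sum_norm :: "real \<Rightarrow> (real^3) set \<Rightarrow> (real^3 \<Rightarrow> 'b::euclidean_space) \<Rightarrow> real" where
  "sum_norm q \<Omega> v = Inf {Lp_norm 2 \<Omega> g + Lp_norm q \<Omega> h | g h. sum_decomp q \<Omega> v g h}"

text \<open>Bounded linear functionals on \<open>L\<^sup>2 + L\<^sup>q(\<Omega>)\<close>. Boundedness with respect to the norm makes them
  insensitive to modifications on null sets.\<close>

definition sum_dual ::
  "real \<Rightarrow> (real^3) set \<Rightarrow> ((real^3 \<Rightarrow> 'b::euclidean_space) \<Rightarrow> real) \<Rightarrow> bool" where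
  "sum_dual q \<Omega> \<l> \<longleftrightarrow>
     (\<forall>v\<in>L2_plus_Lq q \<Omega>. \<forall>w\<in>L2_plus_Lq q \<Omega>. \<l> (\<lambda>x. v x + w x) = \<l> v + \<l> w) \<and>
     (\<forall>c. \<forall>v\<in>L2_plus_Lq q \<Omega>. \<l> (\<lambda>x. c *\<^sub>R v x) = c * \<l> v) \<and>
     (\<exists>C. \<forall>v\<in>L2_plus_Lq q \<Omega>. \<bar>\<l> v\<bar> \<le> C * sum_norm q \<Omega> v)"

definition C_weak ::
  "real \<Rightarrow> real \<Rightarrow> (real^3) set \<Rightarrow> (real \<Rightarrow> real^3 \<Rightarrow> 'b::euclidean_space) \<Rightarrow> bool" where
  "C_weak q T \<Omega> w \<longleftrightarrow> (\<forall>t\<in>{0..T}. w t \<in> L2_plus_Lq q \<Omega>) \<and>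
     (\<forall>\<l>. sum_dual q \<Omega> \<l> \<longrightarrow> continuous_on {0..T} (\<lambda>t. \<l> (w t)))"

definition space_time_measurable ::
  "real \<Rightarrow> (real^3) set \<Rightarrow> (real \<Rightarrow> real^3 \<Rightarrow> 'b::euclidean_space) \<Rightarrow> bool" where
  "space_time_measurable T \<Omega> v \<longleftrightarrow>
     (\<lambda>(t, x). v t x) \<in> borel_measurable (lebesgue_on ({0<..<T} \<times> \<Omega>))"

definition Linf_L2_plus_Lq ::
  "real \<Rightarrow> real \<Rightarrow> (real^3) set \<Rightarrow> (real \<Rightarrow> real^3 \<Rightarrow> 'b::euclidean_space) \<Rightarrow> bool" where
  "Linf_L2_plus_Lq q T \<Omega> v \<longleftrightarrow> space_time_measurable T \<Omega> v \<and>
     (\<exists>C. AE t in lebesgue_on {0<..<T}. v t \<in> L2_plus_Lq q \<Omega> \<and> sum_norm q \<Omega> (v t) \<le> C)"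

text \<open>\<open>L\<^sup>\<infinity>(0,T; L\<^sup>1 \<inter> L\<^sup>\<infinity>(\<Omega>))\<close>.\<close>

definition Linf_L1_Linf ::
  "real \<Rightarrow> (real^3) set \<Rightarrow> (real \<Rightarrow> real^3 \<Rightarrow> 'b::euclidean_space) \<Rightarrow> bool" where
  "Linf_L1_Linf T \<Omega> f \<longleftrightarrow> space_time_measurable T \<Omega> f \<and>
     (\<exists>C. AE t in lebesgue_on {0<..<T}.
        integrable (lebesgue_on \<Omega>) (f t) \<and>
        (LINT x|lebesgue_on \<Omega>. norm (f t x)) \<le> C \<and>
        (AE x in lebesgue_on \<Omega>. norm (f t x) \<le> C))"

text \<open>\<open>v\<close> belongs to \<open>D\<^sub>0\<^sup>1\<^sup>,\<^sup>2(\<Omega>;R\<^sup>3)\<close> and has (weak) gradient \<open>G\<close>. By the Sobolev inequality in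
  three dimensions, a sequence of test functions that is Cauchy in the \<open>L\<^sup>2\<close>-norm of the gradient
  converges in \<open>L\<^sup>6\<close>, which realizes the abstract completion as a space of functions.\<close>

definition D012 :: "(real^3) set \<Rightarrow> (real^3 \<Rightarrow> real^3) \<Rightarrow> (real^3 \<Rightarrow> real^3^3) \<Rightarrow> bool" where
  "D012 \<Omega> v G \<longleftrightarrow> in_Lp 6 \<Omega> v \<and> in_Lp 2 \<Omega> G \<and>
     (\<exists>\<phi> :: nat \<Rightarrow> real^3 \<Rightarrow> real^3. (\<forall>n. Cc_space \<Omega> (\<phi> n)) \<and>
        (\<lambda>n. Lp_norm 6 \<Omega> (\<lambda>x. \<phi> n x - v x)) \<longlonglongrightarrow> 0 \<and>
        (\<lambda>n. Lp_norm 2 \<Omega> (\<lambda>x. vgrad (\<phi> n) x - G x)) \<longlonglongrightarrow> 0)"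

text \<open>\<open>u \<in> L\<^sup>2(0,T; D\<^sub>0\<^sup>1\<^sup>,\<^sup>2(\<Omega>;R\<^sup>3))\<close> with spatial gradient \<open>Du\<close>; the latter is determined by
  \<open>u\<close> up to a null set.\<close>

definition L2_D012 ::
  "real \<Rightarrow> (real^3) set \<Rightarrow> (real \<Rightarrow> real^3 \<Rightarrow> real^3) \<Rightarrow> (real \<Rightarrow> real^3 \<Rightarrow> real^3^3) \<Rightarrow> bool" where
  "L2_D012 T \<Omega> u Du \<longleftrightarrow> space_time_measurable T \<Omega> u \<and> space_time_measurable T \<Omega> Du \<and>
     (AE t in lebesgue_on {0<..<T}. D012 \<Omega> (u t) (Du t)) \<and>
     integrable (lebesgue_on ({0<..<T} \<times> \<Omega>)) (\<lambda>(t, x). (norm (Du t x))\<^sup>2)"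

definition L1_loc :: "real \<Rightarrow> (real^3) set \<Rightarrow> (real \<Rightarrow> real^3 \<Rightarrow> real) \<Rightarrow> bool" where
  "L1_loc T \<Omega> g \<longleftrightarrow>
     (\<forall>K. compact K \<and> K \<subseteq> {0..T} \<times> \<Omega> \<longrightarrow> set_integrable lebesgue K (\<lambda>(t, x). g t x))"


section \<open>Pressure potential and energy\<close>

definition H_formula :: "(real \<Rightarrow> real) \<Rightarrow> real \<Rightarrow> real \<Rightarrow> real" where
  "H_formula p \<rho>b s = s * (LBINT z=ereal \<rho>b..ereal s. p z / z\<^sup>2)"

text \<open>The values of \<open>H\<close> and (for \<open>\<rho>b = 0\<close>) of \<open>H'\<close> at \<open>0\<close> are the limits from the right.\<close>

definition H :: "(real \<Rightarrow> real) \<Rightarrow> real \<Rightarrow> real \<Rightarrow> real" where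
  "H p \<rho>b s = (if s = 0 then Lim (at_right 0) (H_formula p \<rho>b) else H_formula p \<rho>b s)"

definition dH :: "(real \<Rightarrow> real) \<Rightarrow> real \<Rightarrow> real \<Rightarrow> real" where
  "dH p \<rho>b s = (if s = 0 then Lim (at_right 0) (deriv (H p \<rho>b)) else deriv (H p \<rho>b) s)"

definition energy_density ::
  "(real \<Rightarrow> real) \<Rightarrow> real \<Rightarrow> (real^3 \<Rightarrow> real) \<Rightarrow> (real^3 \<Rightarrow> real^3) \<Rightarrow> real^3 \<Rightarrow> real" where
  "energy_density p \<rho>b \<rho> u x =
     1/2 * \<rho> x * (norm (u x))\<^sup>2 + H p \<rho>b (\<rho> x) - dH p \<rho>b \<rho>b * (\<rho> x - \<rho>b) - H p \<rho>b \<rho>b"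

definition rel_energy_density ::
  "(real \<Rightarrow> real) \<Rightarrow> real \<Rightarrow> (real^3 \<Rightarrow> real) \<Rightarrow> (real^3 \<Rightarrow> real^3) \<Rightarrow>
   (real^3 \<Rightarrow> real) \<Rightarrow> (real^3 \<Rightarrow> real^3) \<Rightarrow> real^3 \<Rightarrow> real" where
  "rel_energy_density p \<rho>b \<rho> u r U x =
     1/2 * \<rho> x * (norm (u x - U x))\<^sup>2 + H p \<rho>b (\<rho> x) - dH p \<rho>b (r x) * (\<rho> x - r x) - H p \<rho>b (r x)"

definition rel_energy ::
  "(real^3) set \<Rightarrow> (real \<Rightarrow> real) \<Rightarrow> real \<Rightarrow> (real^3 \<Rightarrow> real) \<Rightarrow> (real^3 \<Rightarrow> real^3) \<Rightarrow>
   (real^3 \<Rightarrow> real) \<Rightarrow> (real^3 \<Rightarrow> real^3) \<Rightarrow> real" where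
  "rel_energy \<Omega> p \<rho>b \<rho> u r U = (LINT x|lebesgue_on \<Omega>. rel_energy_density p \<rho>b \<rho> u r U x)"


section \<open>Finite energy weak solutions\<close>

text \<open>A solution is given by space-time functions \<open>\<rho>\<close>, \<open>u\<close>, defined up to null sets, together with
  the gradient \<open>Du\<close> of \<open>u\<close>. The values of density and momentum at a specific time \<open>\<tau>\<close> in the weak
  formulations are those of their weakly continuous representatives \<open>\<rho>w\<close> and \<open>m\<close>. Where a Bochner
  integral might fail to exist, its existence is part of the definition (all other integrals exist
  by (i), the assumptions on \<open>f\<close> and the finiteness of the energy).\<close>

definition weak_continuity_equation ::
  "real \<Rightarrow> (real^3) set \<Rightarrow> (real^3 \<Rightarrow> real) \<Rightarrow> (real \<Rightarrow> real^3 \<Rightarrow> real) \<Rightarrow>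
   (real \<Rightarrow> real^3 \<Rightarrow> real) \<Rightarrow> (real \<Rightarrow> real^3 \<Rightarrow> real^3) \<Rightarrow> bool" where
  "weak_continuity_equation T \<Omega> \<rho>0 \<rho>w \<rho> u \<longleftrightarrow>
     (\<forall>\<tau>\<in>{0..T}. \<forall>\<phi>. Cc_closure T \<Omega> \<phi> \<longrightarrow>
        (LINT x|lebesgue_on \<Omega>. \<rho>w \<tau> x * \<phi> \<tau> x) - (LINT x|lebesgue_on \<Omega>. \<rho>0 x * \<phi> 0 x)
        = (LINT (t, x)|lebesgue_on ({0<..<\<tau>} \<times> \<Omega>).
             \<rho> t x * dt \<phi> t x + (\<rho> t x *\<^sub>R u t x) \<bullet> grad (\<phi> t) x))"

definition weak_momentum_equation ::
  "real \<Rightarrow> real \<Rightarrow> (real \<Rightarrow> real) \<Rightarrow> (real \<Rightarrow> real^3 \<Rightarrow> real^3) \<Rightarrow> real \<Rightarrow> (real^3) set \<Rightarrow>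
   (real^3 \<Rightarrow> real) \<Rightarrow> (real^3 \<Rightarrow> real^3) \<Rightarrow> (real \<Rightarrow> real^3 \<Rightarrow> real^3) \<Rightarrow>
   (real \<Rightarrow> real^3 \<Rightarrow> real) \<Rightarrow> (real \<Rightarrow> real^3 \<Rightarrow> real^3) \<Rightarrow> (real \<Rightarrow> real^3 \<Rightarrow> real^3^3) \<Rightarrow> bool" where
  "weak_momentum_equation \<mu> \<eta> p f T \<Omega> \<rho>0 u0 m \<rho> u Du \<longleftrightarrow>
     (\<forall>\<tau>\<in>{0..T}. \<forall>\<phi>. Cc_open T \<Omega> \<phi> \<longrightarrow>
        (LINT x|lebesgue_on \<Omega>. m \<tau> x \<bullet> \<phi> \<tau> x)
          - (LINT x|lebesgue_on \<Omega>. (\<rho>0 x *\<^sub>R u0 x) \<bullet> \<phi> 0 x)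
        = (LINT (t, x)|lebesgue_on ({0<..<\<tau>} \<times> \<Omega>).
             (\<rho> t x *\<^sub>R u t x) \<bullet> dt \<phi> t x
             + tensor (\<rho> t x *\<^sub>R u t x) (u t x) \<bullet> vgrad (\<phi> t) x
             + p (\<rho> t x) * trace (vgrad (\<phi> t) x)
             - stress \<mu> \<eta> (Du t x) \<bullet> vgrad (\<phi> t) x
             + (\<rho> t x *\<^sub>R f t x) \<bullet> \<phi> t x))"

definition energy_inequality ::
  "real \<Rightarrow> real \<Rightarrow> (real \<Rightarrow> real) \<Rightarrow> real \<Rightarrow> (real \<Rightarrow> real^3 \<Rightarrow> real^3) \<Rightarrow> real \<Rightarrow> (real^3) set \<Rightarrow>
   (real^3 \<Rightarrow> real) \<Rightarrow> (real^3 \<Rightarrow> real^3) \<Rightarrow>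
   (real \<Rightarrow> real^3 \<Rightarrow> real) \<Rightarrow> (real \<Rightarrow> real^3 \<Rightarrow> real^3) \<Rightarrow> (real \<Rightarrow> real^3 \<Rightarrow> real^3^3) \<Rightarrow> bool" where
  "energy_inequality \<mu> \<eta> p \<rho>b f T \<Omega> \<rho>0 u0 \<rho> u Du \<longleftrightarrow>
     (AE \<tau> in lebesgue_on {0..T}.
        integrable (lebesgue_on \<Omega>) (energy_density p \<rho>b (\<rho> \<tau>) (u \<tau>)) \<and>
        (LINT x|lebesgue_on \<Omega>. energy_density p \<rho>b (\<rho> \<tau>) (u \<tau>) x)
          + (LINT (t, x)|lebesgue_on ({0<..<\<tau>} \<times> \<Omega>).
               stress \<mu> \<eta> (Du t x) \<bullet> Du t x)
        \<le> (LINT x|lebesgue_on \<Omega>. energy_density p \<rho>b \<rho>0 u0 x)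
          + (LINT (t, x)|lebesgue_on ({0<..<\<tau>} \<times> \<Omega>).
               (\<rho> t x *\<^sub>R f t x) \<bullet> u t x))"

definition finite_energy_weak_solution ::
  "real \<Rightarrow> real \<Rightarrow> (real \<Rightarrow> real) \<Rightarrow> real \<Rightarrow> real \<Rightarrow> (real \<Rightarrow> real^3 \<Rightarrow> real^3) \<Rightarrow> real \<Rightarrow>
   (real^3) set \<Rightarrow> (real^3 \<Rightarrow> real) \<Rightarrow> (real^3 \<Rightarrow> real^3) \<Rightarrow>
   (real \<Rightarrow> real^3 \<Rightarrow> real) \<Rightarrow> (real \<Rightarrow> real^3 \<Rightarrow> real^3) \<Rightarrow> (real \<Rightarrow> real^3 \<Rightarrow> real^3^3) \<Rightarrow> bool" where
  "finite_energy_weak_solution \<mu> \<eta> p \<gamma> \<rho>b f T \<Omega> \<rho>0 u0 \<rho> u Du \<longleftrightarrow>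
     \<comment> \<open>initial data of finite energy\<close>
     \<rho>0 \<in> borel_measurable (lebesgue_on \<Omega>) \<and> u0 \<in> borel_measurable (lebesgue_on \<Omega>) \<and>
     (AE x in lebesgue_on \<Omega>. 0 \<le> \<rho>0 x) \<and>
     integrable (lebesgue_on \<Omega>) (energy_density p \<rho>b \<rho>0 u0) \<and>
     \<comment> \<open>(i)\<close>
     Linf_L2_plus_Lq \<gamma> T \<Omega> (\<lambda>t x. \<rho> t x - \<rho>b) \<and>
     (AE z in lebesgue_on ({0<..<T} \<times> \<Omega>). case z of (t, x) \<Rightarrow> 0 \<le> \<rho> t x) \<and>
     L2_D012 T \<Omega> u Du \<and>
     Linf_L2_plus_Lq (2 * \<gamma> / (\<gamma> + 1)) T \<Omega> (\<lambda>t x. \<rho> t x *\<^sub>R u t x) \<and>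
     L1_loc T \<Omega> (\<lambda>t x. p (\<rho> t x)) \<and>
     \<comment> \<open>(ii)\<close>
     (\<exists>\<rho>w. (AE t in lebesgue_on {0<..<T}. AE x in lebesgue_on \<Omega>. \<rho>w t x = \<rho> t x) \<and>
           C_weak \<gamma> T \<Omega> (\<lambda>t x. \<rho>w t x - \<rho>b) \<and>
           weak_continuity_equation T \<Omega> \<rho>0 \<rho>w \<rho> u) \<and>
     \<comment> \<open>(iii)\<close>
     (\<exists>m. (AE t in lebesgue_on {0<..<T}. AE x in lebesgue_on \<Omega>. m t x = \<rho> t x *\<^sub>R u t x) \<and>
          C_weak (2 * \<gamma> / (\<gamma> + 1)) T \<Omega> m \<and>
          weak_momentum_equation \<mu> \<eta> p f T \<Omega> \<rho>0 u0 m \<rho> u Du) \<and>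
     \<comment> \<open>(iv)\<close>
     energy_inequality \<mu> \<eta> p \<rho>b f T \<Omega> \<rho>0 u0 \<rho> u Du"


section \<open>The remainder in the relative energy inequality\<close>

definition R_convective ::
  "(real \<Rightarrow> real^3 \<Rightarrow> real) \<Rightarrow> (real \<Rightarrow> real^3 \<Rightarrow> real^3) \<Rightarrow> (real \<Rightarrow> real^3 \<Rightarrow> real^3) \<Rightarrow>
   real \<Rightarrow> real^3 \<Rightarrow> real" where
  "R_convective \<rho> u U t x =
     \<rho> t x * ((dt U t x + vgrad (U t) x *v u t x) \<bullet> (U t x - u t x))"

definition R_viscous ::
  "real \<Rightarrow> real \<Rightarrow> (real \<Rightarrow> real^3 \<Rightarrow> real^3^3) \<Rightarrow> (real \<Rightarrow> real^3 \<Rightarrow> real^3) \<Rightarrow>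
   real \<Rightarrow> real^3 \<Rightarrow> real" where
  "R_viscous \<mu> \<eta> Du U t x = stress \<mu> \<eta> (vgrad (U t) x) \<bullet> (vgrad (U t) x - Du t x)"

definition R_force ::
  "(real \<Rightarrow> real^3 \<Rightarrow> real^3) \<Rightarrow> (real \<Rightarrow> real^3 \<Rightarrow> real) \<Rightarrow> (real \<Rightarrow> real^3 \<Rightarrow> real^3) \<Rightarrow>
   (real \<Rightarrow> real^3 \<Rightarrow> real^3) \<Rightarrow> real \<Rightarrow> real^3 \<Rightarrow> real" where
  "R_force f \<rho> u U t x = (\<rho> t x *\<^sub>R f t x) \<bullet> (u t x - U t x)"

definition R_density ::
  "(real \<Rightarrow> real) \<Rightarrow> real \<Rightarrow> (real \<Rightarrow> real^3 \<Rightarrow> real) \<Rightarrow> (real \<Rightarrow> real^3 \<Rightarrow> real^3) \<Rightarrow>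
   (real \<Rightarrow> real^3 \<Rightarrow> real) \<Rightarrow> (real \<Rightarrow> real^3 \<Rightarrow> real^3) \<Rightarrow> real \<Rightarrow> real^3 \<Rightarrow> real" where
  "R_density p \<rho>b \<rho> u r U t x =
     (r t x - \<rho> t x) * dt (\<lambda>s y. dH p \<rho>b (r s y)) t x
     + grad (\<lambda>y. dH p \<rho>b (r t y)) x \<bullet> (r t x *\<^sub>R U t x - \<rho> t x *\<^sub>R u t x)"

definition R_pressure ::
  "(real \<Rightarrow> real) \<Rightarrow> (real \<Rightarrow> real^3 \<Rightarrow> real) \<Rightarrow> (real \<Rightarrow> real^3 \<Rightarrow> real) \<Rightarrow>
   (real \<Rightarrow> real^3 \<Rightarrow> real^3) \<Rightarrow> real \<Rightarrow> real^3 \<Rightarrow> real" where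
  "R_pressure p \<rho> r U t x = trace (vgrad (U t) x) * (p (\<rho> t x) - p (r t x))"

definition remainder ::
  "real \<Rightarrow> real \<Rightarrow> (real \<Rightarrow> real) \<Rightarrow> real \<Rightarrow> (real \<Rightarrow> real^3 \<Rightarrow> real^3) \<Rightarrow> (real^3) set \<Rightarrow>
   (real \<Rightarrow> real^3 \<Rightarrow> real) \<Rightarrow> (real \<Rightarrow> real^3 \<Rightarrow> real^3) \<Rightarrow> (real \<Rightarrow> real^3 \<Rightarrow> real^3^3) \<Rightarrow>
   (real \<Rightarrow> real^3 \<Rightarrow> real) \<Rightarrow> (real \<Rightarrow> real^3 \<Rightarrow> real^3) \<Rightarrow> real \<Rightarrow> real" where
  "remainder \<mu> \<eta> p \<rho>b f \<Omega> \<rho> u Du r U t =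
     (LINT x|lebesgue_on \<Omega>. R_convective \<rho> u U t x)
     + (LINT x|lebesgue_on \<Omega>. R_viscous \<mu> \<eta> Du U t x)
     + (LINT x|lebesgue_on \<Omega>. R_force f \<rho> u U t x)
     + (LINT x|lebesgue_on \<Omega>. R_density p \<rho>b \<rho> u r U t x)
     - (LINT x|lebesgue_on \<Omega>. R_pressure p \<rho> r U t x)"

text \<open>All integrals entering \<^const>\<open>remainder\<close> and its time integral converge, so that none of them
  is the default value of a non-integrable function.\<close>

definition remainder_integrable ::
  "real \<Rightarrow> real \<Rightarrow> (real \<Rightarrow> real) \<Rightarrow> real \<Rightarrow> (real \<Rightarrow> real^3 \<Rightarrow> real^3) \<Rightarrow> real \<Rightarrow> (real^3) set \<Rightarrow>
   (real \<Rightarrow> real^3 \<Rightarrow> real) \<Rightarrow> (real \<Rightarrow> real^3 \<Rightarrow> real^3) \<Rightarrow> (real \<Rightarrow> real^3 \<Rightarrow> real^3^3) \<Rightarrow>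
   (real \<Rightarrow> real^3 \<Rightarrow> real) \<Rightarrow> (real \<Rightarrow> real^3 \<Rightarrow> real^3) \<Rightarrow> bool" where
  "remainder_integrable \<mu> \<eta> p \<rho>b f T \<Omega> \<rho> u Du r U \<longleftrightarrow>
     (AE t in lebesgue_on {0<..<T}.
        integrable (lebesgue_on \<Omega>) (R_convective \<rho> u U t) \<and>
        integrable (lebesgue_on \<Omega>) (R_viscous \<mu> \<eta> Du U t) \<and>
        integrable (lebesgue_on \<Omega>) (R_force f \<rho> u U t) \<and>
        integrable (lebesgue_on \<Omega>) (R_density p \<rho>b \<rho> u r U t) \<and>
        integrable (lebesgue_on \<Omega>) (R_pressure p \<rho> r U t)) \<and>
     integrable (lebesgue_on {0<..<T}) (remainder \<mu> \<eta> p \<rho>b f \<Omega> \<rho> u Du r U)"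

end

theory Submission
  imports Defs
begin

text \<open>Test the momentum equation with \<open>U\<close> and the continuity equation with \<open>|U|\<^sup>2/2\<close> and with
  \<open>H'(r) - H'(\<rho>b)\<close>, and combine the three identities with the energy inequality; the remaining terms
  match by \<open>\<integral> (\<nabla>p(r) \<bullet> U + p(r) div U) dx = 0\<close> and
  \<open>\<partial>\<^sub>t (r H'(r) - H(r)) = r \<partial>\<^sub>t H'(r)\<close>. Two points need care. First, \<open>H'\<close> is only of class
  \<open>C\<^sup>2\<close>, so \<open>H'(r)\<close> is not a test function; since \<open>r\<close> takes values in a compact subset of the
  positive half-line, polynomials approximating \<open>H'\<close> in \<open>C\<^sup>1\<close> yield smooth test functions. Second,
  the convective terms must be integrable: \<open>\<rho> f \<bullet> u\<close> is integrable because \<open>\<rho> u\<close> is bounded in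
  \<open>L\<^sup>2 + L\<^sup>q\<close> while \<open>f\<close> is bounded in \<open>L\<^sup>1 \<inter> L\<^sup>\<infinity>\<close>, hence the energy inequality bounds the energy
  uniformly in time and \<open>\<rho> |u|\<^sup>2\<close> is bounded in \<open>L\<^sup>1\<close>; no Sobolev embedding is used.\<close>

section \<open>Fubini's theorem for Lebesgue measurable functions\<close>

text \<open>The tested equations concern the representatives \<open>\<rho>w\<close> and
  \<open>m\<close>, which agree with the density and the momentum only at almost every time, so
  every identity is collected for almost every \<tau>. The exceptional set of times does not depend
  on the test function; the polynomials replacing H' can therefore be chosen afterwards, one for
  each accuracy. The constant H'(\<rho>b) is subtracted because r equals \<rho>b off a compact set,
  and the polynomial must vanish at \<rho>b to give a compactly supported test function. This has to
  work for \<rho>b = 0 as well, where the range of r stays away from 0. On an unbounded \<Omega> the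
  functions H(\<rho>), H(r) and p(r) need not be integrable one by one. The relative energy is
  therefore split into groups that are: the energy density, terms with a factor supported in a
  compact set, and p(r) - p(\<rho>b). Space-time integrals are taken with respect to the complete
  Lebesgue measure, which is not the product of the complete measures of the factors; Fubini's
  theorem is transferred from Borel measure.\<close>

lemma AE_lborel_sections:
  fixes P :: "'a::euclidean_space \<times> 'b::euclidean_space \<Rightarrow> bool"
  assumes "AE z in lborel. P z"
  shows "AE t in lborel. AE x in lborel. P (t, x)"
  using assms unfolding lborel_prod[symmetric] by (rule lborel_pair.AE_pair)

text \<open>\<open>lebesgue\<close> on a product is the completion of the product of the Borel
  measures, so single sections of \<open>F\<close> may fail to be measurable. A Borel function
  \<open>G\<close> equal to \<open>F\<close> off a null set has good sections, and for almost every
  t the sections of \<open>F\<close> and \<open>G\<close> agree almost everywhere.\<close>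

lemma lebesgue_Fubini:
  fixes F :: "'a::euclidean_space \<times> 'b::euclidean_space \<Rightarrow> real"
  assumes "integrable lebesgue F"
  shows "AE t in lebesgue. integrable lebesgue (\<lambda>x. F (t, x))"
    and "integrable lebesgue (\<lambda>t. LINT x|lebesgue. F (t, x))"
    and "(LINT t|lebesgue. LINT x|lebesgue. F (t, x)) = (LINT z|lebesgue. F z)"
proof -
  obtain G where G [measurable]: "G \<in> borel_measurable lborel" and eq: "AE z in lborel. F z = G z"
    using completion_ex_borel_measurable_real[of F lborel] assms by auto
  have intG: "integrable lborel G"
    using assms eq integrable_cong_AE[of F lebesgue G] integrable_completion[of G lborel]
    by (auto simp: AE_completion_iff measurable_completion)
  then have intG': "integrable (lborel \<Otimes>\<^sub>M lborel) G"
    by (simp only: lborel_prod)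
  have sec: "AE t in lborel. AE x in lborel. F (t, x) = G (t, x)"
    using AE_lborel_sections[OF eq] by simp
  have GM: "G \<in> borel_measurable (lborel \<Otimes>\<^sub>M lborel)"
    using G by (simp only: lborel_prod)
  have Gsec: "(\<lambda>x. G (t, x)) \<in> borel_measurable lborel" for t
    using GM by measurable
  have Fsec: "(\<lambda>x. F (t, x)) \<in> borel_measurable lebesgue"
    if "AE x in lborel. F (t, x) = G (t, x)" for t
  proof (rule borel_measurable_AE[OF measurable_completion[OF Gsec]])
    show "AE x in lebesgue. G (t, x) = F (t, x)"
      unfolding AE_completion_iff using that by eventually_elim simp
  qed
  have int_eq: "(LINT x|lebesgue. F (t, x)) = (LINT x|lborel. G (t, x))"
    if "AE x in lborel. F (t, x) = G (t, x)" for t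
    using integral_cong_AE[OF Fsec[OF that] measurable_completion[OF Gsec]] that
    by (simp add: AE_completion_iff integral_completion Gsec)
  have int_sec: "AE t in lborel. integrable lborel (\<lambda>x. G (t, x))"
    using lborel_pair.AE_integrable_fst'[OF intG'] .
  show "AE t in lebesgue. integrable lebesgue (\<lambda>x. F (t, x))"
    unfolding AE_completion_iff using sec int_sec
  proof eventually_elim
    case (elim t)
    then show ?case
      using integrable_cong_AE[OF Fsec[OF elim(1)] measurable_completion[OF Gsec]]
      by (simp add: AE_completion_iff integrable_completion Gsec)
  qed
  have ae: "AE t in lebesgue. (LINT x|lborel. G (t, x)) = (LINT x|lebesgue. F (t, x))"
    unfolding AE_completion_iff using sec by eventually_elim (simp add: int_eq)
  have intGt: "integrable lborel (\<lambda>t. LINT x|lborel. G (t, x))"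
    using lborel_pair.integrable_fst'[OF intG'] .
  then have intGt': "integrable lebesgue (\<lambda>t. LINT x|lborel. G (t, x))"
    by (subst integrable_completion) auto
  have meas: "(\<lambda>t. LINT x|lebesgue. F (t, x)) \<in> borel_measurable lebesgue"
    by (rule borel_measurable_AE[OF _ ae]) (use intGt' in auto)
  show "integrable lebesgue (\<lambda>t. LINT x|lebesgue. F (t, x))"
    using integrable_cong_AE[OF _ meas ae] intGt' by auto
  have "(LINT t|lebesgue. LINT x|lebesgue. F (t, x)) = (LINT t|lebesgue. LINT x|lborel. G (t, x))"
    using integral_cong_AE[OF _ meas ae] intGt' by simp
  also have "\<dots> = (LINT t|lborel. LINT x|lborel. G (t, x))"
    using intGt by (intro integral_completion) auto
  also have "\<dots> = (LINT z|lborel. G z)"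
    using lborel_pair.integral_fst'[OF intG'] by (simp only: lborel_prod)
  also have "\<dots> = (LINT z|lebesgue. G z)"
    by (simp add: integral_completion)
  also have "\<dots> = (LINT z|lebesgue. F z)"
    by (rule integral_cong_AE) (use assms eq in \<open>auto simp: AE_completion_iff measurable_completion\<close>)
  finally show "(LINT t|lebesgue. LINT x|lebesgue. F (t, x)) = (LINT z|lebesgue. F z)" .
qed

lemma sets_lebesgue_Times:
  fixes A :: "'a::euclidean_space set" and B :: "'b::euclidean_space set"
  assumes "A \<in> sets borel" "B \<in> sets borel"
  shows "A \<times> B \<in> sets lebesgue"
  using borel_Times[OF assms] by simp

text \<open>Extension by zero: the indicator of \<open>A \<times> B\<close> factors into those of
  \<open>A\<close> and \<open>B\<close>, which reduces the claim to the whole space.\<close>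

lemma lebesgue_on_Fubini:
  fixes F :: "'a::euclidean_space \<times> 'b::euclidean_space \<Rightarrow> real"
  assumes A: "A \<in> sets borel" and B: "B \<in> sets borel"
    and F: "integrable (lebesgue_on (A \<times> B)) F"
  shows "AE t in lebesgue_on A. integrable (lebesgue_on B) (\<lambda>x. F (t, x))"
    and "integrable (lebesgue_on A) (\<lambda>t. LINT x|lebesgue_on B. F (t, x))"
    and "(LINT t|lebesgue_on A. LINT x|lebesgue_on B. F (t, x)) = (LINT z|lebesgue_on (A \<times> B). F z)"
proof -
  have S: "A \<times> B \<in> sets lebesgue" "A \<in> sets lebesgue" "B \<in> sets lebesgue"
    using sets_lebesgue_Times A B by auto
  define G where "G = (\<lambda>z. indicator (A \<times> B) z *\<^sub>R F z)"
  have G: "integrable lebesgue G"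
    using F S by (simp add: G_def integrable_restrict_space)
  have Gx: "G (t, x) = indicator A t *\<^sub>R indicator B x *\<^sub>R F (t, x)" for t x
    by (auto simp: G_def indicator_def)
  have int: "(LINT x|lebesgue. G (t, x)) = indicator A t *\<^sub>R (LINT x|lebesgue_on B. F (t, x))" for t
    using S by (simp add: Gx integral_restrict_space)
  show "AE t in lebesgue_on A. integrable (lebesgue_on B) (\<lambda>x. F (t, x))"
    using lebesgue_Fubini(1)[OF G] S
    by (auto simp: AE_restrict_space_iff integrable_restrict_space Gx elim!: eventually_mono)
  show "integrable (lebesgue_on A) (\<lambda>t. LINT x|lebesgue_on B. F (t, x))"
    using lebesgue_Fubini(2)[OF G] S by (simp add: int integrable_restrict_space)
  show "(LINT t|lebesgue_on A. LINT x|lebesgue_on B. F (t, x)) = (LINT z|lebesgue_on (A \<times> B). F z)"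
    using lebesgue_Fubini(3)[OF G] S unfolding int by (simp add: integral_restrict_space G_def)
qed

text \<open>Turns a bound on the spatial integrals that is uniform in time into integrability on
  space-time, the time set having finite measure. Tonelli's theorem is applied to a Borel version of
  the absolute value.\<close>

lemma lebesgue_on_Tonelli_bounded:
  fixes F :: "'a::euclidean_space \<times> 'b::euclidean_space \<Rightarrow> real"
  assumes A: "A \<in> sets borel" and B: "B \<in> sets borel" and fin: "emeasure lborel A < \<infinity>"
    and F: "F \<in> borel_measurable (lebesgue_on (A \<times> B))"
    and sec: "AE t in lebesgue_on A. integrable (lebesgue_on B) (\<lambda>x. F (t, x)) \<and>
                (LINT x|lebesgue_on B. \<bar>F (t, x)\<bar>) \<le> C"
  shows "integrable (lebesgue_on (A \<times> B)) F"
proof -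
  have S: "A \<times> B \<in> sets lebesgue" "A \<in> sets lebesgue" "B \<in> sets lebesgue"
    using sets_lebesgue_Times A B by auto
  define G where "G = (\<lambda>z. indicator (A \<times> B) z *\<^sub>R \<bar>F z\<bar>)"
  have Gx: "G (t, x) = indicator A t *\<^sub>R indicator B x *\<^sub>R \<bar>F (t, x)\<bar>" for t x
    by (auto simp: G_def indicator_def)
  have "G \<in> borel_measurable lebesgue"
    using F S borel_measurable_restrict_space_iff[of "A \<times> B" lebesgue "\<lambda>z. \<bar>F z\<bar>"] unfolding G_def by auto
  then obtain G' where G' [measurable]: "G' \<in> borel_measurable lborel" and eq: "AE z in lborel. G z = G' z"
    using completion_ex_borel_measurable_real[of G lborel] by auto
  have GM [measurable]: "G' \<in> borel_measurable (lborel \<Otimes>\<^sub>M lborel)"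
    using G' by (simp only: lborel_prod)
  have sec': "AE t in lborel. t \<in> A \<longrightarrow> integrable (lebesgue_on B) (\<lambda>x. F (t, x)) \<and>
                (LINT x|lebesgue_on B. \<bar>F (t, x)\<bar>) \<le> C"
    using sec S by (simp add: AE_restrict_space_iff AE_completion_iff del: AE_conj_iff)
  have "(\<integral>\<^sup>+z. norm (G z) \<partial>lebesgue) = (\<integral>\<^sup>+z. norm (G' z) \<partial>lebesgue)"
    by (rule nn_integral_cong_AE) (use eq in \<open>auto simp: AE_completion_iff\<close>)
  also have "\<dots> = (\<integral>\<^sup>+z. norm (G' z) \<partial>(lborel \<Otimes>\<^sub>M lborel))"
    by (simp add: nn_integral_completion lborel_prod)
  also have "\<dots> = (\<integral>\<^sup>+t. \<integral>\<^sup>+x. norm (G' (t, x)) \<partial>lborel \<partial>lborel)"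
    by (subst lborel.nn_integral_fst[symmetric]) auto
  \<comment> \<open>\<open>C\<close> may be negative when \<open>A\<close> is a null set, hence the
    absolute value.\<close>
  also have "\<dots> \<le> (\<integral>\<^sup>+t. ennreal \<bar>C\<bar> * indicator A t \<partial>lborel)"
  proof (rule nn_integral_mono_AE, use sec' AE_lborel_sections[OF eq] in eventually_elim)
    case (elim t)
    have "(\<integral>\<^sup>+x. norm (G' (t, x)) \<partial>lborel) = (\<integral>\<^sup>+x. norm (G (t, x)) \<partial>lborel)"
      by (rule nn_integral_cong_AE) (use elim(2) in auto)
    also have "\<dots> \<le> ennreal \<bar>C\<bar> * indicator A t"
    proof (cases "t \<in> A")
      case True
      have "(\<integral>\<^sup>+x. norm (G (t, x)) \<partial>lborel) = (\<integral>\<^sup>+x. ennreal \<bar>F (t, x)\<bar> * indicator B x \<partial>lebesgue)"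
        unfolding nn_integral_completion
        by (rule nn_integral_cong) (use True in \<open>auto simp: Gx indicator_def\<close>)
      also have "\<dots> = (\<integral>\<^sup>+x. ennreal \<bar>F (t, x)\<bar> \<partial>lebesgue_on B)"
        using S by (simp add: nn_integral_restrict_space)
      also have "\<dots> = ennreal (LINT x|lebesgue_on B. \<bar>F (t, x)\<bar>)"
        using elim True by (intro nn_integral_eq_integral) auto
      also have "\<dots> \<le> ennreal \<bar>C\<bar>" using elim True by (intro ennreal_leI) auto
      finally show ?thesis using True by simp
    qed (simp add: Gx)
    finally show ?case .
  qed
  also have "\<dots> = ennreal \<bar>C\<bar> * emeasure lborel A"
    using A by (simp add: nn_integral_cmult_indicator)
  also have "\<dots> < \<infinity>" using fin by (simp add: ennreal_mult_less_top)
  finally have "integrable lebesgue G"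
    using \<open>G \<in> borel_measurable lebesgue\<close> by (intro integrableI_bounded) auto
  then have "integrable (lebesgue_on (A \<times> B)) (\<lambda>z. \<bar>F z\<bar>)"
    using S by (simp add: G_def integrable_restrict_space)
  then show ?thesis using F integrable_abs_iff by blast
qed

section \<open>Restriction to subsets\<close>

lemma integrable_lebesgue_on_subset:
  fixes F :: "'a::euclidean_space \<Rightarrow> 'b::euclidean_space"
  assumes "integrable (lebesgue_on S) F" "A \<subseteq> S" "A \<in> sets lebesgue" "S \<in> sets lebesgue"
  shows "integrable (lebesgue_on A) F"
proof -
  have "set_integrable lebesgue S F"
    using assms by (simp add: set_integrable_def integrable_restrict_space)
  then have "set_integrable lebesgue A F"
    by (rule set_integrable_subset) (use assms in auto)
  then show ?thesis
    using assms by (simp add: set_integrable_def integrable_restrict_space)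
qed

lemma AE_lebesgue_on_subset:
  assumes "AE x in lebesgue_on S. P x" "A \<subseteq> S" "A \<in> sets lebesgue" "S \<in> sets lebesgue"
  shows "AE x in lebesgue_on A. P x"
  using assms by (auto simp: AE_restrict_space_iff elim!: eventually_mono)

section \<open>Smooth functions\<close>

lemma Ck_imp_continuous: "Ck k f \<Longrightarrow> continuous_on UNIV f"
  by (cases k) (auto simp: continuous_on_eq_continuous_at intro: differentiable_imp_continuous_within)

lemma Ck_Suc_imp_Ck: "Ck (Suc k) f \<Longrightarrow> Ck k f"
proof (induction k arbitrary: f)
  case 0
  then show ?case using Ck_imp_continuous[of "Suc 0" f] by simp
next
  case (Suc k)
  then show ?case by auto
qed

lemma Ck_add:
  fixes f g :: "'a::euclidean_space \<Rightarrow> 'b::real_normed_vector"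
  shows "Ck k f \<Longrightarrow> Ck k g \<Longrightarrow> Ck k (\<lambda>x. f x + g x)"
proof (induction k arbitrary: f g)
  case 0
  then show ?case by (auto intro: continuous_intros)
next
  case (Suc k)
  have "frechet_derivative (\<lambda>x. f x + g x) (at x) v
      = frechet_derivative f (at x) v + frechet_derivative g (at x) v" for x v
    using Suc.prems frechet_derivative_at[OF has_derivative_add, of f _ x g]
    by (auto simp: frechet_derivative_works fun_eq_iff)
  then show ?case using Suc by (auto intro!: differentiable_add)
qed

text \<open>Leibniz rule: each of the two products in the derivative has one differentiated factor
  of class k and one undifferentiated factor of class k + 1, which is lowered to k before the
  induction hypothesis applies.\<close>

lemma (in bounded_bilinear) Ck_prod:
  fixes f :: "'d::euclidean_space \<Rightarrow> 'a" and g :: "'d \<Rightarrow> 'b"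
  shows "Ck k f \<Longrightarrow> Ck k g \<Longrightarrow> Ck k (\<lambda>x. prod (f x) (g x))"
proof (induction k arbitrary: f g)
  case 0
  then show ?case by (auto intro: continuous_on)
next
  case (Suc k)
  have der: "((\<lambda>x. prod (f x) (g x)) has_derivative (\<lambda>h. prod (f x) (frechet_derivative g (at x) h)
      + prod (frechet_derivative f (at x) h) (g x))) (at x)" for x
    using Suc.prems by (intro FDERIV) (auto simp: frechet_derivative_works)
  then have "frechet_derivative (\<lambda>x. prod (f x) (g x)) (at x) v
      = prod (f x) (frechet_derivative g (at x) v) + prod (frechet_derivative f (at x) v) (g x)" for x v
    using frechet_derivative_at[OF der, of x] by (simp add: fun_eq_iff)
  moreover have "Ck k f" "Ck k g"
    using Suc.prems Ck_Suc_imp_Ck by blast+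
  ultimately show ?case
    using Suc differentiableI[OF der] by (auto intro!: Ck_add)
qed

lemma Ck_const: "Ck k (\<lambda>x. c)"
  by (induction k arbitrary: c) auto

lemma smooth_const: "smooth (\<lambda>x. c)"
  by (simp add: smooth_def Ck_const)

lemma smooth_add: "smooth f \<Longrightarrow> smooth g \<Longrightarrow> smooth (\<lambda>x. f x + g x)"
  by (simp add: smooth_def Ck_add)

lemma smooth_mult:
  fixes f g :: "'a::euclidean_space \<Rightarrow> real"
  shows "smooth f \<Longrightarrow> smooth g \<Longrightarrow> smooth (\<lambda>x. f x * g x)"
  by (simp add: smooth_def bounded_bilinear.Ck_prod[OF bounded_bilinear_mult])

lemma smooth_inner:
  fixes f g :: "'a::euclidean_space \<Rightarrow> 'b::real_inner"
  shows "smooth f \<Longrightarrow> smooth g \<Longrightarrow> smooth (\<lambda>x. f x \<bullet> g x)"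
  by (simp add: smooth_def bounded_bilinear.Ck_prod[OF bounded_bilinear_inner])

text \<open>Makes polynomials in \<open>\<rho>b + \<psi>r\<close> available as test
  functions.\<close>

lemma smooth_real_polynomial:
  fixes f :: "'a::euclidean_space \<Rightarrow> real"
  assumes "real_polynomial_function P" "smooth f"
  shows "smooth (\<lambda>x. P (f x))"
  using assms
proof (induction rule: real_polynomial_function.induct)
  case (linear P)
  interpret bounded_linear P by (rule linear)
  have "P = (\<lambda>x. P 1 * x)"
  proof
    show "P x = P 1 * x" for x
      using scaleR[of x 1] unfolding real_scaleR_def mult_1_right by (simp only: mult.commute)
  qed
  then show ?case
    using smooth_mult[OF smooth_const[of "P 1"] \<open>smooth f\<close>] by metis
qed (auto intro: smooth_const smooth_add smooth_mult)

lemma smooth_imp_C1: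
  assumes "smooth f"
  shows "(f has_derivative frechet_derivative f (at x)) (at x)"
    and "continuous_on UNIV (\<lambda>x. frechet_derivative f (at x) v)"
    and "continuous_on UNIV f"
proof -
  have "Ck 1 f" "Ck 0 f" using assms by (auto simp: smooth_def)
  then show "(f has_derivative frechet_derivative f (at x)) (at x)"
    "continuous_on UNIV (\<lambda>x. frechet_derivative f (at x) v)" "continuous_on UNIV f"
    by (auto simp: frechet_derivative_works[symmetric])
qed

section \<open>Functions of compact support\<close>

lemma not_in_supp:
  assumes "x \<notin> supp f"
  shows "f x = 0" "frechet_derivative f (at x) = (\<lambda>h. 0)"
proof -
  have z: "f y = 0" if "y \<in> - supp f" for y
    using that closure_subset[of "{x. f x \<noteq> 0}"] by (auto simp: supp_def)
  then show "f x = 0" using assms by auto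
  have "open (- supp f)" by (simp add: supp_def open_Compl)
  then have "(f has_derivative (\<lambda>h. 0)) (at x)"
    using has_derivative_transform_within_open[of "\<lambda>_. 0" "\<lambda>h. 0" x UNIV "- supp f" f] assms z
    by auto
  from frechet_derivative_at[OF this] show "frechet_derivative f (at x) = (\<lambda>h. 0)" by simp
qed

lemma compact_support_bounded:
  fixes g :: "'a::euclidean_space \<Rightarrow> 'b::real_normed_vector"
  assumes "continuous_on UNIV g" "compact S" "\<And>x. x \<notin> S \<Longrightarrow> g x = 0"
  obtains C where "C \<ge> 0" "\<And>x. norm (g x) \<le> C"
proof -
  have "bounded (g ` S)"
    using assms by (intro compact_imp_bounded compact_continuous_image) (auto intro: continuous_on_subset)
  then obtain C where C: "\<And>x. x \<in> S \<Longrightarrow> norm (g x) \<le> C"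
    by (auto simp: bounded_iff)
  have "norm (g x) \<le> \<bar>C\<bar>" for x
    using C[of x] assms(3)[of x] by (cases "x \<in> S") auto
  then show ?thesis using that[of "\<bar>C\<bar>"] by auto
qed

text \<open>Translation invariance of Lebesgue measure makes the integral of every difference quotient
  vanish.\<close>

lemma integral_directional_derivative_eq_0:
  fixes v :: "'a::euclidean_space \<Rightarrow> real"
  assumes der: "\<And>x. (v has_derivative v' x) (at x)"
    and bnd: "\<And>x. \<bar>v' x e\<bar> \<le> L"
    and supp: "bounded S" "\<And>x. x \<notin> S \<Longrightarrow> v x = 0"
  shows "integrable lborel (\<lambda>x. v' x e)" "(LINT x|lborel. v' x e) = 0"
proof -
  define q where "q n x = (v (x + inverse (real (Suc n)) *\<^sub>R e) - v x) / inverse (real (Suc n))" for n x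
  have cont: "continuous_on UNIV v"
    using der by (metis continuous_at_imp_continuous_on has_derivative_continuous)
  have Vm [measurable]: "v \<in> borel_measurable borel"
    using cont by (rule borel_measurable_continuous_onI)
  have bl: "bounded_linear (v' x)" for x using der by (rule has_derivative_bounded_linear)
  have line: "((\<lambda>s. v (x + s *\<^sub>R e)) has_real_derivative v' (x + s *\<^sub>R e) e) (at s)" for x s
  proof -
    have "((\<lambda>s. v (x + s *\<^sub>R e)) has_derivative (\<lambda>h. v' (x + s *\<^sub>R e) (h *\<^sub>R e))) (at s)"
      by (rule has_derivative_compose[OF _ der]) (auto intro!: derivative_eq_intros)
    moreover have "(\<lambda>h. v' (x + s *\<^sub>R e) (h *\<^sub>R e)) = (*) (v' (x + s *\<^sub>R e) e)"
      using linear_simps(5)[OF bl] by (auto simp: fun_eq_iff)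
    ultimately show ?thesis by (simp add: has_field_derivative_def)
  qed
  have lim: "(\<lambda>n. q n x) \<longlonglongrightarrow> v' x e" for x
  proof -
    have "((\<lambda>h. (v (x + h *\<^sub>R e) - v x) / h) \<longlongrightarrow> v' x e) (at 0)"
      using line[of x 0] by (simp add: DERIV_def)
    moreover have "filterlim (\<lambda>n. inverse (real (Suc n))) (at 0) sequentially"
      using LIMSEQ_inverse_real_of_nat by (auto simp: filterlim_at)
    ultimately show ?thesis unfolding q_def by (rule filterlim_compose)
  qed
  \<comment> \<open>The mean value theorem bounds all difference quotients by \<open>L\<close>;
    together with a common support this yields a dominating function.\<close>
  have qb: "\<bar>q n x\<bar> \<le> L" for n x
  proof -
    let ?h = "inverse (real (Suc n))"
    obtain z where "v (x + ?h *\<^sub>R e) - v (x + 0 *\<^sub>R e) = (?h - 0) * v' (x + z *\<^sub>R e) e"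
      using MVT2[of 0 ?h "\<lambda>s. v (x + s *\<^sub>R e)" "\<lambda>s. v' (x + s *\<^sub>R e) e"] line by auto
    then have "q n x = v' (x + z *\<^sub>R e) e" by (simp add: q_def)
    then show ?thesis using bnd by simp
  qed
  obtain R where R: "\<And>x. x \<in> S \<Longrightarrow> norm x \<le> R" using supp by (auto simp: bounded_iff)
  \<comment> \<open>The translations have length at most \<open>norm e\<close>, so a ball enlarged
    by that amount contains the supports of all quotients.\<close>
  define W where "W = cball (0::'a) (\<bar>R\<bar> + norm e)"
  have qz: "q n x = 0" if "x \<notin> W" for n x
  proof -
    have "norm (inverse (real (Suc n)) *\<^sub>R e) \<le> norm e"
      by (simp add: field_simps)
    moreover have "norm x \<le> norm (x + inverse (real (Suc n)) *\<^sub>R e) + norm (inverse (real (Suc n)) *\<^sub>R e)"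
      using norm_triangle_ineq4[of "x + inverse (real (Suc n)) *\<^sub>R e" "inverse (real (Suc n)) *\<^sub>R e"]
      by simp
    moreover have "norm x > \<bar>R\<bar> + norm e"
      using that by (simp add: W_def)
    moreover have "norm e \<ge> 0" by simp
    ultimately have "norm (x + inverse (real (Suc n)) *\<^sub>R e) > \<bar>R\<bar>" "norm x > \<bar>R\<bar>"
      by linarith+
    then have "x + inverse (real (Suc n)) *\<^sub>R e \<notin> S" "x \<notin> S"
      using R by force+
    then show ?thesis using supp(2) by (simp add: q_def)
  qed
  have L: "L \<ge> 0" using bnd[of 0] by linarith
  have intW: "integrable lborel (\<lambda>x. c * indicator W x)" for c :: real
    unfolding W_def using emeasure_lborel_cball_finite by (intro integrable_mult_right integrable_real_indicator) auto
  note dom = intW[of L]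
  have qbW: "\<bar>q n x\<bar> \<le> L * indicator W x" for n x
    using qb qz L by (auto simp: indicator_def)
  have m: "q n \<in> borel_measurable lborel" for n unfolding q_def by measurable
  have m': "(\<lambda>x. v' x e) \<in> borel_measurable lborel"
    by (rule borel_measurable_LIMSEQ_real[where u = q]) (use lim m in auto)
  show "integrable lborel (\<lambda>x. v' x e)"
    by (rule integrable_dominated_convergence[where s = q, OF m' m dom]) (use lim qbW in auto)
  have vint: "integrable lborel v"
  proof -
    have v0: "v x = 0" if "x \<notin> W" for x
    proof -
      have "norm x > R" using that norm_ge_zero[of e] unfolding W_def mem_cball_0 by linarith
      then show ?thesis using R[of x] supp(2)[of x] by force
    qed
    have "compact W" by (simp add: W_def)
    obtain C where C: "C \<ge> 0" "\<And>x. norm (v x) \<le> C"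
      using compact_support_bounded[OF cont \<open>compact W\<close> v0] by blast
    have "norm (v x) \<le> norm (C * indicator W x)" for x
      using C v0[of x] by (auto simp: indicator_def)
    then show ?thesis
      by (intro Bochner_Integration.integrable_bound[OF intW[of C]]) auto
  qed
  have "(LINT x|lborel. q n x) = 0" for n
  proof -
    let ?t = "inverse (real (Suc n)) *\<^sub>R e"
    have "integrable lborel (\<lambda>x. v (?t + x))" "(LINT x|lborel. v (?t + x)) = (LINT x|lborel. v x)"
    proof -
      have d: "distr lborel borel ((+) ?t) = lborel" by (rule lborel_distr_plus)
      show "integrable lborel (\<lambda>x. v (?t + x))"
        using vint integrable_distr_eq[of "(+) ?t" lborel borel v] d by simp
      show "(LINT x|lborel. v (?t + x)) = (LINT x|lborel. v x)"
        using integral_distr[of "(+) ?t" lborel borel v] d by simp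
    qed
    then show ?thesis using vint by (simp add: q_def add.commute)
  qed
  moreover have "(\<lambda>n. LINT x|lborel. q n x) \<longlonglongrightarrow> (LINT x|lborel. v' x e)"
    by (rule integral_dominated_convergence[where s = q, OF m' m dom]) (use lim qbW in auto)
  ultimately show "(LINT x|lborel. v' x e) = 0"
    by (simp add: LIMSEQ_const_iff)
qed

section \<open>Weighted integrals in sum spaces and polynomial approximation\<close>

lemma le_1_plus_powr:
  fixes x q :: real
  assumes "1 \<le> q" "0 \<le> x"
  shows "x \<le> 1 + x powr q"
proof (cases "x \<le> 1")
  case False
  then have "x powr 1 \<le> x powr q" using assms by (intro powr_mono) auto
  then show ?thesis using False by simp
qed (simp add: add_increasing2)

lemma Lp_norm_le_imp_integral_le:
  assumes "0 < q" "Lp_norm q \<Omega> v \<le> C"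
  shows "(LINT x|lebesgue_on \<Omega>. norm (v x) powr q) \<le> C powr q"
proof -
  let ?I = "LINT x|lebesgue_on \<Omega>. norm (v x) powr q"
  have I: "0 \<le> ?I" by (simp add: integral_nonneg_AE)
  have "?I = (?I powr (1/q)) powr q" using assms I by (simp add: powr_powr)
  also have "\<dots> \<le> C powr q" using assms by (intro powr_mono2) (auto simp: Lp_norm_def)
  finally show ?thesis .
qed

text \<open>Pairs the sum space with weights bounded in L1 and Linf. From |g| \<le> 1 + |g|^2 and
  |h| \<le> 1 + |h|^q one gets |v| \<le> 2 + |g|^2 + |h|^q; the integral of the weight takes care of
  the 2, its upper bound of the powers. The constant is explicit so that it can be used uniformly in
  time.\<close>

lemma L2_plus_Lq_weighted_integral:
  fixes v :: "real^3 \<Rightarrow> 'b::euclidean_space"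
  assumes q: "1 \<le> q" and v: "v \<in> L2_plus_Lq q \<Omega>" and C: "sum_norm q \<Omega> v \<le> C"
    and w: "integrable (lebesgue_on \<Omega>) w" "(LINT x|lebesgue_on \<Omega>. w x) \<le> c"
    and w_bd: "AE x in lebesgue_on \<Omega>. 0 \<le> w x \<and> w x \<le> c" and "0 \<le> c"
  shows "integrable (lebesgue_on \<Omega>) (\<lambda>x. w x * norm (v x))"
    and "(LINT x|lebesgue_on \<Omega>. w x * norm (v x)) \<le> 2 * c + c * (C + 1) powr 2 + c * (C + 1) powr q"
proof -
  let ?M = "lebesgue_on \<Omega>"
  let ?S = "{Lp_norm 2 \<Omega> g + Lp_norm q \<Omega> h | g h. sum_decomp q \<Omega> v g h}"
  have nn: "0 \<le> Lp_norm s \<Omega> g" for s and g :: "real^3 \<Rightarrow> 'b" by (simp add: Lp_norm_def)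
  have "?S \<noteq> {}" using v by (auto simp: L2_plus_Lq_def)
  \<comment> \<open>The infimum defining \<open>sum_norm\<close> need not be attained; an excess of
    1 yields an actual decomposition.\<close>
  moreover have "Inf ?S < C + 1" using C by (simp add: sum_norm_def)
  ultimately have "\<exists>y\<in>?S. y < C + 1" by (rule cInf_lessD)
  then obtain g h where dec: "sum_decomp q \<Omega> v g h" and "Lp_norm 2 \<Omega> g + Lp_norm q \<Omega> h < C + 1"
    by blast
  then have le: "Lp_norm 2 \<Omega> g \<le> C + 1" "Lp_norm q \<Omega> h \<le> C + 1"
    using nn[of 2 g] nn[of q h] by linarith+
  have gi: "integrable ?M (\<lambda>x. norm (g x) powr 2)" and hi: "integrable ?M (\<lambda>x. norm (h x) powr q)"
    and vgh: "AE x in ?M. v x = g x + h x"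
    using dec by (auto simp: sum_decomp_def in_Lp_def)
  have vm: "v \<in> borel_measurable ?M" using v by (simp add: L2_plus_Lq_def)
  let ?B = "\<lambda>x. 2 * w x + c * (norm (g x) powr 2) + c * (norm (h x) powr q)"
  have Bi: "integrable ?M ?B" using gi hi w by auto
  have bd: "AE x in ?M. norm (w x * norm (v x)) \<le> ?B x"
    using vgh w_bd
  proof eventually_elim
    case (elim x)
    have "norm (v x) \<le> norm (g x) + norm (h x)" using elim by (simp add: norm_triangle_ineq)
    also have "\<dots> \<le> (1 + norm (g x) powr 2) + (1 + norm (h x) powr q)"
      using q by (intro add_mono le_1_plus_powr) auto
    finally have "w x * norm (v x) \<le> w x * (2 + norm (g x) powr 2 + norm (h x) powr q)"
      using elim by (intro mult_left_mono) auto
    also have "\<dots> = 2 * w x + w x * norm (g x) powr 2 + w x * norm (h x) powr q"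
      by (simp add: algebra_simps)
    also have "\<dots> \<le> ?B x"
      using elim by (intro add_mono mult_right_mono) auto
    finally show ?case using elim by simp
  qed
  show i: "integrable ?M (\<lambda>x. w x * norm (v x))"
    by (rule Bochner_Integration.integrable_bound[OF Bi]) (use bd w vm in auto)
  have "(LINT x|?M. w x * norm (v x)) \<le> (LINT x|?M. ?B x)"
    by (rule integral_mono_AE[OF i Bi]) (use bd in auto)
  also have "\<dots> = 2 * (LINT x|?M. w x) + c * (LINT x|?M. norm (g x) powr 2)
                + c * (LINT x|?M. norm (h x) powr q)"
    using gi hi w by simp
  also have "\<dots> \<le> 2 * c + c * (C + 1) powr 2 + c * (C + 1) powr q"
    using Lp_norm_le_imp_integral_le[OF _ le(1)] Lp_norm_le_imp_integral_le[OF _ le(2)] q w \<open>0 \<le> c\<close>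
    by (intro add_mono mult_left_mono) auto
  finally show "(LINT x|?M. w x * norm (v x)) \<le> 2 * c + c * (C + 1) powr 2 + c * (C + 1) powr q" .
qed

section \<open>Polynomial approximation in C1 with a prescribed value\<close>

lemma real_polynomial_antiderivative:
  fixes q :: "real \<Rightarrow> real"
  assumes "real_polynomial_function q"
  obtains Q where "real_polynomial_function Q" "\<And>s. (Q has_real_derivative q s) (at s)"
proof -
  obtain a n where q: "q = (\<lambda>x. \<Sum>i\<le>n. a i * x ^ i)"
    using assms by (auto simp: real_polynomial_function_iff_sum)
  define Q where "Q = (\<lambda>x. \<Sum>i\<le>n. a i / real (Suc i) * x ^ Suc i)"
  have id: "real_polynomial_function (\<lambda>x::real. x)"
    by (intro real_polynomial_function.intros bounded_linear_ident)
  have "real_polynomial_function Q"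
    unfolding Q_def by (intro real_polynomial_function_sum real_polynomial_function.intros(2,4)
      real_polynomial_function_power id) auto
  moreover have "(Q has_real_derivative q s) (at s)" for s
    unfolding Q_def q by (auto intro!: derivative_eq_intros sum.cong simp del: power_Suc)
  ultimately show thesis using that by blast
qed

text \<open>Weierstrass approximation is applied to the derivative, and the polynomial is then
  integrated from \<open>b\<close>. The value at \<open>b\<close> is thereby exact, and elsewhere
  the error is at most the length of the interval times the error of the derivative.\<close>

lemma C1_polynomial_approx_at:
  fixes G k :: "real \<Rightarrow> real"
  assumes G: "\<And>s. s \<in> {c..d} \<Longrightarrow> (G has_real_derivative k s) (at s within {c..d})"
    and k: "continuous_on {c..d} k" and e: "e > 0" and b: "b \<in> {c..d}"
  obtains P P' where "real_polynomial_function P" "\<And>s. (P has_real_derivative P' s) (at s)"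
    "P b = G b" "\<And>s. s \<in> {c..d} \<Longrightarrow> \<bar>P s - G s\<bar> < e" "\<And>s. s \<in> {c..d} \<Longrightarrow> \<bar>P' s - k s\<bar> < e"
proof -
  \<comment> \<open>Chosen so that both e' and e' * (d - c) stay within \<open>e\<close>, whether
    the interval is long or a single point.\<close>
  define e' where "e' = e / (2 + (d - c))"
  have D: "0 \<le> d - c" using b by simp
  then have pos: "e' > 0" using e by (simp add: e'_def)
  moreover have "e' * (2 + (d - c)) = e" using D by (simp add: e'_def)
  ultimately have e': "e' > 0" "e' \<le> e" "e' * (d - c) < e"
    using mult_nonneg_nonneg[OF less_imp_le[OF pos] D] by (auto simp only: distrib_left)
  obtain q where q: "real_polynomial_function q" "\<And>s. s \<in> {c..d} \<Longrightarrow> \<bar>k s - q s\<bar> < e'"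
    using Stone_Weierstrass_real_polynomial_function[OF compact_Icc k e'(1)] by blast
  obtain Q where Q: "real_polynomial_function Q" "\<And>s. (Q has_real_derivative q s) (at s)"
    using real_polynomial_antiderivative[OF q(1)] by blast
  define P where "P s = Q s + (G b - Q b)" for s
  have P: "real_polynomial_function P" "\<And>s. (P has_real_derivative q s) (at s)" "P b = G b"
  proof -
    show "real_polynomial_function P"
      unfolding P_def by (intro real_polynomial_function.intros(3)[OF Q(1)] real_polynomial_function.intros(2))
    show "(P has_real_derivative q s) (at s)" for s
      unfolding P_def by (auto intro!: derivative_eq_intros Q(2))
  qed (simp add: P_def)
  have "\<bar>P s - G s\<bar> < e" if s: "s \<in> {c..d}" for s
  proof -
    have "norm ((P s - G s) - (P b - G b)) \<le> e' * norm (s - b)"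
    proof (rule field_differentiable_bound[of "{c..d}" _ "\<lambda>s. q s - k s"])
      fix z assume z: "z \<in> {c..d}"
      show "((\<lambda>s. P s - G s) has_field_derivative q z - k z) (at z within {c..d})"
        using G[OF z] P(2)[of z] by (auto intro!: derivative_intros intro: has_field_derivative_at_within)
      show "norm (q z - k z) \<le> e'" using q(2)[OF z] by (simp add: abs_minus_commute)
    qed (use s b in auto)
    also have "\<dots> \<le> e' * (d - c)" using s b e' by (intro mult_left_mono) auto
    finally show ?thesis using e' P(3) by simp
  qed
  moreover have "\<bar>q s - k s\<bar> < e" if "s \<in> {c..d}" for s
    using q(2)[OF that] e' by (simp add: abs_minus_commute)
  ultimately show thesis using that P by blast
qed

text \<open>When the prescribed zero \<open>b\<close> lies to the left of the interval, it is enforced by approximating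
  \<open>G s / (s - b)\<close> instead of \<open>G\<close>.\<close>

lemma C1_polynomial_approx_zero:
  fixes G k :: "real \<Rightarrow> real"
  assumes G: "\<And>s. s \<in> {c..d} \<Longrightarrow> (G has_real_derivative k s) (at s within {c..d})"
    and k: "continuous_on {c..d} k" and e: "e > 0" and cd: "c \<le> d"
    and b: "b \<in> {c..d} \<and> G b = 0 \<or> b < c"
  obtains P P' where "real_polynomial_function P" "\<And>s. (P has_real_derivative P' s) (at s)"
    "P b = 0" "\<And>s. s \<in> {c..d} \<Longrightarrow> \<bar>P s - G s\<bar> < e" "\<And>s. s \<in> {c..d} \<Longrightarrow> \<bar>P' s - k s\<bar> < e"
proof (cases "b < c")
  case False
  then show thesis using C1_polynomial_approx_at[OF G k e, of b] b that by metis
next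
  case True
  \<comment> \<open>The factor 1 + (d - b) pays for P' = Q + (s - b) Q', whose error is that of Q
    plus at most d - b times that of Q'.\<close>
  define e' where "e' = e / (2 + (d - b))"
  have e': "e' > 0" "e' * (1 + (d - b)) < e"
    using e cd True by (auto simp: e'_def field_simps intro!: add_pos_nonneg)
  define g where "g s = G s / (s - b)" for s
  define g' where "g' s = (k s * (s - b) - G s) / ((s - b) * (s - b))" for s
  have "(g has_real_derivative g' s) (at s within {c..d})" if "s \<in> {c..d}" for s
    using G[OF that] that True unfolding g_def g'_def by (auto intro!: derivative_eq_intros)
  moreover have "continuous_on {c..d} G"
    using G by (intro DERIV_continuous_on)
  then have "continuous_on {c..d} g'"
    unfolding g'_def using k True by (intro continuous_intros) auto
  \<comment> \<open>The base point \<open>c\<close> is an arbitrary choice in the interval; the zero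
    at \<open>b\<close> will come from the factor s - b.\<close>
  ultimately obtain Q Q' where Q: "real_polynomial_function Q" "\<And>s. (Q has_real_derivative Q' s) (at s)"
    "\<And>s. s \<in> {c..d} \<Longrightarrow> \<bar>Q s - g s\<bar> < e'" "\<And>s. s \<in> {c..d} \<Longrightarrow> \<bar>Q' s - g' s\<bar> < e'"
    using C1_polynomial_approx_at[of c d g g' e' c] e' cd by (metis atLeastAtMost_iff order_refl)
  define P where "P s = (s - b) * Q s" for s
  define P' where "P' s = Q s + (s - b) * Q' s" for s
  have "real_polynomial_function P"
    unfolding P_def
    by (intro real_polynomial_function.intros(4)[OF real_polynomial_function_diff Q(1)]
        real_polynomial_function.intros(1)[OF bounded_linear_ident] real_polynomial_function.intros(2))
  moreover have "(P has_real_derivative P' s) (at s)" for s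
    unfolding P_def P'_def by (auto intro!: derivative_eq_intros Q(2))
  moreover have "\<bar>P s - G s\<bar> < e \<and> \<bar>P' s - k s\<bar> < e" if s: "s \<in> {c..d}" for s
  proof
    have sb: "0 < s - b" "s - b \<le> d - b" using s True by auto
    have 1: "P s - G s = (s - b) * (Q s - g s)" using sb by (simp add: P_def g_def field_simps)
    have "\<bar>(s - b) * (Q s - g s)\<bar> \<le> (d - b) * e'"
      unfolding abs_mult using sb Q(3)[OF s] by (intro mult_mono) auto
    then show "\<bar>P s - G s\<bar> < e" unfolding 1 using e' by (simp add: algebra_simps)
    have 2: "P' s - k s = (Q s - g s) + (s - b) * (Q' s - g' s)"
    proof -
      have "\<sigma> * ((K * \<sigma> - A) / (\<sigma> * \<sigma>)) = K - A / \<sigma>" if "\<sigma> \<noteq> 0" for \<sigma> K A :: real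
        using that by (simp add: field_simps)
      from this[of "s - b" "k s" "G s"] have "(s - b) * g' s = k s - g s"
        using sb by (simp add: g_def g'_def)
      then show ?thesis by (simp add: P'_def algebra_simps)
    qed
    have "\<bar>(s - b) * (Q' s - g' s)\<bar> \<le> (d - b) * e'"
      unfolding abs_mult using sb Q(4)[OF s] by (intro mult_mono) auto
    then show "\<bar>P' s - k s\<bar> < e" unfolding 2 using e' Q(3)[OF s] by (simp add: algebra_simps)
  qed
  ultimately show thesis using that[of P P'] by (simp add: P_def)
qed

section \<open>The pressure potential\<close>

locale pressure_law =
  fixes p :: "real \<Rightarrow> real" and \<rho>b :: real
  assumes \<rho>b_nonneg: "\<rho>b \<ge> 0"
    and p_cont: "continuous_on {0..} p"
    and p_C2: "\<And>z. z > 0 \<Longrightarrow> p differentiable (at z)"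
              "\<And>z. z > 0 \<Longrightarrow> deriv p differentiable (at z)"
    and p_zero: "p 0 = 0"
    and p_mono: "\<And>z. z > 0 \<Longrightarrow> deriv p z > 0"
    and H_finite: "\<rho>b = 0 \<Longrightarrow> (\<forall>s>0. set_integrable lborel {0<..<s} (\<lambda>z. p z / z\<^sup>2))"
begin

lemma p_deriv: "z > 0 \<Longrightarrow> (p has_real_derivative deriv p z) (at z)"
  using p_C2(1) by (simp add: DERIV_deriv_iff_real_differentiable)

lemma continuous_deriv_p: "continuous_on {0<..} (deriv p)"
  using p_C2(2) by (intro continuous_at_imp_continuous_on) (auto intro: differentiable_imp_continuous_within)

lemma p_less: "0 \<le> s \<Longrightarrow> s < t \<Longrightarrow> p s < p t"
  using p_mono
  by (intro DERIV_pos_imp_increasing_open[of s t p])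
     (auto intro!: exI[of _ "deriv p _"] p_deriv continuous_on_subset[OF p_cont])

lemma p_pos: "s > 0 \<Longrightarrow> p s > 0"
  using p_less[of 0 s] p_zero by simp

lemma continuous_integrand: "continuous_on {0<..} (\<lambda>z. p z / z\<^sup>2)"
  by (intro continuous_intros continuous_on_subset[OF p_cont]) auto

text \<open>H(s) / s, the antiderivative of p(z) / z^2 that vanishes at \<rho>b. For \<rho>b = 0 the
  lower limit is the singular point of the integrand.\<close>

definition J :: "real \<Rightarrow> real" where "J s = (LBINT z=ereal \<rho>b..ereal s. p z / z\<^sup>2)"

text \<open>Away from 0 the integrand is continuous; 0 itself is a limit of integration only for
  \<rho>b = 0, where \<open>H_finite\<close> applies.\<close>

lemma integrand_integrable:
  assumes "0 < b" "0 < a \<or> a = 0 \<and> \<rho>b = 0"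
  shows "set_integrable lborel {a<..<b} (\<lambda>z. p z / z\<^sup>2)"
proof (cases "0 < a")
  case True
  have "set_integrable lborel {a..b} (\<lambda>z. p z / z\<^sup>2)"
    using True by (intro borel_integrable_atLeastAtMost' continuous_on_subset[OF continuous_integrand]) auto
  then show ?thesis by (rule set_integrable_subset) auto
qed (use assms H_finite in auto)

text \<open>Moves the base point from \<rho>b, possibly singular, to a positive \<open>c\<close>,
  from which the fundamental theorem of calculus can be applied. The three points may come in any
  order, hence the minima and maxima in the proof.\<close>

lemma J_split:
  assumes "0 < c" "0 < s"
  shows "J s = J c + (LBINT z=ereal c..ereal s. p z / z\<^sup>2)"
proof -
  have "0 < max \<rho>b (max c s)" "min \<rho>b (min c s) \<le> max \<rho>b (max c s)"
    "0 < min \<rho>b (min c s) \<or> min \<rho>b (min c s) = 0 \<and> \<rho>b = 0"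
    using \<rho>b_nonneg assms by (auto simp: min_def)
  then have "interval_lebesgue_integrable lborel (ereal (min \<rho>b (min c s)))
      (ereal (max \<rho>b (max c s))) (\<lambda>z. p z / z\<^sup>2)"
    using integrand_integrable[of "max \<rho>b (max c s)" "min \<rho>b (min c s)"]
    by (simp only: interval_lebesgue_integrable_def einterval_eq ereal_less_eq if_True)
  then have "(LBINT z=ereal \<rho>b..ereal c. p z / z\<^sup>2) + (LBINT z=ereal c..ereal s. p z / z\<^sup>2)
      = (LBINT z=ereal \<rho>b..ereal s. p z / z\<^sup>2)"
    unfolding ereal_min ereal_max by (rule interval_integral_sum)
  then show ?thesis by (simp add: J_def)
qed

lemma J_deriv:
  assumes "s > 0"
  shows "(J has_real_derivative p s / s\<^sup>2) (at s)"
proof -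
  \<comment> \<open>Any point of (0, s) would serve as base point; \<open>s\<close> is then interior
    to {c..2 * s}.\<close>
  define c where "c = s / 2"
  have c: "0 < c" "c < s" using assms by (auto simp: c_def)
  have "((\<lambda>u. LBINT z=ereal c..ereal u. p z / z\<^sup>2) has_vector_derivative (p s / s\<^sup>2)) (at s within {c..2 * s})"
    using assms c by (intro interval_integral_FTC2 continuous_on_subset[OF continuous_integrand]) auto
  then have "((\<lambda>u. LBINT z=ereal c..ereal u. p z / z\<^sup>2) has_real_derivative (p s / s\<^sup>2)) (at s)"
    using assms c by (subst (asm) at_within_interior)
      (auto simp: has_real_derivative_iff_has_vector_derivative)
  then have "((\<lambda>u. J c + (LBINT z=ereal c..ereal u. p z / z\<^sup>2)) has_real_derivative (p s / s\<^sup>2)) (at s)"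
    by (auto intro!: derivative_eq_intros)
  then show ?thesis
    by (rule has_field_derivative_transform_within_open[of _ _ _ "{0<..}"])
       (use assms J_split[OF c(1), symmetric] in auto)
qed

lemma H_eq: "s \<noteq> 0 \<Longrightarrow> H p \<rho>b s = s * J s"
  by (simp add: H_def H_formula_def J_def)

lemma H_deriv:
  assumes "s > 0"
  shows "(H p \<rho>b has_real_derivative J s + p s / s) (at s)"
proof -
  have "((\<lambda>s. s * J s) has_real_derivative J s + p s / s) (at s)"
    using J_deriv[OF assms] assms by (auto intro!: derivative_eq_intros simp: power2_eq_square)
  then show ?thesis
    by (rule has_field_derivative_transform_within_open[of _ _ _ "{0<..}"]) (use assms H_eq in auto)
qed

lemma dH_eq: "s > 0 \<Longrightarrow> dH p \<rho>b s = J s + p s / s"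
  using DERIV_imp_deriv[OF H_deriv] by (simp add: dH_def)

text \<open>H'' = p' / s: the term p / s^2 coming from \<open>J\<close> cancels the one from the
  quotient rule. This turns r H''(r) into p'(r), and it makes H' strictly increasing.\<close>

lemma dH_deriv:
  assumes "s > 0"
  shows "(dH p \<rho>b has_real_derivative deriv p s / s) (at s)"
proof -
  have "((\<lambda>s. J s + p s / s) has_real_derivative deriv p s / s) (at s)"
    using J_deriv[OF assms] p_deriv[OF assms] assms
    by (auto intro!: derivative_eq_intros simp: power2_eq_square field_simps)
  then show ?thesis
    by (rule has_field_derivative_transform_within_open[of _ _ _ "{0<..}"]) (use assms dH_eq in auto)
qed

text \<open>Through this identity the part of the relative energy that depends on r alone, r H'(r) -
  H(r), becomes the pressure p(r).\<close>

lemma pressure_eq: "s > 0 \<Longrightarrow> s * dH p \<rho>b s - H p \<rho>b s = p s"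
  by (simp add: dH_eq H_eq field_simps)

lemma dH_less:
  assumes "0 < s" "s < t"
  shows "dH p \<rho>b s < dH p \<rho>b t"
proof (rule DERIV_pos_imp_increasing[OF assms(2)])
  fix x assume "s \<le> x" "x \<le> t"
  then have "x > 0" using assms by simp
  then show "\<exists>y. (dH p \<rho>b has_real_derivative y) (at x) \<and> 0 < y"
    using dH_deriv p_mono by (intro exI[of _ "deriv p x / x"]) auto
qed

text \<open>H is convex on the open half-line because H' increases there. Vacuum, s = 0, is not
  covered and is treated separately.\<close>

lemma H_above_tangent:
  assumes "0 < s" "0 < t"
  shows "H p \<rho>b s \<ge> H p \<rho>b t + dH p \<rho>b t * (s - t)"
proof -
  have "convex_on {0<..} (H p \<rho>b)"
  proof (rule convex_on_realI[where f' = "dH p \<rho>b"])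
    show "(H p \<rho>b has_real_derivative dH p \<rho>b x) (at x)" if "x \<in> {0<..}" for x
      using that H_deriv[of x] dH_eq[of x] by simp
    show "dH p \<rho>b x \<le> dH p \<rho>b y" if "x \<in> {0<..}" "x \<le> y" for x y
      using that dH_less[of x y] by (cases "x = y") auto
  qed auto
  then have "H p \<rho>b s - H p \<rho>b t \<ge> dH p \<rho>b t * (s - t)"
    by (rule convex_on_imp_above_tangent)
       (use assms H_deriv[of t] dH_eq[of t] in \<open>auto simp: interior_open intro: has_field_derivative_at_within\<close>)
  then show ?thesis by simp
qed

section \<open>Limits of H and H' at vacuum\<close>

lemma p_tendsto_0: "(p \<longlongrightarrow> 0) (at_right 0)"
proof -
  have "(p \<longlongrightarrow> p 0) (at 0 within {0..})"
    using p_cont by (simp add: continuous_on_def)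
  then have "(p \<longlongrightarrow> p 0) (at_right 0)"
    by (rule tendsto_within_subset) auto
  then show ?thesis using p_zero by simp
qed

text \<open>\<open>J\<close> may diverge at 0 when \<rho>b > 0, so s J(s) is read as J(s) / (1/s).
  By l'Hopital's rule with denominator tending to infinity, the quotient of the derivatives is
  -p(s), which tends to 0.\<close>

lemma H_formula_tendsto_0: "((\<lambda>s. s * J s) \<longlongrightarrow> 0) (at_right 0)"
proof -
  have "((\<lambda>s. J s / inverse s) \<longlongrightarrow> 0) (at_right 0)"
  proof (rule lhopital_right_0_at_top)
    show "LIM x at_right (0::real). inverse x :> at_top"
      by (rule filterlim_inverse_at_top_right)
    show "\<forall>\<^sub>F x in at_right (0::real). - inverse (x\<^sup>2) \<noteq> 0"
      by (rule eventually_mono[OF eventually_at_right_less]) simp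
    show "\<forall>\<^sub>F x in at_right 0. (J has_real_derivative p x / x\<^sup>2) (at x)"
      by (rule eventually_mono[OF eventually_at_right_less]) (rule J_deriv)
    show "\<forall>\<^sub>F x in at_right (0::real). (inverse has_real_derivative - inverse (x\<^sup>2)) (at x)"
      by (rule eventually_mono[OF eventually_at_right_less])
         (auto simp: power2_eq_square intro!: derivative_eq_intros)
    have "((\<lambda>x. - p x) \<longlongrightarrow> 0) (at_right 0)"
      using tendsto_minus[OF p_tendsto_0] by simp
    moreover have "\<forall>\<^sub>F x in at_right (0::real). - p x = p x / x\<^sup>2 / - inverse (x\<^sup>2)"
      by (rule eventually_mono[OF eventually_at_right_less]) (simp add: divide_inverse)
    ultimately show "((\<lambda>x. p x / x\<^sup>2 / - inverse (x\<^sup>2)) \<longlongrightarrow> 0) (at_right 0)"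
      by (rule Lim_transform_eventually)
  qed
  moreover have "(\<lambda>s. J s / inverse s) = (\<lambda>s. s * J s)"
    by (rule ext) (simp only: divide_inverse inverse_inverse_eq mult.commute)
  ultimately show ?thesis by (simp only:)
qed

lemma H_0: "H p \<rho>b 0 = 0"
proof -
  have "H_formula p \<rho>b = (\<lambda>s. s * J s)" by (auto simp: H_formula_def J_def)
  then show ?thesis
    using H_formula_tendsto_0 by (simp add: H_def tendsto_Lim)
qed

text \<open>By \<open>H_finite\<close> the integrand is integrable up to 0, and an indefinite
  integral is continuous at its base point.\<close>

lemma J_tendsto_0:
  assumes "\<rho>b = 0"
  shows "(J \<longlongrightarrow> 0) (at_right 0)"
proof -
  let ?f = "\<lambda>z. p z / z\<^sup>2"
  have int: "set_integrable lborel {0..s} ?f" if "s > 0" for s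
  proof -
    have "set_integrable lborel {0<..<s} ?f"
      using integrand_integrable[of s 0] that assms by simp
    then show ?thesis
      unfolding set_integrable_def
      by (rule integrable_discrete_difference[where X = "{0, s}", THEN iffD1, rotated -1])
         (auto simp: indicator_def)
  qed
  have eq: "J s = integral {0..s} ?f" if "s > 0" for s
    using interval_integral_eq_integral[OF less_imp_le[OF that] int[OF that]] unfolding J_def unfolding assms .
  have "?f integrable_on {0..1}"
    using int[of 1] set_borel_integral_eq_integral(1) by auto
  then have "continuous_on {0..1} (\<lambda>s. integral {0..s} ?f)"
    by (rule indefinite_integral_continuous_1)
  from this[unfolded continuous_on_def, rule_format, of 0]
  have "((\<lambda>s. integral {0..s} ?f) \<longlongrightarrow> 0) (at 0 within {0..1})" by simp
  then have "((\<lambda>s. integral {0..s} ?f) \<longlongrightarrow> 0) (at_right 0)"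
    by (simp add: at_within_Icc_at_right)
  moreover have "\<forall>\<^sub>F s in at_right 0. integral {0..s} ?f = J s"
    by (rule eventually_mono[OF eventually_at_right_less]) (rule eq[symmetric])
  ultimately show ?thesis by (rule Lim_transform_eventually)
qed

lemma J_nonneg:
  assumes "\<rho>b = 0" "s > 0"
  shows "J s \<ge> 0"
proof -
  have "(LBINT z:{0<..<s}. p z / z\<^sup>2) \<ge> 0"
    unfolding set_lebesgue_integral_def
    by (intro integral_nonneg_AE AE_I2) (use p_pos in \<open>auto simp: indicator_def less_imp_le\<close>)
  then show ?thesis
    using assms(2) unfolding J_def unfolding assms(1)
    by (simp only: interval_lebesgue_integral_def einterval_eq ereal_less_eq less_imp_le if_True)
qed

text \<open>As H' = J + p / s and \<open>J\<close> tends to 0, only p(s) / s is in question. Since p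
  increases, J(2s) - J(s) is at least p(s) times the integral of 1 / z^2 over [s, 2s], that is p(s)
  / (2s). Hence 0 \<le> H'(s) \<le> 2 J(2s).\<close>

lemma dH_0:
  assumes "\<rho>b = 0"
  shows "dH p \<rho>b 0 = 0"
proof -
  \<comment> \<open>With p(s) frozen, J(z) + p(s) / z has derivative (p(z) - p(s)) / z^2, which is
    nonnegative for z \<ge> s.\<close>
  have mono: "J s + p s / s \<le> J (2 * s) + p s / (2 * s)" if "s > 0" for s
  proof (rule DERIV_nonneg_imp_nondecreasing[of s "2 * s" "\<lambda>z. J z + p s / z"])
    fix z assume z: "s \<le> z" "z \<le> 2 * s"
    then have "p s \<le> p z" using p_less[of s z] that by (cases "s = z") auto
    moreover have "((\<lambda>z. J z + p s / z) has_real_derivative (p z - p s) / z\<^sup>2) (at z)"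
      using J_deriv[of z] z that
      by (auto intro!: derivative_eq_intros simp: power2_eq_square diff_divide_distrib)
    ultimately show "\<exists>y. ((\<lambda>z. J z + p s / z) has_real_derivative y) (at z) \<and> 0 \<le> y"
      by (intro exI[of _ "(p z - p s) / z\<^sup>2"]) auto
  qed (use that in auto)
  note J_nonneg = J_nonneg[OF assms]
  have J2: "((\<lambda>s. J (2 * s)) \<longlongrightarrow> 0) (at_right 0)"
    using J_tendsto_0[OF assms]
  proof (rule filterlim_compose)
    have "((\<lambda>s::real. 2 * s) \<longlongrightarrow> 2 * 0) (at_right 0)" by (intro tendsto_intros)
    then show "filterlim (\<lambda>s::real. 2 * s) (at_right 0) (at_right 0)"
      by (auto simp: filterlim_at eventually_at_right_field intro!: exI[of _ 1])
  qed
  have bd: "0 \<le> J s + p s / s" "J s + p s / s \<le> 2 * J (2 * s)" if "s > 0" for s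
  proof -
    have "p s / (2 * s) = p s / s - p s / (2 * s)" by (simp add: field_simps)
    then have "p s / (2 * s) + J s \<le> J (2 * s)" using mono[OF that] by linarith
    moreover have "p s / (2 * s) = (p s / s) / 2" by simp
    ultimately have "p s / s + 2 * J s \<le> 2 * J (2 * s)" by linarith
    then show "J s + p s / s \<le> 2 * J (2 * s)" using J_nonneg[OF that] by linarith
    show "0 \<le> J s + p s / s" using J_nonneg[OF that] p_pos[OF that] that by simp
  qed
  have "((\<lambda>s. J s + p s / s) \<longlongrightarrow> 0) (at_right 0)"
  proof (rule tendsto_sandwich[where f = "\<lambda>_. 0" and h = "\<lambda>s. 2 * J (2 * s)"])
    show "((\<lambda>s. 2 * J (2 * s)) \<longlongrightarrow> 0) (at_right 0)"
      using tendsto_mult_left[OF J2, of 2] by simp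
  qed (use bd in \<open>auto simp: eventually_at_right_field intro!: exI[of _ 1]\<close>)
  moreover have "\<forall>\<^sub>F s in at_right 0. J s + p s / s = deriv (H p \<rho>b) s"
    using DERIV_imp_deriv[OF H_deriv] by (auto simp: eventually_at_right_field intro!: exI[of _ 1])
  ultimately have "(deriv (H p \<rho>b) \<longlongrightarrow> 0) (at_right 0)"
    by (rule Lim_transform_eventually)
  then show ?thesis by (simp add: dH_def tendsto_Lim)
qed

section \<open>Potential energy relative to the far field\<close>

definition potential :: "real \<Rightarrow> real" where
  "potential s = H p \<rho>b s - dH p \<rho>b \<rho>b * (s - \<rho>b) - H p \<rho>b \<rho>b"

text \<open>This is the gap between H and its tangent at \<rho>b. The tangent inequality concerns s
  > 0; at s = 0 and \<rho>b > 0 the gap is p(\<rho>b), and for \<rho>b = 0 the whole function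
  reduces to s J(s).\<close>

lemma potential_nonneg:
  assumes "0 \<le> s"
  shows "0 \<le> potential s"
proof (cases "\<rho>b = 0")
  case True
  then show ?thesis
    using assms J_nonneg[OF True, of s] dH_0[OF True] H_0 H_eq[of s]
    unfolding potential_def
    by (cases "s = 0") (simp_all add: True[THEN arg_cong[where f = "dH p \<rho>b"]] True[THEN arg_cong[where f = "H p \<rho>b"]] zero_le_mult_iff)
next
  case False
  then have "\<rho>b > 0" using \<rho>b_nonneg by simp
  then have "\<rho>b * dH p \<rho>b \<rho>b - H p \<rho>b \<rho>b > 0" using pressure_eq p_pos by simp
  then show ?thesis
    using H_above_tangent[of s \<rho>b] assms \<open>\<rho>b > 0\<close>
    by (cases "s = 0") (auto simp: potential_def H_0 algebra_simps)
qed

text \<open>Convexity forces at least linear growth. It serves to control the initial density, of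
  which only finite energy is known.\<close>

lemma potential_lower_bound:
  obtains c C where "c > 0" "C \<ge> 0" "\<And>s. 0 \<le> s \<Longrightarrow> c * s \<le> potential s + C"
proof -
  \<comment> \<open>The tangent to \<open>potential\<close> at \<rho>b + 1 is c * s + C, with
    positive slope because H' increases strictly to the right of \<rho>b.\<close>
  let ?b = "\<rho>b + 1"
  define c where "c = dH p \<rho>b ?b - dH p \<rho>b \<rho>b"
  define C where "C = potential ?b - c * ?b"
  have "c > 0"
  proof (cases "\<rho>b = 0")
    case True
    then show ?thesis
      using J_nonneg[OF True, of 1] dH_0[OF True] dH_eq[of 1] p_pos[of 1]
      unfolding c_def by (simp add: True[THEN arg_cong[where f = "\<lambda>b. b + 1"]] True[THEN arg_cong[where f = "dH p \<rho>b"]])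
  next
    case False
    then show ?thesis using dH_less[of \<rho>b ?b] \<rho>b_nonneg by (simp add: c_def)
  qed
  moreover have "c * s \<le> potential s + \<bar>C\<bar>" if "0 \<le> s" for s
  proof (cases "s = 0")
    case True
    then show ?thesis using potential_nonneg[of s] by simp
  next
    case False
    then have "c * s + C \<le> potential s"
      using H_above_tangent[of s ?b] that \<rho>b_nonneg
      by (simp add: C_def c_def potential_def algebra_simps)
    then show ?thesis by simp
  qed
  ultimately show ?thesis using that[of c "\<bar>C\<bar>"] by simp
qed

end

section \<open>Derivatives in space and time\<close>

lemma AE_lebesgue_on_sections:
  fixes P :: "'a::euclidean_space \<times> 'b::euclidean_space \<Rightarrow> bool"
  assumes A: "A \<in> sets borel" and B: "B \<in> sets borel"
    and "AE z in lebesgue_on (A \<times> B). P z"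
  shows "AE t in lebesgue_on A. AE x in lebesgue_on B. P (t, x)"
proof -
  have S: "A \<times> B \<in> sets lebesgue" "A \<in> sets lebesgue" "B \<in> sets lebesgue"
    using sets_lebesgue_Times A B by auto
  have "AE z in lborel. z \<in> A \<times> B \<longrightarrow> P z"
    using assms(3) S by (simp add: AE_restrict_space_iff AE_completion_iff)
  then have "AE t in lborel. AE x in lborel. (t, x) \<in> A \<times> B \<longrightarrow> P (t, x)"
    by (rule AE_lborel_sections)
  then have "AE t in lborel. t \<in> A \<longrightarrow> (AE x in lborel. x \<in> B \<longrightarrow> P (t, x))"
    by eventually_elim auto
  then show ?thesis
    using S by (simp add: AE_restrict_space_iff AE_completion_iff)
qed

lemma integrable_dominated:
  fixes e g :: "'a \<Rightarrow> real"
  assumes "integrable M g" "e \<in> borel_measurable M" "AE z in M. \<bar>e z\<bar> \<le> C * g z"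
  shows "integrable M e"
proof (rule Bochner_Integration.integrable_bound)
  show "integrable M (\<lambda>z. C * g z)" using assms by simp
  show "AE z in M. norm (e z) \<le> norm (C * g z)"
    using assms(3) by eventually_elim simp
qed (use assms in auto)

section \<open>Linear algebra of matrices\<close>

lemma linear_transpose: "linear (transpose :: real^'n^'m \<Rightarrow> real^'m^'n)"
  by (rule linearI) (simp_all add: transpose_def vec_eq_iff)

lemma linear_trace: "linear (trace :: real^'n^'n \<Rightarrow> real)"
  by (rule linearI) (simp_all add: trace_def sum.distrib sum_distrib_left)

lemma linear_stress: "linear (stress \<mu> \<eta>)"
  by (rule linearI)
     (simp_all add: stress_def linear_add[OF linear_trace] linear_cmul[OF linear_trace]
       linear_add[OF linear_transpose] linear_cmul[OF linear_transpose] algebra_simps add_divide_distrib)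

lemma norm_tensor: "norm (tensor a b) = norm a * norm b"
proof -
  have "norm (tensor a b $ i) = norm (a $ i) * norm b" for i
  proof -
    have "tensor a b $ i = a $ i *\<^sub>R b" by (simp add: tensor_def vec_eq_iff)
    then show ?thesis by simp
  qed
  then show ?thesis
    by (simp add: norm_vec_def[of "tensor a b"] norm_vec_def[of a] L2_set_left_distrib)
qed

lemma tensor_inner: "tensor a b \<bullet> A = a \<bullet> (A *v b)"
  by (simp add: tensor_def inner_vec_def matrix_vector_mult_def sum_distrib_left mult_ac)

lemma abs_inner_matrix_vector_le:
  fixes a b :: "real^3"
  shows "\<bar>a \<bullet> (A *v b)\<bar> \<le> norm A * (norm a * norm b)"
  using Cauchy_Schwarz_ineq2[of "tensor a b" A] by (simp add: tensor_inner norm_tensor mult_ac)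

text \<open>Taken of the smooth extensions, these partial derivatives are continuous on all of
  space-time. The operators \<open>dt\<close>, \<open>grad\<close> and \<open>vgrad\<close> of U and
  r are identified with them only where function and extension agree near the point.\<close>

definition time_deriv :: "(real \<times> (real^3) \<Rightarrow> 'b::real_normed_vector) \<Rightarrow> real \<times> (real^3) \<Rightarrow> 'b" where
  "time_deriv \<psi> z = frechet_derivative \<psi> (at z) (1, 0)"

definition space_grad :: "(real \<times> (real^3) \<Rightarrow> real) \<Rightarrow> real \<times> (real^3) \<Rightarrow> real^3" where
  "space_grad \<psi> z = (\<chi> i. frechet_derivative \<psi> (at z) (0, axis i 1))"

definition space_jacobian :: "(real \<times> (real^3) \<Rightarrow> real^3) \<Rightarrow> real \<times> (real^3) \<Rightarrow> real^3^3" where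
  "space_jacobian \<psi> z = (\<chi> i j. frechet_derivative \<psi> (at z) (0, axis j 1) $ i)"

lemma has_derivative_partial:
  assumes "smooth \<psi>"
  shows "((\<lambda>s. \<psi> (s, x)) has_vector_derivative time_deriv \<psi> (t, x)) (at t within S)"
    and "((\<lambda>y. \<psi> (t, y)) has_derivative (\<lambda>v. frechet_derivative \<psi> (at (t, x)) (0, v))) (at x)"
proof -
  note D = smooth_imp_C1(1)[OF assms, of "(t, x)"]
  interpret bounded_linear "frechet_derivative \<psi> (at (t, x))"
    using D by (rule has_derivative_bounded_linear)
  have "((\<lambda>s. \<psi> (s, x)) has_derivative (\<lambda>h. frechet_derivative \<psi> (at (t, x)) (h, 0))) (at t within S)"
    by (rule has_derivative_compose[where f = "\<lambda>s. (s, x)" and g = \<psi>, OF _ D]) (auto intro!: derivative_eq_intros)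
  moreover have "frechet_derivative \<psi> (at (t, x)) (h, 0) = h *\<^sub>R time_deriv \<psi> (t, x)" for h
    using scaleR[of h "(1, 0)"] by (simp add: time_deriv_def)
  ultimately show "((\<lambda>s. \<psi> (s, x)) has_vector_derivative time_deriv \<psi> (t, x)) (at t within S)"
    by (simp add: has_vector_derivative_def)
  show "((\<lambda>y. \<psi> (t, y)) has_derivative (\<lambda>v. frechet_derivative \<psi> (at (t, x)) (0, v))) (at x)"
    by (rule has_derivative_compose[where f = "\<lambda>y. (t, y)" and g = \<psi>, OF _ D]) (auto intro!: derivative_eq_intros)
qed

lemma inner_space_grad:
  assumes "smooth \<psi>"
  shows "space_grad \<psi> z \<bullet> v = frechet_derivative \<psi> (at z) (0, v)"
proof -
  interpret bounded_linear "frechet_derivative \<psi> (at z)"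
    using smooth_imp_C1(1)[OF assms] by (rule has_derivative_bounded_linear)
  have "bounded_linear (\<lambda>v. frechet_derivative \<psi> (at z) (0, v))"
    by (rule bounded_linear_compose[OF bounded_linear_axioms])
       (auto intro: bounded_linear_Pair bounded_linear_zero bounded_linear_ident)
  then have lin: "linear (\<lambda>v. frechet_derivative \<psi> (at z) (0, v))"
    by (rule bounded_linear.linear)
  have "frechet_derivative \<psi> (at z) (0, \<Sum>i\<in>UNIV. v $ i *\<^sub>R axis i 1)
      = (\<Sum>i\<in>UNIV. v $ i * frechet_derivative \<psi> (at z) (0, axis i 1))"
    using linear_sum[OF lin, of "\<lambda>i. v $ i *\<^sub>R axis i 1" UNIV] linear_cmul[OF lin] by simp
  moreover have "(\<Sum>i\<in>UNIV. v $ i *\<^sub>R axis i 1) = v"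
    using basis_expansion[of v] by (simp add: scalar_mult_eq_scaleR)
  ultimately show ?thesis by (simp add: space_grad_def inner_vec_def mult.commute)
qed

lemma space_jacobian_mult:
  assumes "smooth \<psi>"
  shows "space_jacobian \<psi> z *v v = frechet_derivative \<psi> (at z) (0, v)"
proof -
  interpret bounded_linear "frechet_derivative \<psi> (at z)"
    using smooth_imp_C1(1)[OF assms] by (rule has_derivative_bounded_linear)
  have "bounded_linear (\<lambda>v. frechet_derivative \<psi> (at z) (0, v))"
    by (rule bounded_linear_compose[OF bounded_linear_axioms])
       (auto intro: bounded_linear_Pair bounded_linear_zero bounded_linear_ident)
  then have "matrix (\<lambda>v. frechet_derivative \<psi> (at z) (0, v)) *v v = frechet_derivative \<psi> (at z) (0, v)"
    by (intro matrix_works) (simp add: linear_matrix_vector_mul_eq bounded_linear.linear)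
  then show ?thesis by (simp add: space_jacobian_def matrix_def)
qed

lemma continuous_partials:
  fixes \<psi> :: "real \<times> (real^3) \<Rightarrow> 'b::real_normed_vector" and \<theta> :: "real \<times> (real^3) \<Rightarrow> real"
    and \<omega> :: "real \<times> (real^3) \<Rightarrow> real^3"
  shows "smooth \<psi> \<Longrightarrow> continuous_on UNIV (time_deriv \<psi>)"
    and "smooth \<theta> \<Longrightarrow> continuous_on UNIV (space_grad \<theta>)"
    and "smooth \<omega> \<Longrightarrow> continuous_on UNIV (space_jacobian \<omega>)"
  unfolding time_deriv_def space_grad_def space_jacobian_def
  by (intro continuous_on_vec_lambda continuous_intros smooth_imp_C1; assumption)+

lemma partials_not_in_supp:
  assumes "z \<notin> supp \<psi>"
  shows "time_deriv \<psi> z = 0"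
  using not_in_supp[OF assms] by (simp add: time_deriv_def)

lemma space_partials_not_in_supp:
  "z \<notin> supp \<psi> \<Longrightarrow> space_grad \<psi> z = 0" "z \<notin> supp \<omega> \<Longrightarrow> space_jacobian \<omega> z = 0"
  by (simp_all add: not_in_supp space_grad_def space_jacobian_def vec_eq_iff)

section \<open>Integrability of weak solutions\<close>

lemma compact_support_ex_bound:
  fixes g :: "'a::euclidean_space \<Rightarrow> 'b::real_normed_vector"
  assumes "continuous_on UNIV g" "compact S" "\<And>x. x \<notin> S \<Longrightarrow> g x = 0"
  shows "\<exists>C. \<forall>x. norm (g x) \<le> C"
  using compact_support_bounded[OF assms] by metis

lemma abs_integral_lebesgue_on_subset_le:
  fixes g :: "'a::euclidean_space \<Rightarrow> real"
  assumes g: "integrable (lebesgue_on S) g" and A: "A \<subseteq> S" "A \<in> sets lebesgue" "S \<in> sets lebesgue"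
  shows "\<bar>LINT x|lebesgue_on A. g x\<bar> \<le> (LINT x|lebesgue_on S. \<bar>g x\<bar>)"
proof -
  have i: "integrable lebesgue (\<lambda>x. indicator S x *\<^sub>R \<bar>g x\<bar>)" "integrable lebesgue (\<lambda>x. indicator A x *\<^sub>R \<bar>g x\<bar>)"
    using integrable_abs[OF integrable_lebesgue_on_subset[OF g A]] integrable_abs[OF g] A
      integrable_restrict_space[of S lebesgue "\<lambda>x. \<bar>g x\<bar>"] integrable_restrict_space[of A lebesgue "\<lambda>x. \<bar>g x\<bar>"]
    by simp_all
  have "\<bar>LINT x|lebesgue_on A. g x\<bar> \<le> (LINT x|lebesgue_on A. \<bar>g x\<bar>)"
    by (rule integral_abs_bound)
  also have "\<dots> = (LINT x|lebesgue. indicator A x *\<^sub>R \<bar>g x\<bar>)"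
    using A by (simp add: integral_restrict_space)
  also have "\<dots> \<le> (LINT x|lebesgue. indicator S x *\<^sub>R \<bar>g x\<bar>)"
    by (rule integral_mono[OF i(2,1)]) (use A in \<open>auto simp: indicator_def\<close>)
  also have "\<dots> = (LINT x|lebesgue_on S. \<bar>g x\<bar>)"
    using A by (simp add: integral_restrict_space)
  finally show ?thesis .
qed

text \<open>The smooth extensions \<psi>U of U and \<psi>r of r - \<rho>b are parameters, so that
  calculus is done on the whole space-time. They are tied to U and r only for t in {0..T} and x in
  \<Omega> or its closure; elsewhere \<rho>b + \<psi>r may fail to be positive.\<close>

locale weak_solution = pressure_law p \<rho>b for p \<rho>b +
  fixes \<Omega> :: "(real^3) set" and T \<gamma> \<mu> \<eta> :: real
    and f :: "real \<Rightarrow> real^3 \<Rightarrow> real^3"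
    and \<rho>0 :: "real^3 \<Rightarrow> real" and u0 :: "real^3 \<Rightarrow> real^3"
    and \<rho> :: "real \<Rightarrow> real^3 \<Rightarrow> real" and u :: "real \<Rightarrow> real^3 \<Rightarrow> real^3"
    and Du :: "real \<Rightarrow> real^3 \<Rightarrow> real^3^3"
    and r :: "real \<Rightarrow> real^3 \<Rightarrow> real" and U :: "real \<Rightarrow> real^3 \<Rightarrow> real^3"
    and \<psi>U :: "real \<times> (real^3) \<Rightarrow> real^3" and \<psi>r :: "real \<times> (real^3) \<Rightarrow> real"
  assumes open_\<Omega>: "open \<Omega>" and T_pos: "T > 0" and \<gamma>_gt_1: "\<gamma> > 1"
    and force: "Linf_L1_Linf T \<Omega> f"
    and solution: "finite_energy_weak_solution \<mu> \<eta> p \<gamma> \<rho>b f T \<Omega> \<rho>0 u0 \<rho> u Du"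
    and \<psi>U: "smooth \<psi>U" "compact (supp \<psi>U)" "supp \<psi>U \<subseteq> UNIV \<times> \<Omega>"
    and U_eq: "\<And>t x. t \<in> {0..T} \<Longrightarrow> x \<in> \<Omega> \<Longrightarrow> U t x = \<psi>U (t, x)"
    and \<psi>r: "smooth \<psi>r" "compact (supp \<psi>r)"
    and r_eq: "\<And>t x. t \<in> {0..T} \<Longrightarrow> x \<in> closure \<Omega> \<Longrightarrow> r t x = \<rho>b + \<psi>r (t, x)"
    and r_pos: "\<And>t x. t \<in> {0..T} \<Longrightarrow> x \<in> closure \<Omega> \<Longrightarrow> r t x > 0"
begin

abbreviation "Q \<equiv> {0<..<T} \<times> \<Omega>"
abbreviation (input) "\<rho>Q z \<equiv> \<rho> (fst z) (snd z)"
abbreviation (input) "uQ z \<equiv> u (fst z) (snd z)"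
abbreviation (input) "DuQ z \<equiv> Du (fst z) (snd z)"
abbreviation (input) "fQ z \<equiv> f (fst z) (snd z)"
abbreviation "\<nu> \<equiv> lebesgue_on \<Omega>"
abbreviation (input) "JU \<equiv> space_jacobian \<psi>U"
abbreviation (input) "r\<psi> z \<equiv> \<rho>b + \<psi>r z"

lemma sets_borel: "{0<..<T} \<in> sets borel" "\<Omega> \<in> sets borel" "{0<..<T} \<in> sets lebesgue" "\<Omega> \<in> sets lebesgue"
  "Q \<in> sets lebesgue"
  using open_\<Omega> sets_lebesgue_Times[of "{0<..<T}" \<Omega>] by auto

lemma emeasure_time_interval: "emeasure lborel {0<..<T} < \<infinity>"
  using T_pos by simp

lemmas lebesgue_on_Q_Tonelli = lebesgue_on_Tonelli_bounded[OF sets_borel(1,2) emeasure_time_interval]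
lemmas lebesgue_on_Q_Fubini = lebesgue_on_Fubini[OF sets_borel(1,2)]

lemma \<Omega>_subset_closure: "x \<in> \<Omega> \<Longrightarrow> x \<in> closure \<Omega>"
  using closure_subset by blast

text \<open>Two spatial supports are kept apart: \<open>KU\<close> is a compact subset of \<Omega>,
  over which p(\<rho>) is integrable, whereas \<open>K\<close> also carries \<psi>r and may meet the
  boundary of \<Omega>.\<close>

definition KU :: "(real^3) set" where "KU = snd ` supp \<psi>U"
definition K :: "(real^3) set" where "K = KU \<union> snd ` supp \<psi>r"

lemma compact_KU: "compact KU"
  unfolding KU_def using \<psi>U by (intro compact_continuous_image continuous_intros)

lemma KU_subset: "KU \<subseteq> \<Omega>"
  using \<psi>U unfolding KU_def by auto

lemma compact_K: "compact K"
  unfolding K_def using \<psi>r compact_KU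
  by (intro compact_Un compact_continuous_image continuous_intros)

lemma not_in_K:
  assumes "x \<notin> K"
  shows "\<psi>r (t, x) = 0" "time_deriv \<psi>r (t, x) = 0" "space_grad \<psi>r (t, x) = 0"
    and "\<psi>U (t, x) = 0" "time_deriv \<psi>U (t, x) = 0" "JU (t, x) = 0"
proof -
  have "(t, x) \<notin> supp \<psi>r" "(t, x) \<notin> supp \<psi>U"
    using assms by (force simp: K_def KU_def)+
  then show "\<psi>r (t, x) = 0" "time_deriv \<psi>r (t, x) = 0" "space_grad \<psi>r (t, x) = 0"
    "\<psi>U (t, x) = 0" "time_deriv \<psi>U (t, x) = 0" "JU (t, x) = 0"
    by (auto simp: partials_not_in_supp space_partials_not_in_supp not_in_supp)
qed

lemma not_in_KU:
  assumes "x \<notin> KU"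
  shows "\<psi>U (t, x) = 0" "time_deriv \<psi>U (t, x) = 0" "JU (t, x) = 0"
proof -
  have "(t, x) \<notin> supp \<psi>U"
    using assms by (force simp: KU_def)+
  then show "\<psi>U (t, x) = 0" "time_deriv \<psi>U (t, x) = 0" "JU (t, x) = 0"
    by (auto simp: partials_not_in_supp space_partials_not_in_supp not_in_supp)
qed

lemma test_continuous:
  "continuous_on UNIV \<psi>r" "continuous_on UNIV (time_deriv \<psi>r)" "continuous_on UNIV (space_grad \<psi>r)"
  "continuous_on UNIV \<psi>U" "continuous_on UNIV (time_deriv \<psi>U)" "continuous_on UNIV (JU)"
  using \<psi>r \<psi>U by (simp_all add: continuous_partials smooth_imp_C1(3))

lemma test_bounds:
  obtains C where "C \<ge> 0"
    "\<And>t x. \<bar>\<psi>r (t, x)\<bar> \<le> C * indicator K x"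
    "\<And>t x. \<bar>time_deriv \<psi>r (t, x)\<bar> \<le> C * indicator K x"
    "\<And>t x. norm (space_grad \<psi>r (t, x)) \<le> C * indicator K x"
    "\<And>t x. norm (\<psi>U (t, x)) \<le> C * indicator KU x"
    "\<And>t x. norm (time_deriv \<psi>U (t, x)) \<le> C * indicator KU x"
    "\<And>t x. norm (JU (t, x)) \<le> C * indicator KU x"
proof -
  have "\<exists>C. \<forall>z. norm (\<psi>r z) \<le> C" "\<exists>C. \<forall>z. norm (time_deriv \<psi>r z) \<le> C"
    "\<exists>C. \<forall>z. norm (space_grad \<psi>r z) \<le> C" "\<exists>C. \<forall>z. norm (\<psi>U z) \<le> C"
    "\<exists>C. \<forall>z. norm (time_deriv \<psi>U z) \<le> C" "\<exists>C. \<forall>z. norm (JU z) \<le> C"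
    by (rule compact_support_ex_bound[OF test_continuous(1) \<psi>r(2)] compact_support_ex_bound[OF test_continuous(2) \<psi>r(2)]
        compact_support_ex_bound[OF test_continuous(3) \<psi>r(2)] compact_support_ex_bound[OF test_continuous(4) \<psi>U(2)]
        compact_support_ex_bound[OF test_continuous(5) \<psi>U(2)] compact_support_ex_bound[OF test_continuous(6) \<psi>U(2)];
        simp add: partials_not_in_supp space_partials_not_in_supp not_in_supp)+
  then obtain a b c d e h where *: "\<And>z. norm (\<psi>r z) \<le> a" "\<And>z. norm (time_deriv \<psi>r z) \<le> b"
    "\<And>z. norm (space_grad \<psi>r z) \<le> c" "\<And>z. norm (\<psi>U z) \<le> d"
    "\<And>z. norm (time_deriv \<psi>U z) \<le> e" "\<And>z. norm (JU z) \<le> h" by metis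
  define C where "C = \<bar>a\<bar> + \<bar>b\<bar> + \<bar>c\<bar> + \<bar>d\<bar> + \<bar>e\<bar> + \<bar>h\<bar>"
  have le: "s \<le> C" if "s \<le> a \<or> s \<le> b \<or> s \<le> c \<or> s \<le> d \<or> s \<le> e \<or> s \<le> h" for s
    using that unfolding C_def by linarith
  have "C \<ge> 0" by (simp add: C_def)
  moreover have "norm (\<psi>r (t, x)) \<le> C * indicator K x" "norm (time_deriv \<psi>r (t, x)) \<le> C * indicator K x"
    "norm (space_grad \<psi>r (t, x)) \<le> C * indicator K x" for t x
    using not_in_K[of x t] le * by (cases "x \<in> K"; simp)+
  moreover have "norm (\<psi>U (t, x)) \<le> C * indicator KU x"
    "norm (time_deriv \<psi>U (t, x)) \<le> C * indicator KU x"
    "norm (JU (t, x)) \<le> C * indicator KU x" for t x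
    using not_in_KU[of x t] le * by (cases "x \<in> KU"; simp)+
  ultimately show thesis using that by simp
qed

text \<open>Supplies the compact interval of positive numbers on which H' is approximated. For
  \<rho>b = 0, positivity of r forces the closure of \<Omega> into \<open>K\<close>, so the range
  still stays away from 0.\<close>

lemma r_range:
  obtains c d where "0 < c" "c \<le> d" "\<And>t x. t \<in> {0..T} \<Longrightarrow> x \<in> closure \<Omega> \<Longrightarrow> r\<psi> (t, x) \<in> {c..d}"
    "\<rho>b > 0 \<Longrightarrow> \<rho>b \<in> {c..d}" "\<rho>b = 0 \<Longrightarrow> \<rho>b < c"
proof -
  \<comment> \<open>Off \<open>K\<close> the extension is constantly \<rho>b, so the image of a
    compact set together with \<rho>b is the whole range. For \<rho>b = 0 the point 1 is added
    instead: it keeps \<open>S\<close> nonempty without admitting 0.\<close>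
  define S where "S = (\<lambda>z. r\<psi> z) ` ({0..T} \<times> (closure \<Omega> \<inter> K)) \<union> (if \<rho>b > 0 then {\<rho>b} else {1})"
  have "compact S"
    unfolding S_def using compact_K smooth_imp_C1(3)[OF \<psi>r(1)]
    by (intro compact_Un compact_continuous_image compact_Times closed_Int_compact)
       (auto intro!: continuous_intros elim: continuous_on_subset)
  moreover have "S \<noteq> {}" by (auto simp: S_def)
  ultimately obtain c d where c: "c \<in> S" "\<And>s. s \<in> S \<Longrightarrow> c \<le> s" and d: "\<And>s. s \<in> S \<Longrightarrow> s \<le> d"
    using compact_attains_inf[of S] compact_attains_sup[of S] by metis
  have pos: "r\<psi> (t, x) > 0" if "t \<in> {0..T}" "x \<in> closure \<Omega>" for t x
    using r_pos[OF that] r_eq[OF that] by simp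
  then have "s > 0" if "s \<in> S" for s
    using that \<rho>b_nonneg by (auto simp: S_def split: if_splits)
  then have "c > 0" using c by simp
  have "r\<psi> (t, x) \<in> S" if "t \<in> {0..T}" "x \<in> closure \<Omega>" for t x
  proof (cases "x \<in> K")
    case True
    then show ?thesis using that by (auto simp: S_def)
  next
    case False
    then have "\<rho>b > 0" using pos[OF that] not_in_K(1)[of x t] by simp
    then show ?thesis using not_in_K(1)[OF False, of t] by (simp add: S_def)
  qed
  then have "r\<psi> (t, x) \<in> {c..d}" if "t \<in> {0..T}" "x \<in> closure \<Omega>" for t x
    using c d that by force
  moreover have "\<rho>b \<in> {c..d}" if "\<rho>b > 0"
    using c(2)[of \<rho>b] d[of \<rho>b] that by (simp add: S_def)
  ultimately show thesis using that[of c d] \<open>c > 0\<close> c(1) d by auto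
qed

section \<open>Measurability and time slices of the solution\<close>

lemma weak_solution_conditions:
  shows \<rho>0_meas: "\<rho>0 \<in> borel_measurable \<nu>" and u0_meas: "u0 \<in> borel_measurable \<nu>"
    and \<rho>0_nonneg: "AE x in \<nu>. 0 \<le> \<rho>0 x"
    and energy0: "integrable \<nu> (energy_density p \<rho>b \<rho>0 u0)"
    and \<rho>_Linf: "Linf_L2_plus_Lq \<gamma> T \<Omega> (\<lambda>t x. \<rho> t x - \<rho>b)"
    and \<rho>_nonneg: "AE z in lebesgue_on Q. case z of (t, x) \<Rightarrow> 0 \<le> \<rho> t x"
    and u_L2: "L2_D012 T \<Omega> u Du"
    and m_Linf: "Linf_L2_plus_Lq (2 * \<gamma> / (\<gamma> + 1)) T \<Omega> (\<lambda>t x. \<rho> t x *\<^sub>R u t x)"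
    and p_L1_loc: "L1_loc T \<Omega> (\<lambda>t x. p (\<rho> t x))"
    and continuity: "\<exists>\<rho>w. (AE t in lebesgue_on {0<..<T}. AE x in \<nu>. \<rho>w t x = \<rho> t x) \<and>
           C_weak \<gamma> T \<Omega> (\<lambda>t x. \<rho>w t x - \<rho>b) \<and>
           weak_continuity_equation T \<Omega> \<rho>0 \<rho>w \<rho> u"
    and momentum: "\<exists>m. (AE t in lebesgue_on {0<..<T}. AE x in \<nu>. m t x = \<rho> t x *\<^sub>R u t x) \<and>
          C_weak (2 * \<gamma> / (\<gamma> + 1)) T \<Omega> m \<and>
          weak_momentum_equation \<mu> \<eta> p f T \<Omega> \<rho>0 u0 m \<rho> u Du"
    and energy: "energy_inequality \<mu> \<eta> p \<rho>b f T \<Omega> \<rho>0 u0 \<rho> u Du"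
  using solution unfolding finite_energy_weak_solution_def by blast+

lemma meas_Q [measurable]:
  "(\<lambda>z. \<rho>Q z) \<in> borel_measurable (lebesgue_on Q)"
  "(\<lambda>z. uQ z) \<in> borel_measurable (lebesgue_on Q)"
  "(\<lambda>z. DuQ z) \<in> borel_measurable (lebesgue_on Q)"
  "(\<lambda>z. fQ z) \<in> borel_measurable (lebesgue_on Q)"
proof -
  have "(\<lambda>z. (\<rho>Q z - \<rho>b) + \<rho>b) \<in> borel_measurable (lebesgue_on Q)"
    using \<rho>_Linf by (intro borel_measurable_add)
      (auto simp: Linf_L2_plus_Lq_def space_time_measurable_def split_beta')
  then show "(\<lambda>z. \<rho>Q z) \<in> borel_measurable (lebesgue_on Q)" by simp
qed (use u_L2 force in \<open>auto simp: L2_D012_def Linf_L1_Linf_def space_time_measurable_def split_beta'\<close>)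

lemma continuous_meas_Q:
  "continuous_on UNIV g \<Longrightarrow> g \<in> borel_measurable (lebesgue_on Q)"
  by (rule continuous_imp_measurable_on_sets_lebesgue) (use sets_borel in \<open>auto elim: continuous_on_subset\<close>)

lemma test_meas_Q [measurable]:
  "\<psi>r \<in> borel_measurable (lebesgue_on Q)" "time_deriv \<psi>r \<in> borel_measurable (lebesgue_on Q)"
  "space_grad \<psi>r \<in> borel_measurable (lebesgue_on Q)"
  "\<psi>U \<in> borel_measurable (lebesgue_on Q)" "time_deriv \<psi>U \<in> borel_measurable (lebesgue_on Q)"
  "JU \<in> borel_measurable (lebesgue_on Q)"
  by (rule continuous_meas_Q, rule test_continuous)+

lemma indicator_meas_Q:
  assumes "closed S"
  shows "(\<lambda>z. indicator S (snd z) :: real) \<in> borel_measurable (lebesgue_on Q)"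
proof -
  have [measurable]: "S \<in> sets borel" using assms by simp
  have "(\<lambda>z::real \<times> (real^3). indicator S (snd z) :: real) \<in> borel_measurable (borel \<Otimes>\<^sub>M borel)"
    by measurable
  then have "(\<lambda>z::real \<times> (real^3). indicator S (snd z) :: real) \<in> borel_measurable lborel"
    by (simp add: borel_prod)
  then show ?thesis
    by (intro measurable_restrict_space1 measurable_completion)
qed

lemma K_meas_Q [measurable]:
  "(\<lambda>z. indicator K (snd z) :: real) \<in> borel_measurable (lebesgue_on Q)"
  "(\<lambda>z. indicator KU (snd z) :: real) \<in> borel_measurable (lebesgue_on Q)"
  using compact_K compact_KU by (auto intro!: indicator_meas_Q compact_imp_closed)

lemma indicator_K_\<Omega>:
  "integrable \<nu> (indicator K :: _ \<Rightarrow> real)"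
proof -
  have "K \<inter> \<Omega> \<in> lmeasurable"
    using compact_K sets_borel by (intro fmeasurable_Int_fmeasurable lmeasurable_compact) auto
  then show ?thesis
    using compact_K sets_borel
    by (auto simp: integrable_indicator_iff emeasure_restrict_space space_restrict_space fmeasurable_def
      sets_restrict_space_iff)
qed

lemma indicator_K_\<Omega>_ae_bounded:
  "AE x in \<nu>. 0 \<le> indicat_real K x \<and> indicat_real K x \<le> max 1 (LINT x|\<nu>. indicat_real K x)"
  by (intro AE_I2) (auto simp: indicator_def)

lemma sections:
  "AE t in lebesgue_on {0<..<T}. \<rho> t \<in> borel_measurable \<nu> \<and>
     u t \<in> borel_measurable \<nu> \<and> (AE x in \<nu>. 0 \<le> \<rho> t x)"
proof -
  have "AE t in lebesgue_on {0<..<T}. AE x in \<nu>. 0 \<le> \<rho> t x"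
    using AE_lebesgue_on_sections[OF sets_borel(1,2) \<rho>_nonneg] by simp
  moreover have "AE t in lebesgue_on {0<..<T}. u t \<in> borel_measurable \<nu>"
    using u_L2 unfolding L2_D012_def
    by (elim conjE) (erule eventually_mono, simp add: D012_def in_Lp_def)
  moreover have "AE t in lebesgue_on {0<..<T}. \<rho> t \<in> borel_measurable \<nu>"
  proof -
    have "AE t in lebesgue_on {0<..<T}. (\<lambda>x. \<rho> t x - \<rho>b) \<in> borel_measurable \<nu>"
      using \<rho>_Linf unfolding Linf_L2_plus_Lq_def
      by (elim conjE exE) (erule eventually_mono, simp add: L2_plus_Lq_def)
    then show ?thesis
    proof eventually_elim
      case (elim t)
      then have "(\<lambda>x. (\<rho> t x - \<rho>b) + \<rho>b) \<in> borel_measurable \<nu>"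
        by (rule borel_measurable_add) simp
      then show ?case by simp
    qed
  qed
  ultimately show ?thesis by eventually_elim simp
qed

section \<open>Space-time integrability from the sum-space bounds\<close>

lemma integrable_weighted_norm:
  fixes v :: "real \<Rightarrow> real^3 \<Rightarrow> 'b::euclidean_space"
  assumes v: "Linf_L2_plus_Lq q T \<Omega> v" and q: "1 \<le> q"
    and wm: "(\<lambda>z. w (fst z) (snd z)) \<in> borel_measurable (lebesgue_on Q)" and c: "0 \<le> c"
    and w: "AE t in lebesgue_on {0<..<T}. integrable \<nu> (w t) \<and>
      (LINT x|\<nu>. w t x) \<le> c \<and> (AE x in \<nu>. 0 \<le> w t x \<and> w t x \<le> c)"
  shows "integrable (lebesgue_on Q) (\<lambda>z. w (fst z) (snd z) * norm (v (fst z) (snd z)))"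
proof -
  obtain C where vm: "(\<lambda>z. v (fst z) (snd z)) \<in> borel_measurable (lebesgue_on Q)"
    and C: "AE t in lebesgue_on {0<..<T}. v t \<in> L2_plus_Lq q \<Omega> \<and> sum_norm q \<Omega> (v t) \<le> C"
    using v by (auto simp: Linf_L2_plus_Lq_def space_time_measurable_def split_beta')
  show ?thesis
  proof (rule lebesgue_on_Q_Tonelli)
    show "(\<lambda>z. w (fst z) (snd z) * norm (v (fst z) (snd z))) \<in> borel_measurable (lebesgue_on Q)"
      using wm vm by measurable
    show "AE t in lebesgue_on {0<..<T}. integrable \<nu> (\<lambda>x. w (fst (t, x)) (snd (t, x)) * norm (v (fst (t, x)) (snd (t, x))))
        \<and> (LINT x|\<nu>. \<bar>w (fst (t, x)) (snd (t, x)) * norm (v (fst (t, x)) (snd (t, x)))\<bar>)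
          \<le> 2 * c + c * (C + 1) powr 2 + c * (C + 1) powr q"
      using C w
    proof eventually_elim
      case (elim t)
      note b = L2_plus_Lq_weighted_integral[OF q, of "v t" \<Omega> C "w t" c]
      have "(LINT x|\<nu>. \<bar>w t x * norm (v t x)\<bar>) = (LINT x|\<nu>. w t x * norm (v t x))"
      proof (rule integral_cong_AE)
        show "AE x in \<nu>. \<bar>w t x * norm (v t x)\<bar> = w t x * norm (v t x)"
          using elim by (auto elim!: eventually_mono)
      qed (use b(1) elim c in auto)
      then show ?case using b elim c by simp
    qed
  qed
qed

lemma force_sections:
  obtains C where "C \<ge> 0"
    "AE t in lebesgue_on {0<..<T}. integrable \<nu> (\<lambda>x. norm (f t x)) \<and>
      (LINT x|\<nu>. norm (f t x)) \<le> C \<and>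
      (AE x in \<nu>. 0 \<le> norm (f t x) \<and> norm (f t x) \<le> C)"
proof -
  obtain C where C: "AE t in lebesgue_on {0<..<T}. integrable \<nu> (f t) \<and>
        (LINT x|\<nu>. norm (f t x)) \<le> C \<and> (AE x in \<nu>. norm (f t x) \<le> C)"
    using force by (auto simp: Linf_L1_Linf_def)
  show thesis
  proof (rule that[of "\<bar>C\<bar>"])
    show "AE t in lebesgue_on {0<..<T}. integrable \<nu> (\<lambda>x. norm (f t x)) \<and>
      (LINT x|\<nu>. norm (f t x)) \<le> \<bar>C\<bar> \<and>
      (AE x in \<nu>. 0 \<le> norm (f t x) \<and> norm (f t x) \<le> \<bar>C\<bar>)"
      using C by eventually_elim (auto elim: eventually_mono)
  qed simp
qed

lemma exponent: "1 \<le> 2 * \<gamma> / (\<gamma> + 1)"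
  using \<gamma>_gt_1 by (simp add: field_simps)

text \<open>The indicator of \<open>K\<close> is a time-independent weight in L1 and Linf, which
  makes localisation to \<open>K\<close> an instance of \<open>integrable_weighted_norm\<close>. One
  constant has to bound the integral and the values, hence the maximum with 1.\<close>

lemma K_sections:
  obtains c where "c \<ge> 0" "AE t in lebesgue_on {0<..<T}. integrable \<nu> (indicat_real K) \<and>
      (LINT x|\<nu>. indicat_real K x) \<le> c \<and>
      (AE x in \<nu>. 0 \<le> indicat_real K x \<and> indicat_real K x \<le> c)"
proof (rule that)
  show "AE t in lebesgue_on {0<..<T}. integrable \<nu> (indicat_real K) \<and>
      (LINT x|\<nu>. indicat_real K x) \<le> max 1 (LINT x|\<nu>. indicat_real K x) \<and>
      (AE x in \<nu>. 0 \<le> indicat_real K x \<and>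
        indicat_real K x \<le> max 1 (LINT x|\<nu>. indicat_real K x))"
    by (intro AE_I2 conjI indicator_K_\<Omega> indicator_K_\<Omega>_ae_bounded) simp
qed (simp only: max.coboundedI1 zero_le_one)

lemma integrable_K: "integrable (lebesgue_on Q) (\<lambda>z. indicator K (snd z) :: real)"
proof (rule K_sections)
  fix c assume "AE t in lebesgue_on {0<..<T}. integrable \<nu> (indicat_real K) \<and>
      (LINT x|\<nu>. indicat_real K x) \<le> c \<and>
      (AE x in \<nu>. 0 \<le> indicat_real K x \<and> indicat_real K x \<le> c)"
  then show ?thesis
    by (intro lebesgue_on_Q_Tonelli[where C = c] K_meas_Q) (erule eventually_mono, simp)
qed

text \<open>Only \<rho> - \<rho>b lies in the sum space; the constant \<rho>b is added back
  afterwards, being integrable over the finite-measure part of \<open>Q\<close> above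
  \<open>K\<close>.\<close>

lemma integrable_density: "integrable (lebesgue_on Q) (\<lambda>z. indicator K (snd z) * \<rho>Q z)"
proof -
  obtain c where c: "c \<ge> 0" "AE t in lebesgue_on {0<..<T}. integrable \<nu> (indicat_real K) \<and>
      (LINT x|\<nu>. indicat_real K x) \<le> c \<and>
      (AE x in \<nu>. 0 \<le> indicat_real K x \<and> indicat_real K x \<le> c)"
    by (rule K_sections)
  have 1: "integrable (lebesgue_on Q) (\<lambda>z. indicator K (snd z) * norm (\<rho>Q z - \<rho>b))"
    using integrable_weighted_norm[OF \<rho>_Linf, of "\<lambda>_. indicator K" c] c \<gamma>_gt_1 by simp
  show ?thesis
  proof (rule integrable_dominated[where C = 1])
    show "integrable (lebesgue_on Q) (\<lambda>z. indicator K (snd z) * norm (\<rho>Q z - \<rho>b) + \<rho>b * indicator K (snd z))"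
      using 1 integrable_K by simp
    show "AE z in lebesgue_on Q. \<bar>indicator K (snd z) * \<rho>Q z\<bar>
        \<le> 1 * (indicator K (snd z) * norm (\<rho>Q z - \<rho>b) + \<rho>b * indicator K (snd z))"
      using \<rho>b_nonneg by (auto simp: indicator_def)
  qed measurable
qed

lemma integrable_momentum:
  "integrable (lebesgue_on Q) (\<lambda>z. indicator K (snd z) * norm (\<rho>Q z *\<^sub>R uQ z))"
proof -
  obtain c where c: "c \<ge> 0" "AE t in lebesgue_on {0<..<T}. integrable \<nu> (indicat_real K) \<and>
      (LINT x|\<nu>. indicat_real K x) \<le> c \<and>
      (AE x in \<nu>. 0 \<le> indicat_real K x \<and> indicat_real K x \<le> c)"
    by (rule K_sections)
  show ?thesis
    using integrable_weighted_norm[OF m_Linf exponent, of "\<lambda>_. indicator K" c] c by simp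
qed

lemma integrable_force_momentum:
  "integrable (lebesgue_on Q) (\<lambda>z. norm (fQ z) * norm (\<rho>Q z *\<^sub>R uQ z))"
  by (rule force_sections) (rule integrable_weighted_norm[OF m_Linf exponent]; measurable)

text \<open>Here the constant \<rho>b is absorbed by the uniform L1 bound on f, so no localisation
  in space is made.\<close>

lemma integrable_force_density:
  "integrable (lebesgue_on Q) (\<lambda>z. norm (fQ z) * \<rho>Q z)"
proof (rule force_sections)
  fix C assume C: "C \<ge> 0"
    "AE t in lebesgue_on {0<..<T}. integrable \<nu> (\<lambda>x. norm (f t x)) \<and>
      (LINT x|\<nu>. norm (f t x)) \<le> C \<and>
      (AE x in \<nu>. 0 \<le> norm (f t x) \<and> norm (f t x) \<le> C)"
  have 1: "integrable (lebesgue_on Q) (\<lambda>z. norm (fQ z) * norm (\<rho>Q z - \<rho>b))"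
    using \<gamma>_gt_1 by (intro integrable_weighted_norm[OF \<rho>_Linf _ _ C]) auto
  have 2: "integrable (lebesgue_on Q) (\<lambda>z. norm (fQ z))"
  proof (rule lebesgue_on_Q_Tonelli[where C = C])
    show "AE t in lebesgue_on {0<..<T}. integrable \<nu> (\<lambda>x. norm (f (fst (t, x)) (snd (t, x)))) \<and>
        (LINT x|\<nu>. \<bar>norm (f (fst (t, x)) (snd (t, x)))\<bar>) \<le> C"
      using C(2) by eventually_elim simp
  qed measurable
  show ?thesis
  proof (rule integrable_dominated[where C = 1])
    show "integrable (lebesgue_on Q) (\<lambda>z. norm (fQ z) * norm (\<rho>Q z - \<rho>b) + \<rho>b * norm (fQ z))"
      using 1 2 by simp
    have "\<bar>n * s\<bar> \<le> n * norm (s - \<rho>b) + \<rho>b * n" if "n \<ge> 0" for n s :: real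
    proof -
      have "n * \<bar>s\<bar> \<le> n * (\<bar>s - \<rho>b\<bar> + \<rho>b)" using that \<rho>b_nonneg by (intro mult_left_mono) auto
      then show ?thesis using that by (simp add: abs_mult algebra_simps)
    qed
    then show "AE z in lebesgue_on Q. \<bar>norm (fQ z) * \<rho>Q z\<bar>
        \<le> 1 * (norm (fQ z) * norm (\<rho>Q z - \<rho>b) + \<rho>b * norm (fQ z))"
      by simp
  qed measurable
qed

lemma integrable_gradient: "integrable (lebesgue_on Q) (\<lambda>z. (norm (DuQ z))\<^sup>2)"
  using u_L2 by (simp add: L2_D012_def split_beta')

text \<open>Local integrability refers to compact subsets of {0..T} \<times> \<Omega>, with the end
  points in time included. So {0..T} \<times> KU qualifies, while \<open>K\<close> need not lie in
  \<Omega>.\<close>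

lemma integrable_pressure:
  "integrable (lebesgue_on Q) (\<lambda>z. indicator KU (snd z) * p (\<rho>Q z))"
proof -
  let ?S = "{0..T} \<times> KU"
  have "compact ?S" "?S \<subseteq> {0..T} \<times> \<Omega>" using compact_KU KU_subset by (auto intro: compact_Times)
  then have "set_integrable lebesgue ?S (\<lambda>z. p (\<rho>Q z))"
    using p_L1_loc by (simp add: L1_loc_def split_beta')
  then have "integrable (lebesgue_on Q) (\<lambda>z. indicator ?S z *\<^sub>R p (\<rho>Q z))"
    unfolding set_integrable_def
    using integrable_lebesgue_on_subset[of UNIV _ Q] sets_borel by (simp add: lebesgue_on_UNIV_eq)
  then show ?thesis
    by (rule Bochner_Integration.integrable_cong[THEN iffD1, rotated -1])
       (auto simp: indicator_def)
qed

lemma stress_bound: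
  obtains C where "C \<ge> 0" "\<And>A. norm (stress \<mu> \<eta> A) \<le> C * norm A"
proof -
  have "bounded_linear (stress \<mu> \<eta>)"
    using linear_stress by (simp add: linear_conv_bounded_linear)
  then obtain C where "C > 0" "\<And>A. norm (stress \<mu> \<eta> A) \<le> norm A * C"
    using bounded_linear.pos_bounded by blast
  then show thesis using that[of C] by (simp add: mult.commute)
qed

lemma stress_meas [measurable]: "stress \<mu> \<eta> \<in> borel_measurable borel"
  by (intro borel_measurable_continuous_onI linear_continuous_on)
     (use linear_stress in \<open>simp add: linear_conv_bounded_linear\<close>)

lemma trace_meas [measurable]: "(trace :: real^3^3 \<Rightarrow> real) \<in> borel_measurable borel"
  by (intro borel_measurable_continuous_onI linear_continuous_on)
     (use linear_trace in \<open>simp add: linear_conv_bounded_linear\<close>)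

section \<open>Uniform energy bound\<close>

lemma energy_density_eq:
  "energy_density p \<rho>b \<sigma> v x = 1/2 * \<sigma> x * (norm (v x))\<^sup>2 + potential (\<sigma> x)"
  by (simp add: energy_density_def potential_def)

lemma integrable_dissipation:
  "integrable (lebesgue_on Q) (\<lambda>z. stress \<mu> \<eta> (DuQ z) \<bullet> DuQ z)"
proof -
  obtain C where C: "\<And>A. norm (stress \<mu> \<eta> A) \<le> C * norm A" using stress_bound by metis
  show ?thesis
  proof (rule integrable_dominated[OF integrable_gradient])
    have "\<bar>stress \<mu> \<eta> A \<bullet> A\<bar> \<le> C * (norm A)\<^sup>2" for A
      using order_trans[OF Cauchy_Schwarz_ineq2 mult_right_mono[OF C[of A]], of A]
      by (simp add: power2_eq_square mult.assoc)
    then show "AE z in lebesgue_on Q. \<bar>stress \<mu> \<eta> (DuQ z) \<bullet> DuQ z\<bar>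
        \<le> C * (norm (DuQ z))\<^sup>2" by simp
  qed measurable
qed

lemma integrable_power_of_force:
  "integrable (lebesgue_on Q) (\<lambda>z. (\<rho>Q z *\<^sub>R fQ z) \<bullet> uQ z)"
proof (rule integrable_dominated[OF integrable_force_momentum, where C = 1])
  have "\<bar>(s *\<^sub>R a) \<bullet> b\<bar> \<le> norm a * norm (s *\<^sub>R b)" for s and a b :: "real^3"
    using Cauchy_Schwarz_ineq2[of a "s *\<^sub>R b"] by simp
  then show "AE z in lebesgue_on Q. \<bar>(\<rho>Q z *\<^sub>R fQ z) \<bullet> uQ z\<bar>
      \<le> 1 * (norm (fQ z) * norm (\<rho>Q z *\<^sub>R uQ z))"
    by simp
qed measurable

abbreviation Q\<tau> :: "real \<Rightarrow> (real \<times> (real^3)) set" where "Q\<tau> \<tau> \<equiv> {0<..<\<tau>} \<times> \<Omega>"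

lemma Q\<tau>_subset: "\<tau> \<le> T \<Longrightarrow> Q\<tau> \<tau> \<subseteq> Q" "Q\<tau> \<tau> \<in> sets lebesgue"
  using sets_lebesgue_Times[of "{0<..<\<tau>}" \<Omega>] sets_borel by auto

lemma energy_AE:
  "AE \<tau> in lebesgue_on {0<..<T}.
    integrable \<nu> (energy_density p \<rho>b (\<rho> \<tau>) (u \<tau>)) \<and>
    (LINT x|\<nu>. energy_density p \<rho>b (\<rho> \<tau>) (u \<tau>) x)
      + (LINT z|lebesgue_on (Q\<tau> \<tau>). stress \<mu> \<eta> (DuQ z) \<bullet> DuQ z)
    \<le> (LINT x|\<nu>. energy_density p \<rho>b \<rho>0 u0 x)
      + (LINT z|lebesgue_on (Q\<tau> \<tau>). (\<rho>Q z *\<^sub>R fQ z) \<bullet> uQ z)"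
  using AE_lebesgue_on_subset[OF energy[unfolded energy_inequality_def], of "{0<..<T}"]
  by (simp add: split_beta' greaterThanLessThan_subseteq_atLeastAtMost_iff)

lemma kinetic_energy_bounded:
  obtains E where
    "AE \<tau> in lebesgue_on {0<..<T}. integrable \<nu> (\<lambda>x. \<rho> \<tau> x * (norm (u \<tau> x))\<^sup>2) \<and>
      (LINT x|\<nu>. \<bar>\<rho> \<tau> x * (norm (u \<tau> x))\<^sup>2\<bar>) \<le> E"
proof -
  let ?S = "\<lambda>z. stress \<mu> \<eta> (DuQ z) \<bullet> DuQ z"
  let ?F = "\<lambda>z. (\<rho>Q z *\<^sub>R fQ z) \<bullet> uQ z"
  \<comment> \<open>Over every Q\<tau> the dissipation and the power of the force are bounded by the
    integrals of their absolute values over \<open>Q\<close>, so that \<open>E\<close> does not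
    depend on \<tau>.\<close>
  define E where "E = (LINT x|\<nu>. energy_density p \<rho>b \<rho>0 u0 x)
    + (LINT z|lebesgue_on Q. \<bar>?S z\<bar>) + (LINT z|lebesgue_on Q. \<bar>?F z\<bar>)"
  have "AE \<tau> in lebesgue_on {0<..<T}. \<tau> \<in> {0<..<T}"
    by (rule AE_I2) simp
  then have "AE \<tau> in lebesgue_on {0<..<T}. integrable \<nu> (\<lambda>x. \<rho> \<tau> x * (norm (u \<tau> x))\<^sup>2) \<and>
      (LINT x|\<nu>. \<bar>\<rho> \<tau> x * (norm (u \<tau> x))\<^sup>2\<bar>) \<le> 2 * E"
    using energy_AE sections
  proof eventually_elim
    case (elim \<tau>)
    then have \<tau>: "\<tau> \<le> T" by simp
    let ?e = "energy_density p \<rho>b (\<rho> \<tau>) (u \<tau>)"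
    have ie: "integrable \<nu> ?e" using elim by simp
    have "(LINT x|\<nu>. ?e x) \<le> E"
      using elim abs_integral_lebesgue_on_subset_le[OF integrable_dissipation Q\<tau>_subset(1)[OF \<tau>] Q\<tau>_subset(2)]
        abs_integral_lebesgue_on_subset_le[OF integrable_power_of_force Q\<tau>_subset(1)[OF \<tau>] Q\<tau>_subset(2)] sets_borel
      unfolding E_def by linarith
    \<comment> \<open>Twice the energy density is \<rho> |u|^2 plus twice \<open>potential\<close>,
      and the latter is nonnegative where \<rho> \<ge> 0.\<close>
    have bd: "AE x in \<nu>. \<bar>\<rho> \<tau> x * (norm (u \<tau> x))\<^sup>2\<bar> \<le> 2 * ?e x"
    proof -
      have "AE x in \<nu>. 0 \<le> \<rho> \<tau> x" using elim by simp
      then show ?thesis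
      proof eventually_elim
        case (elim x)
        then show ?case using potential_nonneg[of "\<rho> \<tau> x"] by (simp add: energy_density_eq)
      qed
    qed
    have i: "integrable \<nu> (\<lambda>x. \<rho> \<tau> x * (norm (u \<tau> x))\<^sup>2)"
    proof (rule integrable_dominated[OF ie _ bd])
      have [measurable]: "\<rho> \<tau> \<in> borel_measurable \<nu>" "u \<tau> \<in> borel_measurable \<nu>"
        using elim by auto
      show "(\<lambda>x. \<rho> \<tau> x * (norm (u \<tau> x))\<^sup>2) \<in> borel_measurable \<nu>"
        by measurable
    qed
    moreover have "(LINT x|\<nu>. \<bar>\<rho> \<tau> x * (norm (u \<tau> x))\<^sup>2\<bar>) \<le> (LINT x|\<nu>. 2 * ?e x)"
      by (rule integral_mono_AE) (use i ie bd in auto)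
    ultimately show ?case using \<open>(LINT x|\<nu>. ?e x) \<le> E\<close> by simp
  qed
  then show thesis by (rule that)
qed

lemma integrable_kinetic_energy:
  "integrable (lebesgue_on Q) (\<lambda>z. \<rho>Q z * (norm (uQ z))\<^sup>2)"
proof (rule kinetic_energy_bounded)
  have m: "(\<lambda>z. \<rho>Q z * (norm (uQ z))\<^sup>2) \<in> borel_measurable (lebesgue_on Q)"
    by measurable
  fix E assume "AE \<tau> in lebesgue_on {0<..<T}. integrable \<nu> (\<lambda>x. \<rho> \<tau> x * (norm (u \<tau> x))\<^sup>2) \<and>
      (LINT x|\<nu>. \<bar>\<rho> \<tau> x * (norm (u \<tau> x))\<^sup>2\<bar>) \<le> E"
  then show ?thesis
    using lebesgue_on_Q_Tonelli[OF m, of E] by (simp only: fst_conv snd_conv)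
qed

text \<open>The initial data are known through their energy alone. On \<open>K\<close> the bound c s
  \<le> potential(s) + C controls the density, and |u0| \<le> |u0|^2 / 2 + 1 then controls the
  momentum by kinetic energy plus density.\<close>

lemma integrable_initial_density:
  "integrable \<nu> (\<lambda>x. indicator K x * \<rho>0 x)"
  "integrable \<nu> (\<lambda>x. indicator K x * norm (\<rho>0 x *\<^sub>R u0 x))"
proof -
  note [measurable] = \<rho>0_meas u0_meas
  have Km [measurable]: "indicat_real K \<in> borel_measurable \<nu>"
    using indicator_K_\<Omega> by auto
  obtain c C where c: "c > 0" "C \<ge> 0" "\<And>s. 0 \<le> s \<Longrightarrow> c * s \<le> potential s + C"
    by (rule potential_lower_bound) (rule that; blast)
  let ?g = "\<lambda>x. energy_density p \<rho>b \<rho>0 u0 x + C * indicator K x"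
  have g: "integrable \<nu> ?g"
    using energy0 indicator_K_\<Omega> by simp
  have pt: "\<bar>indicator K x * \<rho>0 x\<bar> \<le> (1 / c) * ?g x \<and>
      \<bar>indicator K x * norm (\<rho>0 x *\<^sub>R u0 x)\<bar> \<le> (1 / c + 1) * ?g x" if "0 \<le> \<rho>0 x" for x
  proof -
    let ?e = "1/2 * \<rho>0 x * (norm (u0 x))\<^sup>2"
    have e: "0 \<le> ?e" using that by simp
    have g0: "?e \<le> ?g x" "0 \<le> ?g x"
      using e potential_nonneg[OF that] c(2) by (auto simp: energy_density_eq indicator_def)
    have 1: "c * (indicator K x * \<rho>0 x) \<le> ?g x"
      using c(3)[OF that] e g0 by (cases "x \<in> K") (auto simp: energy_density_eq)
    then have 2: "indicator K x * \<rho>0 x \<le> (1 / c) * ?g x"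
      using c(1) by (simp add: field_simps)
    moreover have "norm (u0 x) \<le> 1/2 * (norm (u0 x))\<^sup>2 + 1"
      using sum_squares_bound[of "norm (u0 x)" 1] by simp
    then have "\<rho>0 x * norm (u0 x) \<le> \<rho>0 x * (1/2 * (norm (u0 x))\<^sup>2 + 1)"
      using that by (intro mult_left_mono)
    then have "indicator K x * norm (\<rho>0 x *\<^sub>R u0 x) \<le> ?e + indicator K x * \<rho>0 x"
      using that e by (cases "x \<in> K") (auto simp: algebra_simps)
    then have "indicator K x * norm (\<rho>0 x *\<^sub>R u0 x) \<le> (1 / c + 1) * ?g x"
      using 2 g0 by (simp add: distrib_right)
    ultimately show ?thesis using that by (simp add: abs_mult)
  qed
  have a: "AE x in \<nu>. \<bar>indicator K x * \<rho>0 x\<bar> \<le> (1 / c) * ?g x"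
    using \<rho>0_nonneg by eventually_elim (use pt in blast)
  have b: "AE x in \<nu>. \<bar>indicator K x * norm (\<rho>0 x *\<^sub>R u0 x)\<bar> \<le> (1 / c + 1) * ?g x"
    using \<rho>0_nonneg by eventually_elim (use pt in blast)
  show "integrable \<nu> (\<lambda>x. indicator K x * \<rho>0 x)"
    by (rule integrable_dominated[OF g _ a]) measurable
  show "integrable \<nu> (\<lambda>x. indicator K x * norm (\<rho>0 x *\<^sub>R u0 x))"
    by (rule integrable_dominated[OF g _ b]) measurable
qed

section \<open>The weak formulations at almost every time\<close>

lemma slice_integrable:
  "AE t in lebesgue_on {0<..<T}. integrable \<nu> (\<lambda>x. indicator K x * \<rho> t x) \<and>
     integrable \<nu> (\<lambda>x. indicator K x * norm (\<rho> t x *\<^sub>R u t x))"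
  using lebesgue_on_Q_Fubini(1)[OF integrable_density] lebesgue_on_Q_Fubini(1)[OF integrable_momentum]
  by eventually_elim simp

lemma space_meas:
  "continuous_on UNIV g \<Longrightarrow> (\<lambda>x. g (t, x)) \<in> borel_measurable \<nu>"
  by (rule continuous_imp_measurable_on_sets_lebesgue)
     (use sets_borel in \<open>auto intro!: continuous_on_compose2[of UNIV g] continuous_intros\<close>)

text \<open>The null set comes only from the times at which \<open>\<rho>w\<close> differs from
  \<rho> or the slices are not measurable, so one null set serves all test functions. This order of
  quantifiers is what the polynomial approximation relies on.\<close>

lemma weak_continuity_AE:
  "AE \<tau> in lebesgue_on {0<..<T}. \<forall>\<phi>. smooth \<phi> \<and> compact (supp \<phi>) \<longrightarrow>
    (LINT x|\<nu>. \<rho> \<tau> x * \<phi> (\<tau>, x)) - (LINT x|\<nu>. \<rho>0 x * \<phi> (0, x))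
    = (LINT z|lebesgue_on (Q\<tau> \<tau>). \<rho>Q z * time_deriv \<phi> z
         + (\<rho>Q z *\<^sub>R uQ z) \<bullet> space_grad \<phi> z)"
proof -
  obtain \<rho>w where ae: "AE t in lebesgue_on {0<..<T}. AE x in \<nu>. \<rho>w t x = \<rho> t x"
    and Cw: "C_weak \<gamma> T \<Omega> (\<lambda>t x. \<rho>w t x - \<rho>b)" and eq: "weak_continuity_equation T \<Omega> \<rho>0 \<rho>w \<rho> u"
    using continuity by blast
  have "AE \<tau> in lebesgue_on {0<..<T}. \<tau> \<in> {0<..<T}"
    by (rule AE_I2) simp
  then show ?thesis using ae sections
  proof eventually_elim
    case (elim \<tau>)
    have "(\<lambda>x. (\<rho>w \<tau> x - \<rho>b) + \<rho>b) \<in> borel_measurable \<nu>"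
      using Cw elim by (intro borel_measurable_add) (auto simp: C_weak_def L2_plus_Lq_def)
    then have \<rho>w_meas: "\<rho>w \<tau> \<in> borel_measurable \<nu>" by simp
    show ?case
    proof (intro allI impI, elim conjE)
      fix \<phi> :: "real \<times> (real^3) \<Rightarrow> real" assume \<phi>: "smooth \<phi>" "compact (supp \<phi>)"
      let ?\<phi> = "\<lambda>t x. \<phi> (t, x)"
      have "Cc_closure T \<Omega> ?\<phi>" using \<phi> by (auto simp: Cc_closure_def)
      then have "(LINT x|\<nu>. \<rho>w \<tau> x * \<phi> (\<tau>, x)) - (LINT x|\<nu>. \<rho>0 x * \<phi> (0, x))
        = (LINT (t, x)|lebesgue_on (Q\<tau> \<tau>). \<rho> t x * dt ?\<phi> t x + (\<rho> t x *\<^sub>R u t x) \<bullet> grad (?\<phi> t) x)"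
        using eq elim unfolding weak_continuity_equation_def by auto
      moreover have "dt ?\<phi> t x = time_deriv \<phi> (t, x)" for t x
        unfolding dt_def by (rule vector_derivative_at[OF has_derivative_partial(1)[OF \<phi>(1)]])
      moreover have "grad (?\<phi> t) x = space_grad \<phi> (t, x)" for t x
        using frechet_derivative_at[OF has_derivative_partial(2)[OF \<phi>(1), of t x]]
        by (simp add: grad_def space_grad_def fun_eq_iff)
      moreover have "(LINT x|\<nu>. \<rho>w \<tau> x * \<phi> (\<tau>, x)) = (LINT x|\<nu>. \<rho> \<tau> x * \<phi> (\<tau>, x))"
        using elim \<rho>w_meas space_meas[OF smooth_imp_C1(3)[OF \<phi>(1)], of \<tau>]
        by (intro integral_cong_AE) (auto elim: eventually_mono)
      ultimately show "(LINT x|\<nu>. \<rho> \<tau> x * \<phi> (\<tau>, x)) - (LINT x|\<nu>. \<rho>0 x * \<phi> (0, x))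
        = (LINT z|lebesgue_on (Q\<tau> \<tau>). \<rho>Q z * time_deriv \<phi> z
             + (\<rho>Q z *\<^sub>R uQ z) \<bullet> space_grad \<phi> z)"
        by (simp add: split_beta')
    qed
  qed
qed

lemma weak_momentum_AE:
  "AE \<tau> in lebesgue_on {0<..<T}.
    (LINT x|\<nu>. (\<rho> \<tau> x *\<^sub>R u \<tau> x) \<bullet> \<psi>U (\<tau>, x)) - (LINT x|\<nu>. (\<rho>0 x *\<^sub>R u0 x) \<bullet> \<psi>U (0, x))
    = (LINT z|lebesgue_on (Q\<tau> \<tau>). (\<rho>Q z *\<^sub>R uQ z) \<bullet> time_deriv \<psi>U z
        + tensor (\<rho>Q z *\<^sub>R uQ z) (uQ z) \<bullet> JU z
        + p (\<rho>Q z) * trace (JU z)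
        - stress \<mu> \<eta> (DuQ z) \<bullet> JU z
        + (\<rho>Q z *\<^sub>R fQ z) \<bullet> \<psi>U z)"
proof -
  obtain m where ae: "AE t in lebesgue_on {0<..<T}. AE x in \<nu>. m t x = \<rho> t x *\<^sub>R u t x"
    and Cw: "C_weak (2 * \<gamma> / (\<gamma> + 1)) T \<Omega> m"
    and eq: "weak_momentum_equation \<mu> \<eta> p f T \<Omega> \<rho>0 u0 m \<rho> u Du"
    using momentum by blast
  let ?\<phi> = "\<lambda>t x. \<psi>U (t, x)"
  have "Cc_open T \<Omega> ?\<phi>" using \<psi>U by (auto simp: Cc_open_def)
  note eq' = eq[unfolded weak_momentum_equation_def, rule_format, OF _ this]
  have 1: "dt ?\<phi> t x = time_deriv \<psi>U (t, x)" for t x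
    unfolding dt_def by (rule vector_derivative_at[OF has_derivative_partial(1)[OF \<psi>U(1)]])
  have 2: "vgrad (?\<phi> t) x = JU (t, x)" for t x
    using frechet_derivative_at[OF has_derivative_partial(2)[OF \<psi>U(1), of t x]]
    by (simp add: vgrad_def jacobian_def matrix_def space_jacobian_def fun_eq_iff)
  have "AE \<tau> in lebesgue_on {0<..<T}. \<tau> \<in> {0<..<T}"
    by (rule AE_I2) simp
  then show ?thesis using ae sections
  proof eventually_elim
    case (elim \<tau>)
    have mm: "m \<tau> \<in> borel_measurable \<nu>"
      using Cw elim by (auto simp: C_weak_def L2_plus_Lq_def)
    have "(LINT x|\<nu>. m \<tau> x \<bullet> \<psi>U (\<tau>, x)) = (LINT x|\<nu>. (\<rho> \<tau> x *\<^sub>R u \<tau> x) \<bullet> \<psi>U (\<tau>, x))"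
      using elim mm space_meas[OF test_continuous(4), of \<tau>]
      by (intro integral_cong_AE) (auto elim: eventually_mono)
    then show ?case using eq'[of \<tau>] elim by (simp add: 1 2 split_beta')
  qed
qed

end

section \<open>Test functions of the density\<close>

lemma abs_mult_mono:
  fixes a b A B :: real
  shows "\<bar>a\<bar> \<le> A \<Longrightarrow> \<bar>b\<bar> \<le> B \<Longrightarrow> \<bar>a * b\<bar> \<le> A * B"
  unfolding abs_mult by (intro mult_mono) auto

text \<open>Error estimate for replacing a C1 function by a polynomial: one weight \<open>w\<close>,
  independent of \<open>e\<close>, controls the integrand and the difference.\<close>

lemma abs_integral_diff_le:
  fixes f1 f2 w :: "'a \<Rightarrow> real"
  assumes w: "integrable M w" and f: "f1 \<in> borel_measurable M" "f2 \<in> borel_measurable M"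
    and bd: "AE x in M. \<bar>f1 x\<bar> \<le> B * w x" "AE x in M. \<bar>f1 x - f2 x\<bar> \<le> e * w x"
  shows "\<bar>(LINT x|M. f1 x) - (LINT x|M. f2 x)\<bar> \<le> e * (LINT x|M. w x)"
proof -
  have i1: "integrable M f1" using integrable_dominated[OF w f(1) bd(1)] .
  have "(\<lambda>x. f1 x - f2 x) \<in> borel_measurable M" using f by measurable
  then have i: "integrable M (\<lambda>x. f1 x - f2 x)" by (rule integrable_dominated[OF w _ bd(2)])
  from Bochner_Integration.integrable_diff[OF i1 i] have i2: "integrable M f2" by simp
  have "\<bar>(LINT x|M. f1 x) - (LINT x|M. f2 x)\<bar> = \<bar>LINT x|M. f1 x - f2 x\<bar>"
    using i1 i2 by simp
  also have "\<dots> \<le> (LINT x|M. \<bar>f1 x - f2 x\<bar>)"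
    by (rule integral_abs_bound)
  also have "\<dots> \<le> (LINT x|M. e * w x)"
    by (rule integral_mono_AE) (use i w bd in auto)
  finally show ?thesis using w by simp
qed

lemma partials_compose:
  assumes \<psi>: "smooth \<psi>" and G: "(G has_real_derivative k) (at (b + \<psi> z))"
  shows "time_deriv (\<lambda>z. G (b + \<psi> z)) z = k * time_deriv \<psi> z"
    and "space_grad (\<lambda>z. G (b + \<psi> z)) z = k *\<^sub>R space_grad \<psi> z"
proof -
  have "((\<lambda>z. b + \<psi> z) has_derivative frechet_derivative \<psi> (at z)) (at z)"
    using has_derivative_add[OF has_derivative_const smooth_imp_C1(1)[OF \<psi>, of z], of b] by simp
  from has_derivative_compose[OF this G[unfolded has_field_derivative_def]]
  have "frechet_derivative (\<lambda>z. G (b + \<psi> z)) (at z) = (\<lambda>h. k * frechet_derivative \<psi> (at z) h)"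
    by (rule frechet_derivative_at[symmetric])
  then show "time_deriv (\<lambda>z. G (b + \<psi> z)) z = k * time_deriv \<psi> z"
    "space_grad (\<lambda>z. G (b + \<psi> z)) z = k *\<^sub>R space_grad \<psi> z"
    by (simp_all add: time_deriv_def space_grad_def vec_eq_iff)
qed

lemma compact_supp_subset:
  fixes f :: "'a::euclidean_space \<Rightarrow> 'b::zero"
  assumes "\<And>x. g x = 0 \<Longrightarrow> f x = 0" "compact (supp g)"
  shows "compact (supp f)" "supp f \<subseteq> supp g"
proof -
  have "{x. f x \<noteq> 0} \<subseteq> {x. g x \<noteq> 0}" using assms(1) by auto
  then show "supp f \<subseteq> supp g" unfolding supp_def by (rule closure_mono)
  then show "compact (supp f)"
    using assms(2) compact_Int_closed[of "supp g" "supp f"] by (simp add: Int_absorb1 supp_def)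
qed

lemma eq_if_abs_diff_le:
  fixes x y C :: real
  assumes "\<And>e. e > 0 \<Longrightarrow> \<bar>x - y\<bar> \<le> e * C"
  shows "x = y"
proof (rule ccontr)
  assume "x \<noteq> y"
  \<comment> \<open>\<open>C\<close> may be zero or negative; \<open>n\<close> is a positive upper
    bound by which one can divide.\<close>
  define n where "n = \<bar>C\<bar> + 1"
  have n: "n > 0" "C \<le> n" by (auto simp: n_def)
  define e where "e = \<bar>x - y\<bar> / (2 * n)"
  have "e > 0" using \<open>x \<noteq> y\<close> n by (simp add: e_def)
  have "e * C \<le> e * n" using \<open>e > 0\<close> n by (intro mult_left_mono) auto
  also have "\<dots> = \<bar>x - y\<bar> / 2" using n by (simp add: e_def)
  finally show False using assms[OF \<open>e > 0\<close>] \<open>x \<noteq> y\<close> by simp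
qed

context weak_solution
begin

text \<open>As \<open>g\<close> is continuous on the positive half-line only, measurability is
  claimed where \<rho>b + \<psi>r is known to be positive.\<close>

lemma r_compose_meas:
  fixes g :: "real \<Rightarrow> real"
  assumes g: "continuous_on {0<..} g"
  shows "t \<in> {0..T} \<Longrightarrow> (\<lambda>x. g (r\<psi> (t, x))) \<in> borel_measurable \<nu>"
    and "(\<lambda>z. g (r\<psi> z)) \<in> borel_measurable (lebesgue_on Q)"
proof -
  have pos: "r\<psi> (t, x) > 0" if "t \<in> {0..T}" "x \<in> \<Omega>" for t x
    using r_pos[OF that(1)] r_eq[OF that(1)] \<Omega>_subset_closure[OF that(2)] by simp
  show "(\<lambda>x. g (r\<psi> (t, x))) \<in> borel_measurable \<nu>" if t: "t \<in> {0..T}"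
  proof (rule continuous_imp_measurable_on_sets_lebesgue)
    have "continuous_on \<Omega> (\<lambda>x. r\<psi> (t, x))"
      by (intro continuous_intros continuous_on_compose2[OF test_continuous(1)]) auto
    then show "continuous_on \<Omega> (\<lambda>x. g (r\<psi> (t, x)))"
      by (rule continuous_on_compose2[OF g]) (use pos t in auto)
  qed (rule sets_borel)
  show "(\<lambda>z. g (r\<psi> z)) \<in> borel_measurable (lebesgue_on Q)"
  proof (rule continuous_imp_measurable_on_sets_lebesgue)
    have "continuous_on Q (\<lambda>z. r\<psi> z)"
      by (intro continuous_intros continuous_on_subset[OF test_continuous(1)]) auto
    then show "continuous_on Q (\<lambda>z. g (r\<psi> z))"
      by (rule continuous_on_compose2[OF g]) (use pos in auto)
  qed (rule sets_borel)
qed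

lemma borel_measurable_Q\<tau>:
  assumes "g \<in> borel_measurable (lebesgue_on Q)" "\<tau> \<le> T"
  shows "g \<in> borel_measurable (lebesgue_on (Q\<tau> \<tau>))"
  by (rule measurable_restrict_mono[OF assms(1) Q\<tau>_subset(1)[OF assms(2)]])

lemma integrable_Q\<tau>:
  fixes g :: "real \<times> (real^3) \<Rightarrow> real"
  assumes "integrable (lebesgue_on Q) g" "\<tau> \<le> T"
  shows "integrable (lebesgue_on (Q\<tau> \<tau>)) g"
  using integrable_lebesgue_on_subset[OF assms(1) Q\<tau>_subset(1)[OF assms(2)] Q\<tau>_subset(2)] sets_borel by simp

text \<open>The left side is linear in \<open>G\<close>, the right side in \<open>k\<close> = G'.
  For a polynomial P with P \<rho>b = 0 the identity is the weak continuity equation, and passing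
  from P to \<open>G\<close> changes both sides by at most e times a fixed constant.\<close>

lemma weak_continuity_C1:
  assumes G: "\<And>s. s > 0 \<Longrightarrow> (G has_real_derivative k s) (at s)" and k: "continuous_on {0<..} k"
    and zero: "\<rho>b > 0 \<Longrightarrow> G \<rho>b = 0"
  shows "AE \<tau> in lebesgue_on {0<..<T}.
    (LINT x|\<nu>. \<rho> \<tau> x * G (r\<psi> (\<tau>, x))) - (LINT x|\<nu>. \<rho>0 x * G (r\<psi> (0, x)))
    = (LINT z|lebesgue_on (Q\<tau> \<tau>). k (r\<psi> z) * (\<rho>Q z * time_deriv \<psi>r z
         + (\<rho>Q z *\<^sub>R uQ z) \<bullet> space_grad \<psi>r z))"
proof -
  obtain c d where cd: "0 < c" "c \<le> d" and
    range_cl: "\<And>t x. t \<in> {0..T} \<Longrightarrow> x \<in> closure \<Omega> \<Longrightarrow> r\<psi> (t, x) \<in> {c..d}" and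
    bpos: "\<rho>b > 0 \<Longrightarrow> \<rho>b \<in> {c..d}" and bzero: "\<rho>b = 0 \<Longrightarrow> \<rho>b < c"
    by (rule r_range) blast
  have range: "r\<psi> (t, x) \<in> {c..d} \<inter> {0<..}" if "t \<in> {0..T}" "x \<in> \<Omega>" for t x
    using range_cl[OF that(1) \<Omega>_subset_closure[OF that(2)]] cd by auto
  obtain C where C: "C \<ge> 0"
    "\<And>t x. \<bar>time_deriv \<psi>r (t, x)\<bar> \<le> C * indicator K x"
    "\<And>t x. norm (space_grad \<psi>r (t, x)) \<le> C * indicator K x"
    by (rule test_bounds) blast
  have Gc: "continuous_on {0<..} G"
    using G by (intro continuous_at_imp_continuous_on) (auto dest: DERIV_isCont)
  have sub: "{c..d} \<subseteq> {0<..}" using cd by auto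
  have "compact (G ` {c..d})" "compact (k ` {c..d})"
    using continuous_on_subset[OF Gc sub] continuous_on_subset[OF k sub]
    by (auto intro!: compact_continuous_image)
  then obtain B1 B2 where B: "\<And>s. s \<in> {c..d} \<Longrightarrow> \<bar>G s\<bar> \<le> B1" "\<And>s. s \<in> {c..d} \<Longrightarrow> \<bar>k s\<bar> \<le> B2"
    by (fastforce dest!: compact_imp_bounded simp: bounded_iff)
  have "AE \<tau> in lebesgue_on {0<..<T}. \<tau> \<in> {0<..<T}"
    by (rule AE_I2) simp
  then show ?thesis using weak_continuity_AE slice_integrable sections
  proof eventually_elim
    case (elim \<tau>)
    then have \<tau>: "\<tau> \<in> {0..T}" "0 \<in> {0..T}" "\<tau> \<le> T" by auto
    let ?\<sigma> = "\<lambda>\<sigma> x. indicator K x * \<bar>\<sigma> x\<bar> :: real"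
    let ?q = "\<lambda>z. \<rho>Q z * time_deriv \<psi>r z + (\<rho>Q z *\<^sub>R uQ z) \<bullet> space_grad \<psi>r z"
    let ?w = "\<lambda>z. C * (\<bar>indicator K (snd z) * \<rho>Q z\<bar> + indicator K (snd z) * norm (\<rho>Q z *\<^sub>R uQ z))"
    have w: "integrable (lebesgue_on (Q\<tau> \<tau>)) ?w"
      using integrable_density integrable_momentum by (intro integrable_Q\<tau>[OF _ \<tau>(3)]) simp
    have q_le: "\<bar>?q z\<bar> \<le> ?w z" for z
    proof -
      obtain t x where z: "z = (t, x)" by (cases z)
      let ?m = "\<rho> t x *\<^sub>R u t x"
      have "\<bar>\<rho> t x * time_deriv \<psi>r (t, x)\<bar> \<le> \<bar>\<rho> t x\<bar> * (C * indicator K x)"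
        unfolding abs_mult by (rule mult_left_mono[OF C(2)]) simp
      moreover have "\<bar>?m \<bullet> space_grad \<psi>r (t, x)\<bar> \<le> norm ?m * (C * indicator K x)"
        by (rule order_trans[OF Cauchy_Schwarz_ineq2 mult_left_mono[OF C(3)]]) simp
      ultimately have "\<bar>?q z\<bar> \<le> \<bar>\<rho> t x\<bar> * (C * indicator K x) + norm ?m * (C * indicator K x)"
        unfolding z fst_conv snd_conv by linarith
      also have "\<dots> = ?w z"
        by (simp add: z abs_mult distrib_left mult_ac)
      finally show ?thesis .
    qed
    have q_meas: "?q \<in> borel_measurable (lebesgue_on (Q\<tau> \<tau>))"
      by (rule borel_measurable_Q\<tau>[OF _ \<tau>(3)]) measurable
    have in_Q\<tau>: "r\<psi> z \<in> {c..d}" if "z \<in> Q\<tau> \<tau>" for z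
      using range[of "fst z" "snd z"] that \<tau> by (cases z) auto
    \<comment> \<open>Collects the three weights of the error estimates; it is fixed before the
      accuracy \<open>e\<close> is chosen.\<close>
    define W where "W = (LINT x|\<nu>. ?\<sigma> (\<rho> \<tau>) x) + (LINT x|\<nu>. ?\<sigma> \<rho>0 x) + (LINT z|lebesgue_on (Q\<tau> \<tau>). ?w z)"
    let ?L = "\<lambda>G. (LINT x|\<nu>. \<rho> \<tau> x * G (r\<psi> (\<tau>, x))) - (LINT x|\<nu>. \<rho>0 x * G (r\<psi> (0, x)))"
    let ?R = "\<lambda>k. (LINT z|lebesgue_on (Q\<tau> \<tau>). k (r\<psi> z) * ?q z)"
    show ?case
    proof (rule eq_if_abs_diff_le[of _ _ W])
      fix e :: real assume e: "e > 0"
      have Gw: "(G has_real_derivative k s) (at s within {c..d})" if "s \<in> {c..d}" for s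
        using sub that by (intro has_field_derivative_at_within[OF G]) auto
      \<comment> \<open>For \<rho>b = 0 nothing is assumed about \<open>G\<close> at 0, but then 0
        lies to the left of the range of r and the polynomial can be made to vanish there.\<close>
      have "\<rho>b \<in> {c..d} \<and> G \<rho>b = 0 \<or> \<rho>b < c"
        using zero bpos bzero \<rho>b_nonneg by (cases "\<rho>b = 0") auto
      from C1_polynomial_approx_zero[OF Gw continuous_on_subset[OF k sub] e cd(2) this]
      obtain P P' where P: "real_polynomial_function P" "\<And>s. (P has_real_derivative P' s) (at s)" "P \<rho>b = 0"
        "\<And>s. s \<in> {c..d} \<Longrightarrow> \<bar>P s - G s\<bar> < e" "\<And>s. s \<in> {c..d} \<Longrightarrow> \<bar>P' s - k s\<bar> < e"
        by blast
      let ?\<phi> = "\<lambda>z. P (r\<psi> z)"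
      have Pc: "continuous_on {0<..} P"
        using P(2) by (intro continuous_at_imp_continuous_on) (auto dest: DERIV_isCont)
      \<comment> \<open>Where \<psi>r vanishes the composition takes the value P \<rho>b = 0, whence
        the compact support.\<close>
      have \<phi>: "smooth ?\<phi>" "compact (supp ?\<phi>)"
        using P(3) \<psi>r by (auto intro!: smooth_real_polynomial[OF P(1)] smooth_add smooth_const
          compact_supp_subset(1)[of \<psi>r ?\<phi>])
      have eqP: "?L P = ?R P'"
        using elim(2)[rule_format, OF conjI[OF \<phi>]] unfolding partials_compose[OF \<psi>r(1) P(2)]
        by (simp add: algebra_simps)
      have R: "\<bar>?R k - ?R P'\<bar> \<le> e * (LINT z|lebesgue_on (Q\<tau> \<tau>). ?w z)"
      proof (rule abs_integral_diff_le[OF w, where B = B2])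
        show "(\<lambda>z. k (r\<psi> z) * ?q z) \<in> borel_measurable (lebesgue_on (Q\<tau> \<tau>))"
          using borel_measurable_Q\<tau>[OF r_compose_meas(2)[OF k] \<tau>(3)] q_meas by (rule borel_measurable_times)
        have [measurable]: "time_deriv ?\<phi> \<in> borel_measurable (lebesgue_on Q)" "space_grad ?\<phi> \<in> borel_measurable (lebesgue_on Q)"
          using continuous_partials(1,2)[OF \<phi>(1)] by (auto intro: continuous_meas_Q)
        have "(\<lambda>z. \<rho>Q z * time_deriv ?\<phi> z + (\<rho>Q z *\<^sub>R uQ z) \<bullet> space_grad ?\<phi> z)
            \<in> borel_measurable (lebesgue_on Q)"
          by measurable
        then show "(\<lambda>z. P' (r\<psi> z) * ?q z) \<in> borel_measurable (lebesgue_on (Q\<tau> \<tau>))"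
          using borel_measurable_Q\<tau>[OF _ \<tau>(3)] by (simp add: partials_compose[OF \<psi>r(1) P(2)] algebra_simps)
        show "AE z in lebesgue_on (Q\<tau> \<tau>). \<bar>k (r\<psi> z) * ?q z\<bar> \<le> B2 * ?w z"
          by (intro AE_I2 abs_mult_mono[OF B(2) q_le] in_Q\<tau>) simp
        show "AE z in lebesgue_on (Q\<tau> \<tau>). \<bar>k (r\<psi> z) * ?q z - P' (r\<psi> z) * ?q z\<bar> \<le> e * ?w z"
        proof (rule AE_I2)
          fix z assume "z \<in> space (lebesgue_on (Q\<tau> \<tau>))"
          then have "\<bar>k (r\<psi> z) - P' (r\<psi> z)\<bar> \<le> e"
            using P(5)[OF in_Q\<tau>[of z]] by simp
          then have "\<bar>(k (r\<psi> z) - P' (r\<psi> z)) * ?q z\<bar> \<le> e * ?w z"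
            using q_le by (rule abs_mult_mono)
          then show "\<bar>k (r\<psi> z) * ?q z - P' (r\<psi> z) * ?q z\<bar> \<le> e * ?w z"
            by (simp only: left_diff_distrib)
        qed
      qed
      have L: "\<bar>(LINT x|\<nu>. \<sigma> x * G (r\<psi> (t, x))) - (LINT x|\<nu>. \<sigma> x * P (r\<psi> (t, x)))\<bar>
          \<le> e * (LINT x|\<nu>. ?\<sigma> \<sigma> x)"
        if t: "t \<in> {0..T}" and \<sigma>: "integrable \<nu> (\<lambda>x. indicator K x * \<sigma> x)" "\<sigma> \<in> borel_measurable \<nu>"
        for t and \<sigma> :: "real^3 \<Rightarrow> real"
      proof (rule abs_integral_diff_le[where B = "B1"])
        show "integrable \<nu> (?\<sigma> \<sigma>)"
          using integrable_abs[OF \<sigma>(1)] by (simp add: abs_mult)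
        show "(\<lambda>x. \<sigma> x * G (r\<psi> (t, x))) \<in> borel_measurable \<nu>"
          using \<sigma>(2) r_compose_meas(1)[OF Gc t] by (rule borel_measurable_times)
        show "(\<lambda>x. \<sigma> x * P (r\<psi> (t, x))) \<in> borel_measurable \<nu>"
          using \<sigma>(2) r_compose_meas(1)[OF Pc t] by (rule borel_measurable_times)
        \<comment> \<open>Off \<open>K\<close> the value of \<rho>b + \<psi>r is \<rho>b, which must
          be positive; so \<open>zero\<close> applies, and for \<rho>b = 0 there are no such
          points.\<close>
        have out: "G (r\<psi> (t, x)) = 0" "P (r\<psi> (t, x)) = 0" if "x \<in> \<Omega>" "x \<notin> K" for x
          using range[OF t that(1)] not_in_K(1)[OF that(2), of t] zero P(3) by auto
        have le: "\<bar>\<sigma> x * h\<bar> \<le> B * ?\<sigma> \<sigma> x" if "x \<notin> K \<Longrightarrow> h = 0" "\<bar>h\<bar> \<le> B" for x h B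
          using that mult_right_mono[OF that(2), of "\<bar>\<sigma> x\<bar>"] by (cases "x \<in> K") (auto simp: abs_mult mult.commute)
        show "AE x in \<nu>. \<bar>\<sigma> x * G (r\<psi> (t, x))\<bar> \<le> B1 * ?\<sigma> \<sigma> x"
          using out range[OF t] by (intro AE_I2 le B) auto
        show "AE x in \<nu>. \<bar>\<sigma> x * G (r\<psi> (t, x)) - \<sigma> x * P (r\<psi> (t, x))\<bar> \<le> e * ?\<sigma> \<sigma> x"
        proof (rule AE_I2)
          fix x assume "x \<in> space \<nu>"
          then have x: "x \<in> \<Omega>" by simp
          have "\<bar>G (r\<psi> (t, x)) - P (r\<psi> (t, x))\<bar> \<le> e"
            using P(4)[of "r\<psi> (t, x)"] range[OF t x] by (simp add: abs_minus_commute)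
          then have "\<bar>\<sigma> x * (G (r\<psi> (t, x)) - P (r\<psi> (t, x)))\<bar> \<le> e * ?\<sigma> \<sigma> x"
            by (intro le) (use out x in auto)
          then show "\<bar>\<sigma> x * G (r\<psi> (t, x)) - \<sigma> x * P (r\<psi> (t, x))\<bar> \<le> e * ?\<sigma> \<sigma> x"
            by (simp only: right_diff_distrib)
        qed
      qed
      have 1: "\<bar>(LINT x|\<nu>. \<rho> \<tau> x * G (r\<psi> (\<tau>, x))) - (LINT x|\<nu>. \<rho> \<tau> x * P (r\<psi> (\<tau>, x)))\<bar>
          \<le> e * (LINT x|\<nu>. ?\<sigma> (\<rho> \<tau>) x)"
        using elim by (intro L[OF \<tau>(1)]) auto
      have 2: "\<bar>(LINT x|\<nu>. \<rho>0 x * G (r\<psi> (0, x))) - (LINT x|\<nu>. \<rho>0 x * P (r\<psi> (0, x)))\<bar>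
          \<le> e * (LINT x|\<nu>. ?\<sigma> \<rho>0 x)"
        by (intro L[OF \<tau>(2)] integrable_initial_density \<rho>0_meas)
      show "\<bar>?L G - ?R k\<bar> \<le> e * W"
        using 1 2 R eqP unfolding W_def distrib_left by linarith
    qed
  qed
qed

lemma weak_continuity_kinetic:
  "AE \<tau> in lebesgue_on {0<..<T}.
    (LINT x|\<nu>. \<rho> \<tau> x * (1/2 * (norm (\<psi>U (\<tau>, x)))\<^sup>2))
      - (LINT x|\<nu>. \<rho>0 x * (1/2 * (norm (\<psi>U (0, x)))\<^sup>2))
    = (LINT z|lebesgue_on (Q\<tau> \<tau>). \<rho>Q z * (\<psi>U z \<bullet> time_deriv \<psi>U z)
         + \<rho>Q z * (\<psi>U z \<bullet> (JU z *v uQ z)))"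
proof -
  define \<phi> where "\<phi> = (\<lambda>z. 1/2 * (\<psi>U z \<bullet> \<psi>U z))"
  have \<phi>: "smooth \<phi>" "compact (supp \<phi>)"
    unfolding \<phi>_def
    by (intro smooth_mult smooth_const smooth_inner \<psi>U(1))
       (rule compact_supp_subset(1)[OF _ \<psi>U(2)], simp)
  have D: "frechet_derivative \<phi> (at z) = (\<lambda>h. \<psi>U z \<bullet> frechet_derivative \<psi>U (at z) h)" for z
  proof -
    have "(\<phi> has_derivative (\<lambda>h. 1/2 * (\<psi>U z \<bullet> frechet_derivative \<psi>U (at z) h + frechet_derivative \<psi>U (at z) h \<bullet> \<psi>U z))) (at z)"
      unfolding \<phi>_def by (intro has_derivative_mult_right has_derivative_inner smooth_imp_C1(1)[OF \<psi>U(1)])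
    from frechet_derivative_at[OF this] show ?thesis
      by (simp add: inner_commute)
  qed
  have "time_deriv \<phi> z = \<psi>U z \<bullet> time_deriv \<psi>U z" for z
    by (simp add: time_deriv_def D)
  moreover have "(\<rho>Q z *\<^sub>R v) \<bullet> space_grad \<phi> z
      = \<rho>Q z * (\<psi>U z \<bullet> (JU z *v v))" for z v
    by (simp add: inner_space_grad[OF \<phi>(1)] space_jacobian_mult[OF \<psi>U(1)] D inner_commute[of v])
  ultimately have eq: "(\<rho>Q z * time_deriv \<phi> z + (\<rho>Q z *\<^sub>R uQ z) \<bullet> space_grad \<phi> z)
      = \<rho>Q z * (\<psi>U z \<bullet> time_deriv \<psi>U z)
         + \<rho>Q z * (\<psi>U z \<bullet> (JU z *v uQ z))" for z
    by simp
  have \<phi>_eq: "1/2 * (norm (\<psi>U z))\<^sup>2 = \<phi> z" for z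
    by (simp add: \<phi>_def power2_norm_eq_inner)
  show ?thesis
    using weak_continuity_AE unfolding \<phi>_eq eq[symmetric]
    by eventually_elim (use \<phi> in blast)
qed

section \<open>The pressure of the comparison density\<close>

lemma pressure_bounds:
  obtains B where "B \<ge> 0"
    "\<And>t x. t \<in> {0..T} \<Longrightarrow> x \<in> \<Omega> \<Longrightarrow> \<bar>p (r\<psi> (t, x))\<bar> \<le> B"
    "\<And>t x. t \<in> {0..T} \<Longrightarrow> x \<in> \<Omega> \<Longrightarrow> \<bar>deriv p (r\<psi> (t, x))\<bar> \<le> B"
    "\<And>t x. t \<in> {0..T} \<Longrightarrow> x \<in> \<Omega> \<Longrightarrow> 0 < r\<psi> (t, x)"
    "\<And>t x. t \<in> {0..T} \<Longrightarrow> x \<in> \<Omega> \<Longrightarrow> \<bar>deriv p (r\<psi> (t, x)) / (r\<psi> (t, x))\<bar> \<le> B"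
    "\<And>t x. t \<in> {0..T} \<Longrightarrow> x \<in> \<Omega> \<Longrightarrow> \<bar>dH p \<rho>b (r\<psi> (t, x))\<bar> \<le> B"
proof -
  obtain c d where cd: "0 < c" "c \<le> d" and
    range_cl: "\<And>t x. t \<in> {0..T} \<Longrightarrow> x \<in> closure \<Omega> \<Longrightarrow> r\<psi> (t, x) \<in> {c..d}"
    by (rule r_range) blast
  have range: "r\<psi> (t, x) \<in> {c..d}" if "t \<in> {0..T}" "x \<in> \<Omega>" for t x
    using range_cl[OF that(1) \<Omega>_subset_closure[OF that(2)]] .
  have sub: "{c..d} \<subseteq> {0<..}" "{c..d} \<subseteq> {0..}" using cd by auto
  have dHc: "continuous_on {0<..} (dH p \<rho>b)"
    using dH_deriv by (intro continuous_at_imp_continuous_on) (auto dest: DERIV_isCont)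
  have ex: "\<exists>B. \<forall>s\<in>{c..d}. \<bar>g s\<bar> \<le> B" if "continuous_on {c..d} g" for g :: "real \<Rightarrow> real"
    using compact_imp_bounded[OF compact_continuous_image[OF that compact_Icc]] by (auto simp: bounded_iff)
  have "continuous_on {c..d} (\<lambda>s. deriv p s / s)"
    using sub by (intro continuous_intros continuous_on_subset[OF continuous_deriv_p sub(1)]) auto
  from ex[OF continuous_on_subset[OF p_cont sub(2)]] ex[OF continuous_on_subset[OF continuous_deriv_p sub(1)]]
    ex[OF this] ex[OF continuous_on_subset[OF dHc sub(1)]]
  obtain B1 B2 B3 B4 where B: "\<And>s. s \<in> {c..d} \<Longrightarrow> \<bar>p s\<bar> \<le> B1" "\<And>s. s \<in> {c..d} \<Longrightarrow> \<bar>deriv p s\<bar> \<le> B2"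
    "\<And>s. s \<in> {c..d} \<Longrightarrow> \<bar>deriv p s / s\<bar> \<le> B3" "\<And>s. s \<in> {c..d} \<Longrightarrow> \<bar>dH p \<rho>b s\<bar> \<le> B4" by blast
  define B where "B = \<bar>B1\<bar> + \<bar>B2\<bar> + \<bar>B3\<bar> + \<bar>B4\<bar>"
  have le: "s \<le> B1 \<Longrightarrow> s \<le> B" "s \<le> B2 \<Longrightarrow> s \<le> B" "s \<le> B3 \<Longrightarrow> s \<le> B" "s \<le> B4 \<Longrightarrow> s \<le> B" for s
    unfolding B_def by linarith+
  show thesis
  proof (rule that[of B])
    show "0 < r\<psi> (t, x)" if "t \<in> {0..T}" "x \<in> \<Omega>" for t x
      using range[OF that] cd by simp
  qed (use le B range in \<open>auto simp: B_def simp del: abs_divide\<close>)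
qed

text \<open>For fixed x this is the fundamental theorem of calculus in t for p(r); Fubini's theorem
  with the time integral inside gives the space-time form. Subtracting \<open>b0\<close>, the
  pressure at \<rho>b, confines the integrand to \<open>K\<close>. For \<rho>b = 0 all of \<Omega>
  lies in \<open>K\<close> and the condition on \<open>b0\<close> is void.\<close>

lemma time_integral_pressure:
  assumes \<tau>: "\<tau> \<in> {0<..<T}" and b0: "\<rho>b > 0 \<Longrightarrow> p \<rho>b = b0"
  shows "\<And>t. t \<in> {0..T} \<Longrightarrow> integrable \<nu> (\<lambda>x. p (r\<psi> (t, x)) - b0)"
    and "integrable (lebesgue_on Q) (\<lambda>z. deriv p (r\<psi> z) * time_deriv \<psi>r z)"
    and "(LINT x|\<nu>. p (r\<psi> (\<tau>, x)) - b0) - (LINT x|\<nu>. p (r\<psi> (0, x)) - b0)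
      = (LINT z|lebesgue_on (Q\<tau> \<tau>). deriv p (r\<psi> z) * time_deriv \<psi>r z)"
proof -
  obtain B where B: "B \<ge> 0"
    "\<And>t x. t \<in> {0..T} \<Longrightarrow> x \<in> \<Omega> \<Longrightarrow> \<bar>p (r\<psi> (t, x))\<bar> \<le> B"
    "\<And>t x. t \<in> {0..T} \<Longrightarrow> x \<in> \<Omega> \<Longrightarrow> \<bar>deriv p (r\<psi> (t, x))\<bar> \<le> B"
    "\<And>t x. t \<in> {0..T} \<Longrightarrow> x \<in> \<Omega> \<Longrightarrow> 0 < r\<psi> (t, x)"
    by (rule pressure_bounds) blast
  obtain C where C: "C \<ge> 0" "\<And>t x. \<bar>time_deriv \<psi>r (t, x)\<bar> \<le> C * indicator K x"
    by (rule test_bounds) blast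
  have pc: "continuous_on {0<..} p" using p_cont by (rule continuous_on_subset) auto
  show int: "integrable \<nu> (\<lambda>x. p (r\<psi> (t, x)) - b0)" if t: "t \<in> {0..T}" for t
  proof (rule integrable_dominated[OF indicator_K_\<Omega>])
    show "(\<lambda>x. p (r\<psi> (t, x)) - b0) \<in> borel_measurable \<nu>"
      using r_compose_meas(1)[OF pc t] by simp
    show "AE x in \<nu>. \<bar>p (r\<psi> (t, x)) - b0\<bar> \<le> (B + \<bar>b0\<bar>) * indicator K x"
    proof (rule AE_I2)
      fix x assume "x \<in> space \<nu>"
      then have x: "x \<in> \<Omega>" by simp
      show "\<bar>p (r\<psi> (t, x)) - b0\<bar> \<le> (B + \<bar>b0\<bar>) * indicator K x"
      proof (cases "x \<in> K")
        case True
        then show ?thesis using B(2)[OF t x] by simp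
      next
        case False
        then show ?thesis using B(4)[OF t x] not_in_K(1)[OF False, of t] b0 by simp
      qed
    qed
  qed
  let ?F = "\<lambda>z. deriv p (r\<psi> z) * time_deriv \<psi>r z"
  show F: "integrable (lebesgue_on Q) ?F"
  proof (rule integrable_dominated[OF integrable_K])
    show "?F \<in> borel_measurable (lebesgue_on Q)"
      using r_compose_meas(2)[OF continuous_deriv_p] test_meas_Q(2) by (rule borel_measurable_times)
    show "AE z in lebesgue_on Q. \<bar>?F z\<bar> \<le> B * C * indicator K (snd z)"
      using abs_mult_mono[OF B(3) C(2)] by (intro AE_I2) (auto simp: mult.assoc)
  qed
  have \<tau>T: "\<tau> \<le> T" and t0: "\<tau> \<in> {0..T}" "0 \<in> {0..T}" using \<tau> by auto
  \<comment> \<open>Extension by zero of a function continuous on the open set Q\<tau>. It is Borel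
    measurable, so Fubini's theorem applies on \<open>lborel\<close>, in the order that integrates
    over time first.\<close>
  define G where "G t x = indicator {0<..<\<tau>} t * (indicator \<Omega> x * ?F (t, x))" for t x
  have G: "case_prod G = (\<lambda>z. indicator (Q\<tau> \<tau>) z *\<^sub>R ?F z)"
    by (auto simp: G_def indicator_def fun_eq_iff)
  have op: "open (Q\<tau> \<tau>)" using open_\<Omega> by (intro open_Times) auto
  have Fc: "continuous_on (Q\<tau> \<tau>) ?F"
  proof (intro continuous_intros)
    show "continuous_on (Q\<tau> \<tau>) (\<lambda>z. deriv p (r\<psi> z))"
      by (rule continuous_on_compose2[OF continuous_deriv_p])
         (use B(4) \<tau>T in \<open>auto intro!: continuous_intros continuous_on_subset[OF test_continuous(1)]\<close>)
  qed (rule continuous_on_subset[OF test_continuous(2)], simp)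
  have Gm: "case_prod G \<in> borel_measurable lborel"
  proof -
    have "(\<lambda>z. indicator (Q\<tau> \<tau>) z *\<^sub>R ?F z) \<in> borel_measurable borel"
      using op Fc by (intro borel_measurable_continuous_on_indicator) auto
    then show ?thesis unfolding G by (simp del: real_scaleR_def)
  qed
  have "integrable lebesgue (case_prod G)"
    unfolding G using integrable_Q\<tau>[OF F \<tau>T] Q\<tau>_subset(2)[of \<tau>]
      integrable_restrict_space[of "Q\<tau> \<tau>" lebesgue ?F] by simp
  then have Gi: "integrable (lborel \<Otimes>\<^sub>M lborel) (case_prod G)"
    using Gm by (simp add: lborel_prod integrable_completion)
  have inner: "(LINT t|lborel. G t x) = indicator \<Omega> x * (p (r\<psi> (\<tau>, x)) - p (r\<psi> (0, x)))" for x
  proof (cases "x \<in> \<Omega>")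
    case True
    have pos: "0 < r\<psi> (t, x)" if "t \<in> {0..\<tau>}" for t
      using B(4)[OF _ True, of t] that \<tau> by auto
    have "(LBINT t=ereal 0..ereal \<tau>. ?F (t, x)) = p (r\<psi> (\<tau>, x)) - p (r\<psi> (0, x))"
    proof (rule interval_integral_FTC_finite)
      show "continuous_on {min 0 \<tau>..max 0 \<tau>} (\<lambda>t. ?F (t, x))"
      proof (intro continuous_intros)
        show "continuous_on {min 0 \<tau>..max 0 \<tau>} (\<lambda>t. deriv p (r\<psi> (t, x)))"
          using \<tau> pos by (intro continuous_on_compose2[OF continuous_deriv_p] continuous_intros
            continuous_on_compose2[OF test_continuous(1)]) auto
        show "continuous_on {min 0 \<tau>..max 0 \<tau>} (\<lambda>t. time_deriv \<psi>r (t, x))"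
          by (intro continuous_on_compose2[OF test_continuous(2)] continuous_intros) auto
      qed
      fix t assume "min 0 \<tau> \<le> t" "t \<le> max 0 \<tau>"
      then have "0 < r\<psi> (t, x)" using pos \<tau> by auto
      then have 1: "(p has_real_derivative deriv p (r\<psi> (t, x))) (at (r\<psi> (t, x)))"
        by (rule p_deriv)
      have 2: "((\<lambda>s. r\<psi> (s, x)) has_real_derivative time_deriv \<psi>r (t, x)) (at t within {min 0 \<tau>..max 0 \<tau>})"
        using has_derivative_partial(1)[OF \<psi>r(1), of x t "{min 0 \<tau>..max 0 \<tau>}"]
        by (auto simp: has_real_derivative_iff_has_vector_derivative[symmetric] intro!: derivative_eq_intros)
      show "((\<lambda>s. p (r\<psi> (s, x))) has_vector_derivative ?F (t, x)) (at t within {min 0 \<tau>..max 0 \<tau>})"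
        using DERIV_chain2[OF 1 2] by (simp add: has_real_derivative_iff_has_vector_derivative)
    qed
    moreover have "(LBINT t=ereal 0..ereal \<tau>. ?F (t, x)) = (LINT t|lborel. G t x)"
      using \<tau> True by (simp add: interval_lebesgue_integral_def set_lebesgue_integral_def G_def)
    ultimately show ?thesis using True by simp
  qed (simp add: G_def)
  have "(LINT z|lebesgue_on (Q\<tau> \<tau>). ?F z) = (LINT z|lebesgue. case_prod G z)"
    unfolding G using Q\<tau>_subset(2) by (simp add: integral_restrict_space)
  also have "\<dots> = (LINT z|(lborel \<Otimes>\<^sub>M lborel). case_prod G z)"
    using Gm by (simp add: integral_completion lborel_prod)
  also have "\<dots> = (LINT x|lborel. LINT t|lborel. G t x)"
    using lborel_pair.integral_snd[OF Gi] by simp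
  also have "\<dots> = (LINT x|lborel. indicator \<Omega> x * (p (r\<psi> (\<tau>, x)) - p (r\<psi> (0, x))))"
    by (simp add: inner)
  also have "\<dots> = (LINT x|lebesgue. indicator \<Omega> x * (p (r\<psi> (\<tau>, x)) - p (r\<psi> (0, x))))"
  proof (rule integral_completion[symmetric])
    have "(\<lambda>x. LINT t|lborel. G t x) \<in> borel_measurable lborel"
      by (rule borel_measurable_integrable[OF lborel_pair.integrable_snd[OF Gi]])
    then show "(\<lambda>x. indicator \<Omega> x * (p (r\<psi> (\<tau>, x)) - p (r\<psi> (0, x)))) \<in> borel_measurable lborel"
      by (simp add: inner)
  qed
  also have "\<dots> = (LINT x|\<nu>. p (r\<psi> (\<tau>, x)) - p (r\<psi> (0, x)))"
    using sets_borel by (simp add: integral_restrict_space)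
  also have "\<dots> = (LINT x|\<nu>. (p (r\<psi> (\<tau>, x)) - b0) - (p (r\<psi> (0, x)) - b0))"
    by simp
  also have "\<dots> = (LINT x|\<nu>. p (r\<psi> (\<tau>, x)) - b0) - (LINT x|\<nu>. p (r\<psi> (0, x)) - b0)"
    by (rule Bochner_Integration.integral_diff) (rule int, rule t0)+
  finally show "(LINT x|\<nu>. p (r\<psi> (\<tau>, x)) - b0) - (LINT x|\<nu>. p (r\<psi> (0, x)) - b0)
      = (LINT z|lebesgue_on (Q\<tau> \<tau>). ?F z)" by simp
qed

text \<open>Divergence theorem for p(r) U, as a sum over i of integrals of the i-th derivative of
  the i-th component. Since U has compact support in \<Omega>, the extension by zero is
  differentiable everywhere and no boundary term arises.\<close>

lemma space_integral_pressure_flux: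
  assumes t: "t \<in> {0..T}"
  shows "(LINT x|\<nu>. deriv p (r\<psi> (t, x)) * (space_grad \<psi>r (t, x) \<bullet> \<psi>U (t, x))
      + p (r\<psi> (t, x)) * trace (JU (t, x))) = 0"
proof -
  obtain B where B: "B \<ge> 0"
    "\<And>t x. t \<in> {0..T} \<Longrightarrow> x \<in> \<Omega> \<Longrightarrow> \<bar>p (r\<psi> (t, x))\<bar> \<le> B"
    "\<And>t x. t \<in> {0..T} \<Longrightarrow> x \<in> \<Omega> \<Longrightarrow> \<bar>deriv p (r\<psi> (t, x))\<bar> \<le> B"
    "\<And>t x. t \<in> {0..T} \<Longrightarrow> x \<in> \<Omega> \<Longrightarrow> 0 < r\<psi> (t, x)"
    by (rule pressure_bounds) blast
  obtain C where C: "C \<ge> 0" "\<And>t x. norm (space_grad \<psi>r (t, x)) \<le> C * indicator K x"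
    "\<And>t x. norm (\<psi>U (t, x)) \<le> C * indicator KU x"
    "\<And>t x. norm (JU (t, x)) \<le> C * indicator KU x"
    by (rule test_bounds) blast
  have C': "norm (space_grad \<psi>r (t, x)) \<le> C" "norm (\<psi>U (t, x)) \<le> C" "norm (JU (t, x)) \<le> C" for x
    using C(1) order_trans[OF C(2)] order_trans[OF C(3)] order_trans[OF C(4)] by (auto simp: indicator_def)
  \<comment> \<open>Outside \<Omega> the function \<rho>b + \<psi>r may leave the positive
    half-line, on which p is known to be differentiable; hence the case distinction.\<close>
  define v where "v i x = (if x \<in> \<Omega> then p (r\<psi> (t, x)) * \<psi>U (t, x) $ i else 0)" for i x
  define v' where "v' i x h = (if x \<in> \<Omega> then p (r\<psi> (t, x)) * frechet_derivative \<psi>U (at (t, x)) (0, h) $ i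
      + deriv p (r\<psi> (t, x)) * frechet_derivative \<psi>r (at (t, x)) (0, h) * \<psi>U (t, x) $ i else 0)" for i x h
  have der: "(v i has_derivative v' i x) (at x)" for i x
  proof (cases "x \<in> \<Omega>")
    case True
    have r: "((\<lambda>y. r\<psi> (t, y)) has_derivative (\<lambda>h. frechet_derivative \<psi>r (at (t, x)) (0, h))) (at x)"
      using has_derivative_add[OF has_derivative_const has_derivative_partial(2)[OF \<psi>r(1), of t x], of \<rho>b] by simp
    have "((\<lambda>y. p (r\<psi> (t, y))) has_derivative (\<lambda>h. deriv p (r\<psi> (t, x)) * frechet_derivative \<psi>r (at (t, x)) (0, h))) (at x)"
      using has_derivative_compose[OF r p_deriv[OF B(4)[OF t True], unfolded has_field_derivative_def]] .
    moreover have "((\<lambda>y. \<psi>U (t, y) $ i) has_derivative (\<lambda>h. frechet_derivative \<psi>U (at (t, x)) (0, h) $ i)) (at x)"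
      using bounded_linear.has_derivative[OF bounded_linear_vec_nth has_derivative_partial(2)[OF \<psi>U(1), of t x]] .
    ultimately have "((\<lambda>y. p (r\<psi> (t, y)) * \<psi>U (t, y) $ i) has_derivative v' i x) (at x)"
      using has_derivative_mult True by (auto simp: v'_def[abs_def])
    then show ?thesis
      by (rule has_derivative_transform_within_open[OF _ open_\<Omega> True]) (simp add: v_def)
  next
    case False
    have v'0: "v' i x = (\<lambda>h. 0)" using False by (simp add: v'_def fun_eq_iff)
    \<comment> \<open>A point outside \<Omega> has a neighbourhood disjoint from the closed set
      \<open>KU\<close>, and \<open>v i\<close> vanishes there on either side of the
      boundary.\<close>
    have "open (- KU)" "x \<in> - KU" using compact_KU KU_subset False by (auto simp: compact_imp_closed open_Compl)
    then show ?thesis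
      unfolding v'0 by (rule has_derivative_transform_within_open[OF has_derivative_const])
        (auto simp: v_def not_in_KU)
  qed
  have bnd: "\<bar>v' i x (axis i 1)\<bar> \<le> B * C + B * C * C" for i x
  proof (cases "x \<in> \<Omega>")
    case True
    have 1: "\<bar>JU (t, x) $ i $ i\<bar> \<le> C"
      using order_trans[OF component_le_norm_cart order_trans[OF Finite_Cartesian_Product.norm_nth_le C'(3)]] by auto
    have 2: "\<bar>space_grad \<psi>r (t, x) $ i\<bar> \<le> C" "\<bar>\<psi>U (t, x) $ i\<bar> \<le> C"
      using order_trans[OF component_le_norm_cart C'(1)] order_trans[OF component_le_norm_cart C'(2)] by auto
    have "v' i x (axis i 1) = p (r\<psi> (t, x)) * JU (t, x) $ i $ i
        + deriv p (r\<psi> (t, x)) * space_grad \<psi>r (t, x) $ i * \<psi>U (t, x) $ i"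
      using True by (simp add: v'_def space_jacobian_def space_grad_def)
    then show ?thesis
      using abs_mult_mono[OF B(2)[OF t True] 1] abs_mult_mono[OF abs_mult_mono[OF B(3)[OF t True] 2(1)] 2(2)]
      by linarith
  next
    case False
    then show ?thesis using B C by (simp add: v'_def)
  qed
  have "v i x = 0" if "x \<notin> KU" for i x
    using that by (simp add: v_def not_in_KU)
  note int = integral_directional_derivative_eq_0[OF der bnd compact_imp_bounded[OF compact_KU] this]
  let ?D = "\<lambda>x. deriv p (r\<psi> (t, x)) * (space_grad \<psi>r (t, x) \<bullet> \<psi>U (t, x))
      + p (r\<psi> (t, x)) * trace (JU (t, x))"
  have eq: "indicator \<Omega> x * ?D x = (\<Sum>i\<in>UNIV. v' i x (axis i 1))" for x
    by (simp add: v'_def space_grad_def space_jacobian_def inner_vec_def trace_def sum_distrib_left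
        sum.distrib mult_ac indicator_def)
  have "(LINT x|\<nu>. ?D x) = (LINT x|lebesgue. (\<Sum>i\<in>UNIV. v' i x (axis i 1)))"
    using sets_borel by (simp add: integral_restrict_space flip: eq)
  also have "\<dots> = (LINT x|lborel. (\<Sum>i\<in>UNIV. v' i x (axis i 1)))"
    by (rule integral_completion) (use int(1) in auto)
  also have "\<dots> = 0"
    by (subst Bochner_Integration.integral_sum) (use int in auto)
  finally show ?thesis .
qed

lemma space_time_integral_pressure_flux:
  assumes \<tau>: "\<tau> \<in> {0<..<T}"
  shows "integrable (lebesgue_on Q) (\<lambda>z. deriv p (r\<psi> z) * (space_grad \<psi>r z \<bullet> \<psi>U z)
      + p (r\<psi> z) * trace (JU z))"
    and "(LINT z|lebesgue_on (Q\<tau> \<tau>). deriv p (r\<psi> z) * (space_grad \<psi>r z \<bullet> \<psi>U z)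
      + p (r\<psi> z) * trace (JU z)) = 0"
proof -
  let ?F = "\<lambda>z. deriv p (r\<psi> z) * (space_grad \<psi>r z \<bullet> \<psi>U z)
      + p (r\<psi> z) * trace (JU z)"
  obtain B where B: "B \<ge> 0"
    "\<And>t x. t \<in> {0..T} \<Longrightarrow> x \<in> \<Omega> \<Longrightarrow> \<bar>p (r\<psi> (t, x))\<bar> \<le> B"
    "\<And>t x. t \<in> {0..T} \<Longrightarrow> x \<in> \<Omega> \<Longrightarrow> \<bar>deriv p (r\<psi> (t, x))\<bar> \<le> B"
    by (rule pressure_bounds) blast
  obtain C where C: "C \<ge> 0" "\<And>t x. norm (space_grad \<psi>r (t, x)) \<le> C * indicator K x"
    "\<And>t x. norm (\<psi>U (t, x)) \<le> C * indicator KU x"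
    "\<And>t x. norm (JU (t, x)) \<le> C * indicator KU x"
    by (rule test_bounds) blast
  obtain D where D: "D \<ge> 0" "\<And>A. \<bar>trace (A :: real^3^3)\<bar> \<le> D * norm A"
  proof -
    have "bounded_linear (trace :: real^3^3 \<Rightarrow> real)"
      using linear_trace by (simp add: linear_conv_bounded_linear)
    then obtain D where "D > 0" "\<And>A. norm (trace (A :: real^3^3)) \<le> norm A * D"
      using bounded_linear.pos_bounded by blast
    then show thesis using that[of D] by (simp add: mult.commute)
  qed
  have pc: "continuous_on {0<..} p" using p_cont by (rule continuous_on_subset) auto
  show F: "integrable (lebesgue_on Q) ?F"
  proof (rule integrable_dominated[OF integrable_K])
    show "?F \<in> borel_measurable (lebesgue_on Q)"
      using r_compose_meas(2)[OF continuous_deriv_p] r_compose_meas(2)[OF pc] by measurable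
    show "AE z in lebesgue_on Q. \<bar>?F z\<bar> \<le> (B * (C * C) + B * (D * C)) * indicator K (snd z)"
    proof (rule AE_I2)
      fix z assume "z \<in> space (lebesgue_on Q)"
      then obtain t x where z: "z = (t, x)" "t \<in> {0..T}" "x \<in> \<Omega>" by (cases z) auto
      show "\<bar>?F z\<bar> \<le> (B * (C * C) + B * (D * C)) * indicator K (snd z)"
      proof (cases "x \<in> K")
        case True
        have le: "norm (space_grad \<psi>r (t, x)) \<le> C" "norm (\<psi>U (t, x)) \<le> C" "norm (JU (t, x)) \<le> C"
          using C(1) order_trans[OF C(2)] order_trans[OF C(3)] order_trans[OF C(4)] by (auto simp: indicator_def)
        have 1: "\<bar>space_grad \<psi>r (t, x) \<bullet> \<psi>U (t, x)\<bar> \<le> C * C"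
          using order_trans[OF Cauchy_Schwarz_ineq2 mult_mono[OF le(1,2) C(1) norm_ge_zero]] .
        have 2: "\<bar>trace (JU (t, x))\<bar> \<le> D * C"
          using order_trans[OF D(2) mult_left_mono[OF le(3) D(1)]] .
        show ?thesis
          using abs_mult_mono[OF B(3)[OF z(2,3)] 1] abs_mult_mono[OF B(2)[OF z(2,3)] 2] True
          unfolding z by simp
      next
        case False
        then have "space_grad \<psi>r (t, x) = 0" "JU (t, x) = 0" using not_in_K by auto
        then show ?thesis using False by (simp add: z linear_0[OF linear_trace])
      qed
    qed
  qed
  have s: "{0<..<\<tau>} \<in> sets borel" by simp
  have "(LINT z|lebesgue_on (Q\<tau> \<tau>). ?F z) = (LINT t|lebesgue_on {0<..<\<tau>}. LINT x|\<nu>. ?F (t, x))"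
    using lebesgue_on_Fubini(3)[OF s sets_borel(2) integrable_Q\<tau>[OF F]] \<tau> by simp
  also have "\<dots> = (LINT t|lebesgue_on {0<..<\<tau>}. 0)"
    by (rule Bochner_Integration.integral_cong) (use space_integral_pressure_flux \<tau> in auto)
  finally show "(LINT z|lebesgue_on (Q\<tau> \<tau>). ?F z) = 0" by simp
qed

end

section \<open>The relative energy inequality\<close>

lemma trace_bound:
  obtains D where "D \<ge> 0" "\<And>A. \<bar>trace (A :: real^3^3)\<bar> \<le> D * norm A"
proof -
  have "bounded_linear (trace :: real^3^3 \<Rightarrow> real)"
    using linear_trace by (simp add: linear_conv_bounded_linear)
  then obtain D where "D > 0" "\<And>A. norm (trace (A :: real^3^3)) \<le> norm A * D"
    using bounded_linear.pos_bounded by blast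
  then show thesis using that[of D] by (simp add: mult.commute)
qed

lemma borel_measurable_matrix_vector_mult:
  fixes A :: "'a \<Rightarrow> real^3^3" and v :: "'a \<Rightarrow> real^3"
  assumes "A \<in> borel_measurable M" "v \<in> borel_measurable M"
  shows "(\<lambda>x. A x *v v x) \<in> borel_measurable M"
  by (rule borel_measurable_continuous_Pair[OF assms])
     (auto simp: matrix_vector_mult_def intro!: continuous_on_vec_lambda continuous_intros)

text \<open>Has four slots; shorter combinations repeat one of the functions with coefficient
  0.\<close>

lemma integral_eq_linear_combination:
  fixes g a b c d :: "'a \<Rightarrow> real"
  assumes "integrable M a" "integrable M b" "integrable M c" "integrable M d"
    and "\<And>z. z \<in> space M \<Longrightarrow> g z = \<alpha> * a z + \<beta> * b z + \<gamma> * c z + \<delta> * d z"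
  shows "(LINT z|M. g z) = \<alpha> * (LINT z|M. a z) + \<beta> * (LINT z|M. b z) + \<gamma> * (LINT z|M. c z) + \<delta> * (LINT z|M. d z)"
proof -
  have "(LINT z|M. g z) = (LINT z|M. \<alpha> * a z + \<beta> * b z + \<gamma> * c z + \<delta> * d z)"
    using assms(5) by (rule Bochner_Integration.integral_cong[OF refl])
  then show ?thesis using assms(1-4) by simp
qed

context weak_solution
begin

text \<open>Terms linear in the density or the momentum are localised to \<open>K\<close> by a test
  function, or paired with f. The term quadratic in u needs the kinetic energy, p(\<rho>) needs
  \<open>KU\<close>, and terms linear in Du are dominated by the indicator of \<open>K\<close> plus
  |Du|^2.\<close>

lemma integrable_test_terms:
  shows "integrable (lebesgue_on Q) (\<lambda>z. \<rho>Q z * (\<psi>U z \<bullet> time_deriv \<psi>U z))" (is ?t1)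
    and "integrable (lebesgue_on Q) (\<lambda>z. (\<rho>Q z *\<^sub>R uQ z) \<bullet> time_deriv \<psi>U z)" (is ?t2)
    and "integrable (lebesgue_on Q) (\<lambda>z. \<rho>Q z * (\<psi>U z \<bullet> (JU z *v uQ z)))" (is ?t3)
    and "integrable (lebesgue_on Q) (\<lambda>z. \<rho>Q z * (uQ z \<bullet> (JU z *v uQ z)))" (is ?t4)
    and "integrable (lebesgue_on Q) (\<lambda>z. p (\<rho>Q z) * trace (JU z))" (is ?t5)
    and "integrable (lebesgue_on Q) (\<lambda>z. stress \<mu> \<eta> (DuQ z) \<bullet> JU z)" (is ?t6)
    and "integrable (lebesgue_on Q) (\<lambda>z. (\<rho>Q z *\<^sub>R fQ z) \<bullet> \<psi>U z)" (is ?t7)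
    and "integrable (lebesgue_on Q) (\<lambda>z. stress \<mu> \<eta> (JU z) \<bullet> JU z)" (is ?t8)
    and "integrable (lebesgue_on Q) (\<lambda>z. stress \<mu> \<eta> (JU z) \<bullet> DuQ z)" (is ?t9)
    and "integrable (lebesgue_on Q) (\<lambda>z. deriv p (r\<psi> z) / (r\<psi> z) * (\<rho>Q z * time_deriv \<psi>r z
           + (\<rho>Q z *\<^sub>R uQ z) \<bullet> space_grad \<psi>r z))" (is ?t10)
    and "integrable (lebesgue_on Q) (\<lambda>z. p (r\<psi> z) * trace (JU z))" (is ?t11)
proof -
  obtain C where C: "C \<ge> 0"
    "\<And>t x. \<bar>time_deriv \<psi>r (t, x)\<bar> \<le> C * indicator K x"
    "\<And>t x. norm (space_grad \<psi>r (t, x)) \<le> C * indicator K x"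
    "\<And>t x. norm (\<psi>U (t, x)) \<le> C * indicator KU x"
    "\<And>t x. norm (time_deriv \<psi>U (t, x)) \<le> C * indicator KU x"
    "\<And>t x. norm (JU (t, x)) \<le> C * indicator KU x"
    by (rule test_bounds) blast
  obtain B where B: "B \<ge> 0"
    "\<And>t x. t \<in> {0..T} \<Longrightarrow> x \<in> \<Omega> \<Longrightarrow> \<bar>p (r\<psi> (t, x))\<bar> \<le> B"
    "\<And>t x. t \<in> {0..T} \<Longrightarrow> x \<in> \<Omega> \<Longrightarrow> \<bar>deriv p (r\<psi> (t, x)) / (r\<psi> (t, x))\<bar> \<le> B"
    by (rule pressure_bounds) blast
  obtain S where S: "S \<ge> 0" "\<And>A. norm (stress \<mu> \<eta> A) \<le> S * norm A" by (rule stress_bound) blast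
  obtain D where D: "D \<ge> 0" "\<And>A. \<bar>trace (A :: real^3^3)\<bar> \<le> D * norm A" by (rule trace_bound) blast
  let ?i = "\<lambda>z. indicat_real K (snd z)"
  have i: "0 \<le> ?i z" "?i z \<le> 1" for z :: "real \<times> (real^3)" by (auto simp: indicator_def)
  have KUK: "C * indicat_real KU x \<le> C * indicat_real K x" for x
    using C(1) by (auto simp: indicator_def K_def)
  have c: "\<bar>time_deriv \<psi>r z\<bar> \<le> C * ?i z" "norm (space_grad \<psi>r z) \<le> C * ?i z" "norm (\<psi>U z) \<le> C * ?i z"
    "norm (time_deriv \<psi>U z) \<le> C * ?i z" "norm (JU z) \<le> C * ?i z" for z
    using C(2,3) order_trans[OF C(4) KUK] order_trans[OF C(5) KUK] order_trans[OF C(6) KUK] by (cases z, simp)+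
  have C1: "C * ?i z \<le> C" for z :: "real \<times> (real^3)"
    using mult_left_mono[OF i(2) C(1)] by simp
  have c1: "norm (\<psi>U z) \<le> C" "norm (JU z) \<le> C" for z
    using order_trans[OF c(3) C1] order_trans[OF c(5) C1] by auto
  note [measurable] = borel_measurable_matrix_vector_mult
  have inner_le: "\<bar>a \<bullet> b\<bar> \<le> X * Y" if "norm a \<le> X" "norm b \<le> Y" for a b :: "real^3" and X Y
    using order_trans[OF Cauchy_Schwarz_ineq2 mult_mono[OF that]] order_trans[OF norm_ge_zero that(1)] by simp
  have inner_le': "\<bar>a \<bullet> b\<bar> \<le> X * Y" if "norm a \<le> X" "norm b \<le> Y" for a b :: "real^3^3" and X Y
    using order_trans[OF Cauchy_Schwarz_ineq2 mult_mono[OF that]] order_trans[OF norm_ge_zero that(1)] by simp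
  have mv_le: "\<bar>a \<bullet> (A *v b)\<bar> \<le> M * (X * norm b)" if "norm A \<le> M" "norm a \<le> X" for A and a b :: "real^3" and M X
    using order_trans[OF abs_inner_matrix_vector_le mult_mono[OF that(1) mult_right_mono[OF that(2)]]]
      order_trans[OF norm_ge_zero that(1)] by simp
  show ?t1
  proof (rule integrable_dominated[OF integrable_abs[OF integrable_density]])
    have "\<bar>\<rho>Q z * (\<psi>U z \<bullet> time_deriv \<psi>U z)\<bar> \<le> \<bar>\<rho>Q z\<bar> * (C * (C * ?i z))" for z
      using abs_mult_mono[OF order_refl inner_le[OF c1(1) c(4)]] .
    then show "AE z in lebesgue_on Q. \<bar>\<rho>Q z * (\<psi>U z \<bullet> time_deriv \<psi>U z)\<bar>
        \<le> C * C * \<bar>indicator K (snd z) * \<rho>Q z\<bar>"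
      using i by (intro AE_I2) (simp add: abs_mult mult_ac)
  qed measurable
  show ?t2
  proof (rule integrable_dominated[OF integrable_momentum])
    have "\<bar>(\<rho>Q z *\<^sub>R uQ z) \<bullet> time_deriv \<psi>U z\<bar> \<le> norm (\<rho>Q z *\<^sub>R uQ z) * (C * ?i z)" for z
      using inner_le[OF order_refl c(4)] .
    then show "AE z in lebesgue_on Q. \<bar>(\<rho>Q z *\<^sub>R uQ z) \<bullet> time_deriv \<psi>U z\<bar>
        \<le> C * (indicator K (snd z) * norm (\<rho>Q z *\<^sub>R uQ z))"
      by (intro AE_I2) (simp only: mult_ac)
  qed measurable
  show ?t3
  proof (rule integrable_dominated[OF integrable_momentum])
    have "\<bar>\<rho>Q z * (\<psi>U z \<bullet> (JU z *v uQ z))\<bar>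
        \<le> \<bar>\<rho>Q z\<bar> * (C * ?i z * (C * norm (uQ z)))" for z
      using abs_mult_mono[OF order_refl mv_le[OF c(5) c1(1)]] .
    then show "AE z in lebesgue_on Q. \<bar>\<rho>Q z * (\<psi>U z \<bullet> (JU z *v uQ z))\<bar>
        \<le> C * C * (indicator K (snd z) * norm (\<rho>Q z *\<^sub>R uQ z))"
      by (intro AE_I2) (simp only: norm_scaleR mult_ac)
  qed measurable
  show ?t4
  proof (rule integrable_dominated[OF integrable_abs[OF integrable_kinetic_energy]])
    have "\<bar>\<rho>Q z * (uQ z \<bullet> (JU z *v uQ z))\<bar>
        \<le> \<bar>\<rho>Q z\<bar> * (C * (norm (uQ z) * norm (uQ z)))" for z
      using abs_mult_mono[OF order_refl mv_le[OF c1(2) order_refl]] .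
    then show "AE z in lebesgue_on Q. \<bar>\<rho>Q z * (uQ z \<bullet> (JU z *v uQ z))\<bar>
        \<le> C * \<bar>\<rho>Q z * (norm (uQ z))\<^sup>2\<bar>"
      by (intro AE_I2) (simp add: abs_mult power2_eq_square mult_ac)
  qed measurable
  have tr: "\<bar>trace (JU z)\<bar> \<le> D * C" for z
    using order_trans[OF D(2) mult_left_mono[OF c1(2) D(1)]] .
  show ?t5
  proof (rule integrable_dominated[OF integrable_abs[OF integrable_pressure]])
    \<comment> \<open>Inserting the indicator of \<open>KU\<close>, off which the Jacobian of
      \<psi>U vanishes, reduces measurability and bound to
      \<open>integrable_pressure\<close>.\<close>
    have eq: "p (\<rho>Q z) * trace (JU z)
        = (indicator KU (snd z) * p (\<rho>Q z)) * trace (JU z)" for z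
      using not_in_KU(3)[of "snd z" "fst z"] by (cases "snd z \<in> KU") (auto simp: linear_0[OF linear_trace])
    show "(\<lambda>z. p (\<rho>Q z) * trace (JU z)) \<in> borel_measurable (lebesgue_on Q)"
      unfolding eq using borel_measurable_integrable[OF integrable_pressure] by measurable
    show "AE z in lebesgue_on Q. \<bar>p (\<rho>Q z) * trace (JU z)\<bar>
        \<le> D * C * \<bar>indicator KU (snd z) * p (\<rho>Q z)\<bar>"
      unfolding eq mult.commute[of "D * C"] by (intro AE_I2 abs_mult_mono[OF order_refl tr])
  qed
  have KG: "integrable (lebesgue_on Q) (\<lambda>z. ?i z + (norm (DuQ z))\<^sup>2)"
    using integrable_K integrable_gradient by simp
  \<comment> \<open>Rests on n \<le> 1 + n^2 at points above \<open>K\<close>; elsewhere the left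
    side is 0.\<close>
  have mixed: "n * (S * (C * ?i z)) \<le> S * C * (?i z + n\<^sup>2)" if "n \<ge> 0" for n and z :: "real \<times> (real^3)"
  proof -
    have "n * ?i z \<le> ?i z + n\<^sup>2"
      using sum_squares_bound[of n 1] that by (cases "snd z \<in> K") auto
    from mult_left_mono[OF this, of "S * C"] show ?thesis
      using S(1) C(1) by (simp add: mult_ac)
  qed
  show ?t6
  proof (rule integrable_dominated[OF KG])
    have "\<bar>stress \<mu> \<eta> (DuQ z) \<bullet> JU z\<bar> \<le> norm (DuQ z) * (S * (C * ?i z))" for z
      by (rule order_trans[OF inner_le'[OF S(2) c(5)]]) (simp add: mult_ac)
    from order_trans[OF this mixed[OF norm_ge_zero]]
    show "AE z in lebesgue_on Q. \<bar>stress \<mu> \<eta> (DuQ z) \<bullet> JU z\<bar>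
        \<le> S * C * (?i z + (norm (DuQ z))\<^sup>2)"
      by (rule AE_I2)
  qed measurable
  show ?t7
  proof (rule integrable_dominated[OF integrable_abs[OF integrable_force_density]])
    have "\<bar>(\<rho>Q z *\<^sub>R fQ z) \<bullet> \<psi>U z\<bar> \<le> norm (\<rho>Q z *\<^sub>R fQ z) * C" for z
      using inner_le[OF order_refl c1(1)] .
    then show "AE z in lebesgue_on Q. \<bar>(\<rho>Q z *\<^sub>R fQ z) \<bullet> \<psi>U z\<bar>
        \<le> C * \<bar>norm (fQ z) * \<rho>Q z\<bar>"
      by (intro AE_I2) (simp add: abs_mult mult_ac)
  qed measurable
  have SJ: "norm (stress \<mu> \<eta> (JU z)) \<le> S * (C * ?i z)" for z
    using order_trans[OF S(2) mult_left_mono[OF c(5) S(1)]] .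
  show ?t8
  proof (rule integrable_dominated[OF integrable_K])
    have "\<bar>stress \<mu> \<eta> (JU z) \<bullet> JU z\<bar> \<le> S * (C * ?i z) * C" for z
      using inner_le'[OF SJ c1(2)] .
    then show "AE z in lebesgue_on Q. \<bar>stress \<mu> \<eta> (JU z) \<bullet> JU z\<bar> \<le> S * C * C * ?i z"
      by (intro AE_I2) (simp only: mult_ac)
  qed measurable
  show ?t9
  proof (rule integrable_dominated[OF KG])
    have "\<bar>stress \<mu> \<eta> (JU z) \<bullet> DuQ z\<bar> \<le> norm (DuQ z) * (S * (C * ?i z))" for z
      by (rule order_trans[OF inner_le'[OF SJ order_refl]]) (simp add: mult_ac)
    from order_trans[OF this mixed[OF norm_ge_zero]]
    show "AE z in lebesgue_on Q. \<bar>stress \<mu> \<eta> (JU z) \<bullet> DuQ z\<bar>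
        \<le> S * C * (?i z + (norm (DuQ z))\<^sup>2)"
      by (rule AE_I2)
  qed measurable
  have kc: "continuous_on {0<..} (\<lambda>s. deriv p s / s)"
    by (intro continuous_intros continuous_deriv_p) auto
  have pc: "continuous_on {0<..} p" using p_cont by (rule continuous_on_subset) auto
  show ?t10
  proof (rule integrable_dominated[OF Bochner_Integration.integrable_add[OF integrable_abs[OF integrable_density] integrable_momentum]])
    let ?q = "\<lambda>z. \<rho>Q z * time_deriv \<psi>r z + (\<rho>Q z *\<^sub>R uQ z) \<bullet> space_grad \<psi>r z"
    let ?w = "\<lambda>z. \<bar>?i z * \<rho>Q z\<bar> + ?i z * norm (\<rho>Q z *\<^sub>R uQ z)"
    have "?q \<in> borel_measurable (lebesgue_on Q)" by measurable
    with r_compose_meas(2)[OF kc]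
    show "(\<lambda>z. deriv p (r\<psi> z) / (r\<psi> z) * ?q z) \<in> borel_measurable (lebesgue_on Q)"
      by (rule borel_measurable_times)
    have q: "\<bar>?q z\<bar> \<le> C * ?w z" for z
    proof -
      have "\<bar>\<rho>Q z * time_deriv \<psi>r z\<bar> \<le> \<bar>\<rho>Q z\<bar> * (C * ?i z)"
        using abs_mult_mono[OF order_refl c(1)] .
      moreover have "\<bar>\<rho>Q z\<bar> * (C * ?i z) = C * \<bar>?i z * \<rho>Q z\<bar>"
        using i by (simp add: abs_mult)
      moreover have "\<bar>(\<rho>Q z *\<^sub>R uQ z) \<bullet> space_grad \<psi>r z\<bar>
          \<le> norm (\<rho>Q z *\<^sub>R uQ z) * (C * ?i z)"
        using inner_le[OF order_refl c(2)] .
      moreover have "norm (\<rho>Q z *\<^sub>R uQ z) * (C * ?i z) = C * (?i z * norm (\<rho>Q z *\<^sub>R uQ z))"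
        by (simp only: mult_ac)
      ultimately show ?thesis unfolding distrib_left by linarith
    qed
    show "AE z in lebesgue_on Q. \<bar>deriv p (r\<psi> z) / (r\<psi> z) * ?q z\<bar> \<le> B * C * ?w z"
    proof (rule AE_I2)
      fix z assume "z \<in> space (lebesgue_on Q)"
      then have "\<bar>deriv p (r\<psi> z) / (r\<psi> z)\<bar> \<le> B"
        using B(3)[of "fst z" "snd z"] by auto
      from abs_mult_mono[OF this q]
      show "\<bar>deriv p (r\<psi> z) / (r\<psi> z) * ?q z\<bar> \<le> B * C * ?w z"
        by (simp only: mult.assoc)
    qed
  qed
  show ?t11
  proof (rule integrable_dominated[OF integrable_K])
    show "(\<lambda>z. p (r\<psi> z) * trace (JU z)) \<in> borel_measurable (lebesgue_on Q)"
      using r_compose_meas(2)[OF pc] by measurable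
    show "AE z in lebesgue_on Q. \<bar>p (r\<psi> z) * trace (JU z)\<bar> \<le> B * (D * C) * ?i z"
    proof (rule AE_I2)
      fix z assume "z \<in> space (lebesgue_on Q)"
      then have "\<bar>p (r\<psi> z)\<bar> \<le> B" using B(2)[of "fst z" "snd z"] by auto
      moreover have "\<bar>trace (JU z)\<bar> \<le> D * (C * ?i z)"
        using order_trans[OF D(2) mult_left_mono[OF c(5) D(1)]] .
      ultimately show "\<bar>p (r\<psi> z) * trace (JU z)\<bar> \<le> B * (D * C) * ?i z"
        using abs_mult_mono by (fastforce simp: mult.assoc)
    qed
  qed
qed

section \<open>U and H'(r) in terms of the smooth extensions\<close>

lemma r_eq_\<Omega>: "t \<in> {0..T} \<Longrightarrow> x \<in> \<Omega> \<Longrightarrow> r t x = r\<psi> (t, x)"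
  using r_eq \<Omega>_subset_closure by blast

lemma r_pos_\<Omega>: "t \<in> {0..T} \<Longrightarrow> x \<in> \<Omega> \<Longrightarrow> 0 < r\<psi> (t, x)"
  using r_pos r_eq \<Omega>_subset_closure by metis

text \<open>Both derivatives are two-sided, so U and \<psi>U have to agree in a neighbourhood; this
  restricts t to the open interval and uses that \<Omega> is open.\<close>

lemma U_derivatives:
  assumes t: "t \<in> {0<..<T}" and x: "x \<in> \<Omega>"
  shows "dt U t x = time_deriv \<psi>U (t, x)" "vgrad (U t) x = JU (t, x)"
proof -
  have "((\<lambda>s. U s x) has_vector_derivative time_deriv \<psi>U (t, x)) (at t)"
    by (rule has_vector_derivative_transform_within_open[OF has_derivative_partial(1)[OF \<psi>U(1)], of "{0<..<T}"])
       (use t x U_eq in auto)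
  then show "dt U t x = time_deriv \<psi>U (t, x)"
    unfolding dt_def by (rule vector_derivative_at)
  have "(U t has_derivative (\<lambda>v. frechet_derivative \<psi>U (at (t, x)) (0, v))) (at x)"
    by (rule has_derivative_transform_within_open[OF has_derivative_partial(2)[OF \<psi>U(1)] open_\<Omega> x])
       (use t U_eq in auto)
  from frechet_derivative_at[OF this] show "vgrad (U t) x = JU (t, x)"
    by (simp add: vgrad_def jacobian_def matrix_def space_jacobian_def fun_eq_iff)
qed

lemma dH_r_derivatives:
  assumes t: "t \<in> {0<..<T}" and x: "x \<in> \<Omega>"
  defines "k \<equiv> deriv p (r\<psi> (t, x)) / (r\<psi> (t, x))"
  shows "dt (\<lambda>s y. dH p \<rho>b (r s y)) t x = k * time_deriv \<psi>r (t, x)"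
    and "grad (\<lambda>y. dH p \<rho>b (r t y)) x = k *\<^sub>R space_grad \<psi>r (t, x)"
proof -
  have tT: "t \<in> {0..T}" using t by simp
  have k: "(dH p \<rho>b has_real_derivative k) (at (r\<psi> (t, x)))"
    unfolding k_def by (rule dH_deriv[OF r_pos_\<Omega>[OF tT x]])
  have "((\<lambda>s. r\<psi> (s, x)) has_real_derivative time_deriv \<psi>r (t, x)) (at t)"
    using has_derivative_partial(1)[OF \<psi>r(1), of x t UNIV]
    by (auto simp: has_real_derivative_iff_has_vector_derivative[symmetric] intro!: derivative_eq_intros)
  from DERIV_chain2[OF k this]
  have "((\<lambda>s. dH p \<rho>b (r\<psi> (s, x))) has_vector_derivative k * time_deriv \<psi>r (t, x)) (at t)"
    by (simp add: has_real_derivative_iff_has_vector_derivative)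
  then have "((\<lambda>s. dH p \<rho>b (r s x)) has_vector_derivative k * time_deriv \<psi>r (t, x)) (at t)"
    by (rule has_vector_derivative_transform_within_open[of _ _ _ "{0<..<T}"]) (use t x r_eq_\<Omega> in auto)
  then show "dt (\<lambda>s y. dH p \<rho>b (r s y)) t x = k * time_deriv \<psi>r (t, x)"
    unfolding dt_def by (rule vector_derivative_at)
  have "((\<lambda>y. r\<psi> (t, y)) has_derivative (\<lambda>v. frechet_derivative \<psi>r (at (t, x)) (0, v))) (at x)"
    using has_derivative_add[OF has_derivative_const has_derivative_partial(2)[OF \<psi>r(1), of t x], of \<rho>b] by simp
  from has_derivative_compose[OF this k[unfolded has_field_derivative_def]]
  have "((\<lambda>y. dH p \<rho>b (r t y)) has_derivative (\<lambda>v. k * frechet_derivative \<psi>r (at (t, x)) (0, v))) (at x)"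
    by (rule has_derivative_transform_within_open[OF _ open_\<Omega> x]) (use tT r_eq_\<Omega> in auto)
  from frechet_derivative_at[OF this]
  show "grad (\<lambda>y. dH p \<rho>b (r t y)) x = k *\<^sub>R space_grad \<psi>r (t, x)"
    by (simp add: grad_def space_grad_def fun_eq_iff vec_eq_iff)
qed

text \<open>The dissipation, the remainder and the tested equations are linear combinations of the following
  densities, which reduces the final step to linear arithmetic.\<close>

abbreviation (input) "T1 \<equiv> \<lambda>z. \<rho>Q z * (\<psi>U z \<bullet> time_deriv \<psi>U z)"
abbreviation (input) "T2 \<equiv> \<lambda>z. (\<rho>Q z *\<^sub>R uQ z) \<bullet> time_deriv \<psi>U z"
abbreviation (input) "T3 \<equiv> \<lambda>z. \<rho>Q z * (\<psi>U z \<bullet> (JU z *v uQ z))"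
abbreviation (input) "T4 \<equiv> \<lambda>z. \<rho>Q z * (uQ z \<bullet> (JU z *v uQ z))"
abbreviation (input) "T5 \<equiv> \<lambda>z. p (\<rho>Q z) * trace (JU z)"
abbreviation (input) "T6 \<equiv> \<lambda>z. stress \<mu> \<eta> (DuQ z) \<bullet> JU z"
abbreviation (input) "T7 \<equiv> \<lambda>z. (\<rho>Q z *\<^sub>R fQ z) \<bullet> \<psi>U z"
abbreviation (input) "T8 \<equiv> \<lambda>z. stress \<mu> \<eta> (JU z) \<bullet> JU z"
abbreviation (input) "T9 \<equiv> \<lambda>z. stress \<mu> \<eta> (JU z) \<bullet> DuQ z"
abbreviation (input) "T10 \<equiv> \<lambda>z. deriv p (r\<psi> z) / (r\<psi> z) * (\<rho>Q z * time_deriv \<psi>r z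
           + (\<rho>Q z *\<^sub>R uQ z) \<bullet> space_grad \<psi>r z)"
abbreviation (input) "T11 \<equiv> \<lambda>z. p (r\<psi> z) * trace (JU z)"
abbreviation (input) "T12 \<equiv> \<lambda>z. deriv p (r\<psi> z) * time_deriv \<psi>r z"
abbreviation (input) "T13 \<equiv> \<lambda>z. deriv p (r\<psi> z) * (space_grad \<psi>r z \<bullet> \<psi>U z)"
abbreviation (input) "T14 \<equiv> \<lambda>z. stress \<mu> \<eta> (DuQ z) \<bullet> DuQ z"
abbreviation (input) "T15 \<equiv> \<lambda>z. (\<rho>Q z *\<^sub>R fQ z) \<bullet> uQ z"

lemma integrable_terms:
  "integrable (lebesgue_on Q) T1" "integrable (lebesgue_on Q) T2"
  "integrable (lebesgue_on Q) T3" "integrable (lebesgue_on Q) T4"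
  "integrable (lebesgue_on Q) T5" "integrable (lebesgue_on Q) T6"
  "integrable (lebesgue_on Q) T7" "integrable (lebesgue_on Q) T8"
  "integrable (lebesgue_on Q) T9" "integrable (lebesgue_on Q) T10"
  "integrable (lebesgue_on Q) T11" "integrable (lebesgue_on Q) T12"
  "integrable (lebesgue_on Q) T13" "integrable (lebesgue_on Q) T14"
  "integrable (lebesgue_on Q) T15"
proof -
  \<comment> \<open>The integrability claims taken from the two lemmas do not involve \<tau>; any
    interior time discharges their assumption.\<close>
  have half: "T / 2 \<in> {0<..<T}" using T_pos by simp
  show "integrable (lebesgue_on Q) T12"
    using time_integral_pressure(2)[OF half] by blast
  show "integrable (lebesgue_on Q) T13"
    using Bochner_Integration.integrable_diff[OF space_time_integral_pressure_flux(1)[OF half] integrable_test_terms(11)] by simp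
qed (rule integrable_test_terms integrable_dissipation integrable_power_of_force)+

text \<open>The convective part expands into four products. In the density part r H''(r) = p'(r)
  turns the contributions without \<rho> into the time derivative of p(r) and its gradient tested
  with U, that is T12 and T13.\<close>

lemma remainder_terms:
  assumes "z \<in> Q"
  shows "R_convective \<rho> u U (fst z) (snd z) = T1 z - T2 z + T3 z - T4 z"
    and "R_viscous \<mu> \<eta> Du U (fst z) (snd z) = T8 z - T9 z"
    and "R_force f \<rho> u U (fst z) (snd z) = T15 z - T7 z"
    and "R_density p \<rho>b \<rho> u r U (fst z) (snd z) = T12 z + T13 z - T10 z"
    and "R_pressure p \<rho> r U (fst z) (snd z) = T5 z - T11 z"
    and "(stress \<mu> \<eta> (DuQ z) - stress \<mu> \<eta> (vgrad (U (fst z)) (snd z)))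
        \<bullet> (DuQ z - vgrad (U (fst z)) (snd z)) = T14 z - T6 z - T9 z + T8 z"
proof -
  obtain t x where z: "z = (t, x)" "t \<in> {0<..<T}" "x \<in> \<Omega>" using assms by (cases z) auto
  have tT: "t \<in> {0..T}" using z by simp
  note eqs = U_derivatives[OF z(2,3)] U_eq[OF tT z(3)] r_eq_\<Omega>[OF tT z(3)]
  show "R_convective \<rho> u U (fst z) (snd z) = T1 z - T2 z + T3 z - T4 z"
    by (simp add: R_convective_def z eqs inner_diff_right inner_diff_left inner_add_left inner_add_right
      inner_commute[of "JU (t, x) *v u t x"] inner_commute[of "time_deriv \<psi>U (t, x)"] algebra_simps)
  show "R_viscous \<mu> \<eta> Du U (fst z) (snd z) = T8 z - T9 z"
    by (simp add: R_viscous_def z eqs inner_diff_right)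
  show "R_force f \<rho> u U (fst z) (snd z) = T15 z - T7 z"
    by (simp add: R_force_def z eqs inner_diff_right algebra_simps)
  show "R_pressure p \<rho> r U (fst z) (snd z) = T5 z - T11 z"
    by (simp add: R_pressure_def z eqs algebra_simps)
  show "(stress \<mu> \<eta> (DuQ z) - stress \<mu> \<eta> (vgrad (U (fst z)) (snd z)))
        \<bullet> (DuQ z - vgrad (U (fst z)) (snd z)) = T14 z - T6 z - T9 z + T8 z"
    by (simp add: z eqs inner_diff_right inner_diff_left)
  let ?r = "r\<psi> (t, x)"
  \<comment> \<open>\<open>k\<close> is H''(r); writing p'(r) as k r keeps divisions out of the
    algebra.\<close>
  define k where "k = deriv p ?r / ?r"
  have "?r > 0" by (rule r_pos_\<Omega>[OF tT z(3)])
  then have k: "deriv p ?r = k * ?r" by (simp add: k_def)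
  have "R_density p \<rho>b \<rho> u r U t x = (?r - \<rho> t x) * (k * time_deriv \<psi>r (t, x))
      + (k *\<^sub>R space_grad \<psi>r (t, x)) \<bullet> (?r *\<^sub>R \<psi>U (t, x) - \<rho> t x *\<^sub>R u t x)"
    by (simp add: R_density_def eqs dH_r_derivatives[OF z(2,3)] k_def)
  also have "\<dots> = k * ?r * time_deriv \<psi>r (t, x) + k * ?r * (space_grad \<psi>r (t, x) \<bullet> \<psi>U (t, x))
      - k * (\<rho> t x * time_deriv \<psi>r (t, x) + (\<rho> t x *\<^sub>R u t x) \<bullet> space_grad \<psi>r (t, x))"
    by (simp add: inner_diff_right inner_commute[of "u t x"] algebra_simps)
  finally show "R_density p \<rho>b \<rho> u r U (fst z) (snd z) = T12 z + T13 z - T10 z"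
    using \<open>?r > 0\<close> by (simp add: z k_def)
qed

lemma remainder_integrable_Q:
  shows "integrable (lebesgue_on Q) (\<lambda>z. R_convective \<rho> u U (fst z) (snd z))"
    and "integrable (lebesgue_on Q) (\<lambda>z. R_viscous \<mu> \<eta> Du U (fst z) (snd z))"
    and "integrable (lebesgue_on Q) (\<lambda>z. R_force f \<rho> u U (fst z) (snd z))"
    and "integrable (lebesgue_on Q) (\<lambda>z. R_density p \<rho>b \<rho> u r U (fst z) (snd z))"
    and "integrable (lebesgue_on Q) (\<lambda>z. R_pressure p \<rho> r U (fst z) (snd z))"
    and "integrable (lebesgue_on Q) (\<lambda>z. (stress \<mu> \<eta> (DuQ z) - stress \<mu> \<eta> (vgrad (U (fst z)) (snd z)))
        \<bullet> (DuQ z - vgrad (U (fst z)) (snd z)))"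
proof -
  have cong: "integrable (lebesgue_on Q) g" if "integrable (lebesgue_on Q) h" "\<And>z. z \<in> Q \<Longrightarrow> g z = h z" for g h :: "_ \<Rightarrow> real"
    using that Bochner_Integration.integrable_cong[of "lebesgue_on Q" "lebesgue_on Q" g h] by simp
  note I = Bochner_Integration.integrable_add Bochner_Integration.integrable_diff integrable_terms
  show "integrable (lebesgue_on Q) (\<lambda>z. R_convective \<rho> u U (fst z) (snd z))"
    by (rule cong[OF _ remainder_terms(1)]) (intro I)
  show "integrable (lebesgue_on Q) (\<lambda>z. R_viscous \<mu> \<eta> Du U (fst z) (snd z))"
    by (rule cong[OF _ remainder_terms(2)]) (intro I)
  show "integrable (lebesgue_on Q) (\<lambda>z. R_force f \<rho> u U (fst z) (snd z))"
    by (rule cong[OF _ remainder_terms(3)]) (intro I)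
  show "integrable (lebesgue_on Q) (\<lambda>z. R_density p \<rho>b \<rho> u r U (fst z) (snd z))"
    by (rule cong[OF _ remainder_terms(4)]) (intro I)
  show "integrable (lebesgue_on Q) (\<lambda>z. R_pressure p \<rho> r U (fst z) (snd z))"
    by (rule cong[OF _ remainder_terms(5)]) (intro I)
  show "integrable (lebesgue_on Q) (\<lambda>z. (stress \<mu> \<eta> (DuQ z) - stress \<mu> \<eta> (vgrad (U (fst z)) (snd z)))
        \<bullet> (DuQ z - vgrad (U (fst z)) (snd z)))"
    by (rule cong[OF _ remainder_terms(6)]) (intro I)
qed

lemma remainder_integrable: "remainder_integrable \<mu> \<eta> p \<rho>b f T \<Omega> \<rho> u Du r U"
proof -
  note F = remainder_integrable_Q(1-5)[THEN lebesgue_on_Q_Fubini(1), unfolded fst_conv snd_conv]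
  have "AE t in lebesgue_on {0<..<T}.
        integrable \<nu> (R_convective \<rho> u U t) \<and>
        integrable \<nu> (R_viscous \<mu> \<eta> Du U t) \<and>
        integrable \<nu> (R_force f \<rho> u U t) \<and>
        integrable \<nu> (R_density p \<rho>b \<rho> u r U t) \<and>
        integrable \<nu> (R_pressure p \<rho> r U t)"
    using F by eventually_elim blast
  moreover have "integrable (lebesgue_on {0<..<T}) (remainder \<mu> \<eta> p \<rho>b f \<Omega> \<rho> u Du r U)"
    unfolding remainder_def[abs_def]
    by (intro Bochner_Integration.integrable_add Bochner_Integration.integrable_diff
        remainder_integrable_Q(1-5)[THEN lebesgue_on_Q_Fubini(2), unfolded fst_conv snd_conv])
  ultimately show ?thesis by (simp add: remainder_integrable_def)
qed

lemma integral_remainder: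
  assumes \<tau>: "\<tau> \<in> {0<..<T}"
  defines "I \<equiv> \<lambda>g. LINT z|lebesgue_on (Q\<tau> \<tau>). g z"
  shows "(LINT t|lebesgue_on {0<..<\<tau>}. remainder \<mu> \<eta> p \<rho>b f \<Omega> \<rho> u Du r U t)
    = (I T1 - I T2 + I T3 - I T4) + (I T8 - I T9)
      + (I T15 - I T7) + (I T12 + I T13 - I T10)
      - (I T5 - I T11)"
    and "(LINT z|lebesgue_on (Q\<tau> \<tau>). (stress \<mu> \<eta> (DuQ z) - stress \<mu> \<eta> (vgrad (U (fst z)) (snd z)))
        \<bullet> (DuQ z - vgrad (U (fst z)) (snd z)))
      = I T14 - I T6 - I T9 + I T8"
proof -
  have \<tau>T: "\<tau> \<le> T" using \<tau> by simp
  have s: "{0<..<\<tau>} \<in> sets borel" by simp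
  note i = integrable_terms[THEN integrable_Q\<tau>[OF _ \<tau>T]]
  note R = remainder_integrable_Q(1-5)[THEN integrable_Q\<tau>[OF _ \<tau>T]]
  note R2 = R[THEN lebesgue_on_Fubini(2)[OF s sets_borel(2)], unfolded fst_conv snd_conv]
  note R3 = R[THEN lebesgue_on_Fubini(3)[OF s sets_borel(2)], unfolded fst_conv snd_conv]
  have Q: "z \<in> Q" if "z \<in> space (lebesgue_on (Q\<tau> \<tau>))" for z
    using that Q\<tau>_subset(1)[OF \<tau>T] by auto
  note lin = integral_eq_linear_combination
  have R1: "(LINT z|lebesgue_on (Q\<tau> \<tau>). R_convective \<rho> u U (fst z) (snd z))
      = I T1 - I T2 + I T3 - I T4"
    unfolding I_def using remainder_terms(1)[OF Q]
    by (subst lin[OF i(1-4), where \<alpha> = 1 and \<beta> = "-1" and \<gamma> = 1 and \<delta> = "-1"]) auto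
  have R2': "(LINT z|lebesgue_on (Q\<tau> \<tau>). R_viscous \<mu> \<eta> Du U (fst z) (snd z)) = I T8 - I T9"
    unfolding I_def using remainder_terms(2)[OF Q]
    by (subst lin[OF i(8,9,9,9), where \<alpha> = 1 and \<beta> = "-1" and \<gamma> = 0 and \<delta> = 0]) auto
  have R3': "(LINT z|lebesgue_on (Q\<tau> \<tau>). R_force f \<rho> u U (fst z) (snd z)) = I T15 - I T7"
    unfolding I_def using remainder_terms(3)[OF Q]
    by (subst lin[OF i(15,7,7,7), where \<alpha> = 1 and \<beta> = "-1" and \<gamma> = 0 and \<delta> = 0]) auto
  have R4': "(LINT z|lebesgue_on (Q\<tau> \<tau>). R_density p \<rho>b \<rho> u r U (fst z) (snd z))
      = I T12 + I T13 - I T10"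
    unfolding I_def using remainder_terms(4)[OF Q]
    by (subst lin[OF i(12,13,10,10), where \<alpha> = 1 and \<beta> = 1 and \<gamma> = "-1" and \<delta> = 0]) auto
  have R5': "(LINT z|lebesgue_on (Q\<tau> \<tau>). R_pressure p \<rho> r U (fst z) (snd z)) = I T5 - I T11"
    unfolding I_def using remainder_terms(5)[OF Q]
    by (subst lin[OF i(5,11,11,11), where \<alpha> = 1 and \<beta> = "-1" and \<gamma> = 0 and \<delta> = 0]) auto
  have "(LINT t|lebesgue_on {0<..<\<tau>}. remainder \<mu> \<eta> p \<rho>b f \<Omega> \<rho> u Du r U t)
    = (LINT t|lebesgue_on {0<..<\<tau>}. LINT x|\<nu>. R_convective \<rho> u U t x)
    + (LINT t|lebesgue_on {0<..<\<tau>}. LINT x|\<nu>. R_viscous \<mu> \<eta> Du U t x)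
    + (LINT t|lebesgue_on {0<..<\<tau>}. LINT x|\<nu>. R_force f \<rho> u U t x)
    + (LINT t|lebesgue_on {0<..<\<tau>}. LINT x|\<nu>. R_density p \<rho>b \<rho> u r U t x)
    - (LINT t|lebesgue_on {0<..<\<tau>}. LINT x|\<nu>. R_pressure p \<rho> r U t x)"
    unfolding remainder_def using R2 by simp
  then show "(LINT t|lebesgue_on {0<..<\<tau>}. remainder \<mu> \<eta> p \<rho>b f \<Omega> \<rho> u Du r U t)
    = (I T1 - I T2 + I T3 - I T4) + (I T8 - I T9)
      + (I T15 - I T7) + (I T12 + I T13 - I T10)
      - (I T5 - I T11)"
    unfolding R3 R1 R2' R3' R4' R5' .
  show "(LINT z|lebesgue_on (Q\<tau> \<tau>). (stress \<mu> \<eta> (DuQ z) - stress \<mu> \<eta> (vgrad (U (fst z)) (snd z)))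
        \<bullet> (DuQ z - vgrad (U (fst z)) (snd z)))
      = I T14 - I T6 - I T9 + I T8"
    unfolding I_def using remainder_terms(6)[OF Q]
    by (subst lin[OF i(14,6,9,8), where \<alpha> = 1 and \<beta> = "-1" and \<gamma> = "-1" and \<delta> = 1]) auto
qed

text \<open>Expanding the square and using r H'(r) - H(r) = p(r) leaves the energy density, three
  terms with a factor vanishing off \<open>K\<close>, and p(r) minus its far-field value. Each group
  is integrable by itself.\<close>

lemma rel_energy_density_eq:
  assumes t: "t \<in> {0..T}" and x: "x \<in> \<Omega>"
  shows "rel_energy_density p \<rho>b \<sigma> v (r t) (U t) x
    = energy_density p \<rho>b \<sigma> v x - (\<sigma> x *\<^sub>R v x) \<bullet> \<psi>U (t, x) + \<sigma> x * (1/2 * (norm (\<psi>U (t, x)))\<^sup>2)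
      - \<sigma> x * (dH p \<rho>b (r\<psi> (t, x)) - dH p \<rho>b \<rho>b)
      + (p (r\<psi> (t, x)) - (\<rho>b * dH p \<rho>b \<rho>b - H p \<rho>b \<rho>b))"
proof -
  have norm_eq: "(norm (v x - \<psi>U (t, x)))\<^sup>2 = (norm (v x))\<^sup>2 - 2 * (v x \<bullet> \<psi>U (t, x)) + (norm (\<psi>U (t, x)))\<^sup>2"
    by (simp add: power2_norm_eq_inner inner_diff_left inner_diff_right inner_commute)
  show ?thesis
    unfolding rel_energy_density_def energy_density_def U_eq[OF t x] r_eq_\<Omega>[OF t x] norm_eq
      pressure_eq[OF r_pos_\<Omega>[OF t x], symmetric]
    by (simp add: field_simps)
qed

lemma rel_energy_terms:
  assumes t: "t \<in> {0..T}" and \<sigma>: "\<sigma> \<in> borel_measurable \<nu>" and v: "v \<in> borel_measurable \<nu>"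
    and \<sigma>K: "integrable \<nu> (\<lambda>x. indicator K x * \<sigma> x)"
    and vK: "integrable \<nu> (\<lambda>x. indicator K x * norm (\<sigma> x *\<^sub>R v x))"
  shows "integrable \<nu> (\<lambda>x. (\<sigma> x *\<^sub>R v x) \<bullet> \<psi>U (t, x))"
    and "integrable \<nu> (\<lambda>x. \<sigma> x * (1/2 * (norm (\<psi>U (t, x)))\<^sup>2))"
    and "integrable \<nu> (\<lambda>x. \<sigma> x * (dH p \<rho>b (r\<psi> (t, x)) - dH p \<rho>b \<rho>b))"
proof -
  note [measurable] = \<sigma> v space_meas[OF test_continuous(4), of t]
  obtain C where C: "C \<ge> 0" "\<And>t x. norm (\<psi>U (t, x)) \<le> C * indicator KU x"
    by (rule test_bounds) blast
  obtain B where B: "B \<ge> 0"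
    "\<And>t x. t \<in> {0..T} \<Longrightarrow> x \<in> \<Omega> \<Longrightarrow> \<bar>dH p \<rho>b (r\<psi> (t, x))\<bar> \<le> B"
    by (rule pressure_bounds) blast
  have c: "norm (\<psi>U (t, x)) \<le> C * indicator K x" for x
    using C(1) order_trans[OF C(2)[of t x]] by (auto simp: indicator_def K_def)
  have dHc: "continuous_on {0<..} (\<lambda>s. dH p \<rho>b s - dH p \<rho>b \<rho>b)"
    using dH_deriv by (intro continuous_intros continuous_at_imp_continuous_on) (auto dest: DERIV_isCont)
  show "integrable \<nu> (\<lambda>x. (\<sigma> x *\<^sub>R v x) \<bullet> \<psi>U (t, x))"
  proof (rule integrable_dominated[OF vK])
    have "\<bar>(\<sigma> x *\<^sub>R v x) \<bullet> \<psi>U (t, x)\<bar> \<le> norm (\<sigma> x *\<^sub>R v x) * (C * indicator K x)" for x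
      using order_trans[OF Cauchy_Schwarz_ineq2 mult_left_mono[OF c norm_ge_zero]] .
    then show "AE x in \<nu>. \<bar>(\<sigma> x *\<^sub>R v x) \<bullet> \<psi>U (t, x)\<bar> \<le> C * (indicator K x * norm (\<sigma> x *\<^sub>R v x))"
      by (intro AE_I2) (simp only: mult_ac)
  qed measurable
  show "integrable \<nu> (\<lambda>x. \<sigma> x * (1/2 * (norm (\<psi>U (t, x)))\<^sup>2))"
  proof (rule integrable_dominated[OF integrable_abs[OF \<sigma>K]])
    have "\<bar>1/2 * (norm (\<psi>U (t, x)))\<^sup>2\<bar> \<le> C\<^sup>2 * indicator K x" for x
    proof -
      have "(norm (\<psi>U (t, x)))\<^sup>2 \<le> C\<^sup>2 * indicator K x"
        using power_mono[OF c norm_ge_zero, of x 2] by (cases "x \<in> K") auto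
      then show ?thesis by (rule order_trans[rotated]) simp
    qed
    from abs_mult_mono[OF order_refl this, of "\<sigma> _"]
    have "\<bar>\<sigma> x * (1/2 * (norm (\<psi>U (t, x)))\<^sup>2)\<bar> \<le> \<bar>\<sigma> x\<bar> * (C\<^sup>2 * indicator K x)" for x .
    then show "AE x in \<nu>. \<bar>\<sigma> x * (1/2 * (norm (\<psi>U (t, x)))\<^sup>2)\<bar> \<le> C\<^sup>2 * \<bar>indicator K x * \<sigma> x\<bar>"
      by (intro AE_I2) (simp add: abs_mult mult_ac)
  qed measurable
  show "integrable \<nu> (\<lambda>x. \<sigma> x * (dH p \<rho>b (r\<psi> (t, x)) - dH p \<rho>b \<rho>b))"
  proof (rule integrable_dominated[OF integrable_abs[OF \<sigma>K]])
    show "(\<lambda>x. \<sigma> x * (dH p \<rho>b (r\<psi> (t, x)) - dH p \<rho>b \<rho>b)) \<in> borel_measurable \<nu>"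
      using \<sigma> r_compose_meas(1)[OF dHc t] by (rule borel_measurable_times)
    show "AE x in \<nu>. \<bar>\<sigma> x * (dH p \<rho>b (r\<psi> (t, x)) - dH p \<rho>b \<rho>b)\<bar>
        \<le> (B + \<bar>dH p \<rho>b \<rho>b\<bar>) * \<bar>indicator K x * \<sigma> x\<bar>"
    proof (rule AE_I2)
      fix x assume "x \<in> space \<nu>"
      then have x: "x \<in> \<Omega>" by simp
      have "\<bar>dH p \<rho>b (r\<psi> (t, x)) - dH p \<rho>b \<rho>b\<bar> \<le> (B + \<bar>dH p \<rho>b \<rho>b\<bar>) * indicator K x"
        using B(2)[OF t x] not_in_K(1)[of x t] by (cases "x \<in> K") auto
      from abs_mult_mono[OF order_refl this, of "\<sigma> x"]
      show "\<bar>\<sigma> x * (dH p \<rho>b (r\<psi> (t, x)) - dH p \<rho>b \<rho>b)\<bar> \<le> (B + \<bar>dH p \<rho>b \<rho>b\<bar>) * \<bar>indicator K x * \<sigma> x\<bar>"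
        by (simp add: abs_mult mult_ac)
    qed
  qed
qed

text \<open>The far-field constant is written through H and H' because it arises in this form from
  the energy density, and \<open>pressure_eq\<close> covers positive arguments only.\<close>

lemma far_field_pressure: "\<rho>b > 0 \<Longrightarrow> p \<rho>b = \<rho>b * dH p \<rho>b \<rho>b - H p \<rho>b \<rho>b"
  by (rule pressure_eq[symmetric])

text \<open>Stated for general \<open>\<sigma>\<close> and \<open>v\<close> so as to cover both the
  solution at time \<tau> and the initial data at time 0.\<close>

lemma rel_energy_eq:
  assumes t: "t \<in> {0..T}" and \<sigma>: "\<sigma> \<in> borel_measurable \<nu>" and v: "v \<in> borel_measurable \<nu>"
    and \<sigma>K: "integrable \<nu> (\<lambda>x. indicator K x * \<sigma> x)"
    and vK: "integrable \<nu> (\<lambda>x. indicator K x * norm (\<sigma> x *\<^sub>R v x))"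
    and E: "integrable \<nu> (energy_density p \<rho>b \<sigma> v)"
  shows "integrable \<nu> (rel_energy_density p \<rho>b \<sigma> v (r t) (U t))"
    and "rel_energy \<Omega> p \<rho>b \<sigma> v (r t) (U t)
      = (LINT x|\<nu>. energy_density p \<rho>b \<sigma> v x)
        - (LINT x|\<nu>. (\<sigma> x *\<^sub>R v x) \<bullet> \<psi>U (t, x))
        + (LINT x|\<nu>. \<sigma> x * (1/2 * (norm (\<psi>U (t, x)))\<^sup>2))
        - (LINT x|\<nu>. \<sigma> x * (dH p \<rho>b (r\<psi> (t, x)) - dH p \<rho>b \<rho>b))
        + (LINT x|\<nu>. p (r\<psi> (t, x)) - (\<rho>b * dH p \<rho>b \<rho>b - H p \<rho>b \<rho>b))"
proof -
  have half: "T / 2 \<in> {0<..<T}" using T_pos by simp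
  note i = E rel_energy_terms[OF t \<sigma> v \<sigma>K vK] time_integral_pressure(1)[OF half far_field_pressure t]
  let ?g = "\<lambda>x. energy_density p \<rho>b \<sigma> v x - (\<sigma> x *\<^sub>R v x) \<bullet> \<psi>U (t, x) + \<sigma> x * (1/2 * (norm (\<psi>U (t, x)))\<^sup>2)
      - \<sigma> x * (dH p \<rho>b (r\<psi> (t, x)) - dH p \<rho>b \<rho>b)"
  let ?h = "\<lambda>x. p (r\<psi> (t, x)) - (\<rho>b * dH p \<rho>b \<rho>b - H p \<rho>b \<rho>b)"
  have eq: "x \<in> space \<nu> \<Longrightarrow> rel_energy_density p \<rho>b \<sigma> v (r t) (U t) x = ?g x + ?h x" for x
    using rel_energy_density_eq[OF t, of x] by simp
  have g: "integrable \<nu> ?g"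
    by (intro Bochner_Integration.integrable_add Bochner_Integration.integrable_diff i)
  show "integrable \<nu> (rel_energy_density p \<rho>b \<sigma> v (r t) (U t))"
    using Bochner_Integration.integrable_cong[OF refl eq, THEN iffD2, OF _ Bochner_Integration.integrable_add[OF g i(5)]] .
  have "rel_energy \<Omega> p \<rho>b \<sigma> v (r t) (U t) = (LINT x|\<nu>. ?g x + ?h x)"
    unfolding rel_energy_def by (rule Bochner_Integration.integral_cong[OF refl eq])
  also have "\<dots> = (LINT x|\<nu>. ?g x) + (LINT x|\<nu>. ?h x)"
    by (rule Bochner_Integration.integral_add[OF g i(5)])
  also have "(LINT x|\<nu>. ?g x) = (LINT x|\<nu>. energy_density p \<rho>b \<sigma> v x)
        - (LINT x|\<nu>. (\<sigma> x *\<^sub>R v x) \<bullet> \<psi>U (t, x))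
        + (LINT x|\<nu>. \<sigma> x * (1/2 * (norm (\<psi>U (t, x)))\<^sup>2))
        - (LINT x|\<nu>. \<sigma> x * (dH p \<rho>b (r\<psi> (t, x)) - dH p \<rho>b \<rho>b))"
    by (subst integral_eq_linear_combination[OF i(1-4), where \<alpha> = 1 and \<beta> = "-1" and \<gamma> = 1 and \<delta> = "-1"]) auto
  finally show "rel_energy \<Omega> p \<rho>b \<sigma> v (r t) (U t)
      = (LINT x|\<nu>. energy_density p \<rho>b \<sigma> v x)
        - (LINT x|\<nu>. (\<sigma> x *\<^sub>R v x) \<bullet> \<psi>U (t, x))
        + (LINT x|\<nu>. \<sigma> x * (1/2 * (norm (\<psi>U (t, x)))\<^sup>2))
        - (LINT x|\<nu>. \<sigma> x * (dH p \<rho>b (r\<psi> (t, x)) - dH p \<rho>b \<rho>b))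
        + (LINT x|\<nu>. ?h x)" .
qed

lemma initial_rel_energy:
  "integrable \<nu> (rel_energy_density p \<rho>b \<rho>0 u0 (r 0) (U 0))"
  using rel_energy_eq(1)[OF _ \<rho>0_meas u0_meas integrable_initial_density energy0, of 0] T_pos by simp

text \<open>Subtracting \<open>rel_energy_eq\<close> at time 0 from that at \<tau> leaves five
  differences, supplied by the energy inequality, the momentum equation, the two tested continuity
  equations and \<open>time_integral_pressure\<close>. After integration they sum to at most T15 -
  T14 - (T2 + T4 + T5 - T6 + T7) + (T1 + T3) - T10 + T12. This is the remainder minus the
  dissipation, up to T11 + T13, whose integral vanishes; T8 and T9 occur in both and cancel.\<close>

lemma relative_energy_inequality:
  "AE \<tau> in lebesgue_on {0<..<T}.
     integrable \<nu> (rel_energy_density p \<rho>b (\<rho> \<tau>) (u \<tau>) (r \<tau>) (U \<tau>)) \<and>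
     rel_energy \<Omega> p \<rho>b (\<rho> \<tau>) (u \<tau>) (r \<tau>) (U \<tau>)
       + (LINT z|lebesgue_on (Q\<tau> \<tau>). (stress \<mu> \<eta> (DuQ z) - stress \<mu> \<eta> (vgrad (U (fst z)) (snd z)))
            \<bullet> (DuQ z - vgrad (U (fst z)) (snd z)))
     \<le> rel_energy \<Omega> p \<rho>b \<rho>0 u0 (r 0) (U 0)
       + (LINT t|lebesgue_on {0<..<\<tau>}. remainder \<mu> \<eta> p \<rho>b f \<Omega> \<rho> u Du r U t)"
proof -
  have in_T: "AE \<tau> in lebesgue_on {0<..<T}. \<tau> \<in> {0<..<T}"
    by (rule AE_I2) simp
  let ?G = "\<lambda>s. dH p \<rho>b s - dH p \<rho>b \<rho>b"
  have "AE \<tau> in lebesgue_on {0<..<T}.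
    (LINT x|\<nu>. \<rho> \<tau> x * ?G (r\<psi> (\<tau>, x))) - (LINT x|\<nu>. \<rho>0 x * ?G (r\<psi> (0, x)))
    = (LINT z|lebesgue_on (Q\<tau> \<tau>). T10 z)"
  proof (rule weak_continuity_C1)
    show "(?G has_real_derivative deriv p s / s) (at s)" if "s > 0" for s
      using dH_deriv[OF that] by (auto intro!: derivative_eq_intros)
    show "continuous_on {0<..} (\<lambda>s. deriv p s / s)"
      by (intro continuous_intros continuous_deriv_p) auto
  qed simp
  with in_T sections slice_integrable energy_AE weak_momentum_AE weak_continuity_kinetic
  show ?thesis
  proof eventually_elim
    case (elim \<tau>)
    have \<tau>T: "\<tau> \<le> T" "\<tau> \<in> {0..T}" and zT: "0 \<in> {0..T}" using elim by auto
    note i = integrable_terms[THEN integrable_Q\<tau>[OF _ \<tau>T(1)]]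
    define I where "I g = (LINT z|lebesgue_on (Q\<tau> \<tau>). g z)" for g :: "real \<times> (real^3) \<Rightarrow> real"
    have iE: "integrable \<nu> (energy_density p \<rho>b (\<rho> \<tau>) (u \<tau>))"
      using elim by simp
    have \<rho>u: "\<rho> \<tau> \<in> borel_measurable \<nu>" "u \<tau> \<in> borel_measurable \<nu>"
      "integrable \<nu> (\<lambda>x. indicator K x * \<rho> \<tau> x)"
      "integrable \<nu> (\<lambda>x. indicator K x * norm (\<rho> \<tau> x *\<^sub>R u \<tau> x))"
      using elim by auto
    note rel_\<tau> = rel_energy_eq[OF \<tau>T(2) \<rho>u iE]
    note rel_0 = rel_energy_eq(2)[OF zT \<rho>0_meas u0_meas integrable_initial_density energy0]
    have kin: "(LINT x|\<nu>. \<rho> \<tau> x * (1/2 * (norm (\<psi>U (\<tau>, x)))\<^sup>2))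
        - (LINT x|\<nu>. \<rho>0 x * (1/2 * (norm (\<psi>U (0, x)))\<^sup>2)) = I T1 + I T3"
      unfolding elim(6) I_def by (rule Bochner_Integration.integral_add[OF i(1,3)])
    have mom: "(LINT x|\<nu>. (\<rho> \<tau> x *\<^sub>R u \<tau> x) \<bullet> \<psi>U (\<tau>, x)) - (LINT x|\<nu>. (\<rho>0 x *\<^sub>R u0 x) \<bullet> \<psi>U (0, x))
        = I T2 + I T4 + I T5 - I T6 + I T7"
    proof -
      have eq: "tensor (\<rho>Q z *\<^sub>R uQ z) (uQ z) \<bullet> JU z = T4 z" for z
        by (simp add: tensor_inner)
      have "I (\<lambda>z. T2 z + T4 z + T5 z - T6 z + T7 z)
          = I (\<lambda>z. T2 z + T4 z + T5 z - T6 z) + I T7"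
        unfolding I_def by (intro Bochner_Integration.integral_add Bochner_Integration.integrable_add Bochner_Integration.integrable_diff i)
      also have "I (\<lambda>z. T2 z + T4 z + T5 z - T6 z) = I T2 + I T4 + I T5 - I T6"
        unfolding I_def
        by (subst integral_eq_linear_combination[OF i(2,4,5,6), where \<alpha> = 1 and \<beta> = 1 and \<gamma> = 1 and \<delta> = "-1"]) auto
      finally show ?thesis
        unfolding elim(5) eq I_def .
    qed
    have en: "(LINT x|\<nu>. energy_density p \<rho>b (\<rho> \<tau>) (u \<tau>) x) + I T14
        \<le> (LINT x|\<nu>. energy_density p \<rho>b \<rho>0 u0 x) + I T15"
      using elim(4) unfolding I_def by blast
    have flux: "I T13 + I T11 = 0"
      using space_time_integral_pressure_flux(2)[OF elim(1)] Bochner_Integration.integral_add[OF i(13,11)]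
      unfolding I_def by linarith
    have rem: "(LINT t|lebesgue_on {0<..<\<tau>}. remainder \<mu> \<eta> p \<rho>b f \<Omega> \<rho> u Du r U t)
        = (I T1 - I T2 + I T3 - I T4) + (I T8 - I T9)
      + (I T15 - I T7) + (I T12 + I T13 - I T10)
      - (I T5 - I T11)"
      unfolding I_def by (rule integral_remainder(1)[OF elim(1)])
    have str: "(LINT z|lebesgue_on (Q\<tau> \<tau>). (stress \<mu> \<eta> (DuQ z) - stress \<mu> \<eta> (vgrad (U (fst z)) (snd z)))
        \<bullet> (DuQ z - vgrad (U (fst z)) (snd z)))
      = I T14 - I T6 - I T9 + I T8"
      unfolding I_def by (rule integral_remainder(2)[OF elim(1)])
    note pr = time_integral_pressure(3)[OF elim(1) far_field_pressure, folded I_def]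
    note cont = elim(7)[folded I_def]
    show ?case
      using rel_\<tau>(1) en unfolding rel_\<tau>(2) rel_0 str rem
      using kin mom flux pr cont by (intro conjI) linarith+
  qed
qed

end

theorem theorem2p1:
  fixes \<Omega> :: "(real^3) set" and T \<rho>b \<gamma> a \<mu> \<eta> :: real
    and p :: "real \<Rightarrow> real"
    and f :: "real \<Rightarrow> real^3 \<Rightarrow> real^3"
    and \<rho>0 :: "real^3 \<Rightarrow> real" and u0 :: "real^3 \<Rightarrow> real^3"
    and \<rho> :: "real \<Rightarrow> real^3 \<Rightarrow> real" and u :: "real \<Rightarrow> real^3 \<Rightarrow> real^3"
    and Du :: "real \<Rightarrow> real^3 \<Rightarrow> real^3^3"
    and r :: "real \<Rightarrow> real^3 \<Rightarrow> real" and U :: "real \<Rightarrow> real^3 \<Rightarrow> real^3"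
  assumes domain: "open \<Omega>" "connected \<Omega>" "\<Omega> \<noteq> {}"
    and "T > 0" and "\<rho>b \<ge> 0" and "\<mu> > 0" and "\<eta> \<ge> 0"
    and p_cont: "continuous_on {0..} p"
    and p_C2: "\<And>z. z > 0 \<Longrightarrow> p differentiable (at z)"
              "\<And>z. z > 0 \<Longrightarrow> deriv p differentiable (at z)"
              "continuous_on {0<..} (deriv (deriv p))"
    and p_zero: "p 0 = 0"
    and p_mono: "\<And>z. z > 0 \<Longrightarrow> deriv p z > 0"
    and p_growth: "((\<lambda>z. deriv p z / z powr (\<gamma> - 1)) \<longlongrightarrow> a) at_top" "a > 0" "\<gamma> > 3/2"
    and H_finite: "\<rho>b = 0 \<Longrightarrow> (\<forall>s>0. set_integrable lborel {0<..<s} (\<lambda>z. p z / z\<^sup>2))"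
    and force: "Linf_L1_Linf T \<Omega> f"
    and solution: "finite_energy_weak_solution \<mu> \<eta> p \<gamma> \<rho>b f T \<Omega> \<rho>0 u0 \<rho> u Du"
    and U_test: "Cc_open T \<Omega> U"
    and r_pos: "\<And>t x. t \<in> {0..T} \<Longrightarrow> x \<in> closure \<Omega> \<Longrightarrow> r t x > 0"
    and r_test: "Cc_closure T \<Omega> (\<lambda>t x. r t x - \<rho>b)"
  shows "integrable (lebesgue_on \<Omega>) (rel_energy_density p \<rho>b \<rho>0 u0 (r 0) (U 0)) \<and>
    integrable (lebesgue_on ({0<..<T} \<times> \<Omega>)) (\<lambda>(t, x).
      (stress \<mu> \<eta> (Du t x) - stress \<mu> \<eta> (vgrad (U t) x)) \<bullet> (Du t x - vgrad (U t) x)) \<and>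
    remainder_integrable \<mu> \<eta> p \<rho>b f T \<Omega> \<rho> u Du r U \<and>
    (AE \<tau> in lebesgue_on {0<..<T}.
       integrable (lebesgue_on \<Omega>) (rel_energy_density p \<rho>b (\<rho> \<tau>) (u \<tau>) (r \<tau>) (U \<tau>)) \<and>
       rel_energy \<Omega> p \<rho>b (\<rho> \<tau>) (u \<tau>) (r \<tau>) (U \<tau>)
         + (LINT (t, x)|lebesgue_on ({0<..<\<tau>} \<times> \<Omega>).
              (stress \<mu> \<eta> (Du t x) - stress \<mu> \<eta> (vgrad (U t) x)) \<bullet> (Du t x - vgrad (U t) x))
       \<le> rel_energy \<Omega> p \<rho>b \<rho>0 u0 (r 0) (U 0)
         + (LINT t|lebesgue_on {0<..<\<tau>}. remainder \<mu> \<eta> p \<rho>b f \<Omega> \<rho> u Du r U t))"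
proof -
  obtain \<psi>U where \<psi>U: "smooth \<psi>U" "compact (supp \<psi>U)" "supp \<psi>U \<subseteq> UNIV \<times> \<Omega>"
    "\<And>t x. t \<in> {0..T} \<Longrightarrow> x \<in> \<Omega> \<Longrightarrow> U t x = \<psi>U (t, x)"
    using U_test by (auto simp: Cc_open_def)
  obtain \<psi>r where \<psi>r: "smooth \<psi>r" "compact (supp \<psi>r)"
    "\<And>t x. t \<in> {0..T} \<Longrightarrow> x \<in> closure \<Omega> \<Longrightarrow> r t x - \<rho>b = \<psi>r (t, x)"
    using r_test by (auto simp: Cc_closure_def)
  interpret weak_solution p \<rho>b \<Omega> T \<gamma> \<mu> \<eta> f \<rho>0 u0 \<rho> u Du r U \<psi>U \<psi>r
  proof
    show "\<gamma> > 1" using p_growth(3) by simp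
    show "r t x = \<rho>b + \<psi>r (t, x)" if "t \<in> {0..T}" "x \<in> closure \<Omega>" for t x
      using \<psi>r(3)[OF that] by simp
  qed (fact assms(5) p_cont p_C2(1,2) p_zero p_mono H_finite domain(1) \<open>T > 0\<close> force solution \<psi>U \<psi>r(1,2) r_pos)+
  show ?thesis
    unfolding split_beta'
    by (intro conjI initial_rel_energy remainder_integrable_Q(6) remainder_integrable relative_energy_inequality)
qed

end
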